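(* Given $\lambda,\mu,\nu\in\Pi_{n,k}$ with $|\lambda|+|\mu|-|\nu|=dN$, let $\gamma(\nu)=(s_\beta(T_\alpha|T))_{\emptyset\le\alpha,\beta\le\nu}$ with respect to the dominance order of partitions. Denote by $\Gamma(\nu)$ the matrix which is obtained by replacing the first column vector in $\gamma(\nu)$ with $(\tilde Z_{\lambda,\mu}(T_\nu|t),\ldots,\tilde Z_{\lambda,\mu}(T_\emptyset|t))^t$. Then $$q^dC_{\mu\nu^\vee}^{\lambda,d}(T)=\frac{\det\Gamma(\nu)}{\prod_{\rho\subseteq\nu}s_\rho(T_\rho|T)}.$$ In particular, setting $\nu=\emptyset$ this simplifies to $$q^dC_{\mu\,k^n}^{\lambda,d}(T)=\tilde Z_{\lambda,\mu}(t_{k^n}|t).$$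
   Context: $N=n+k$, $\Lambda=\mathbb Z[T_1,\dots,T_N]$, $t_i:=T_{N+1-i}$. $\mathcal V=\Lambda[q]\otimes V^{\otimes N}$ is free over $\Lambda[q]$ with basis $v_{\varepsilon_1}\otimes\cdots\otimes v_{\varepsilon_N}$, $\varepsilon_j\in\{0,1\}$; $\mathcal V_n$ is the span of those with $\sum_j\varepsilon_j=n$. $\Pi_{n,k}=\{\lambda:k\ge\lambda_1\ge\dots\ge\lambda_n\ge0\}$; $|\lambda\rangle$ is the basis vector of $\mathcal V_n$ with $\varepsilon_j=1$ iff $j=\lambda_{n+1-i}+i$ for some $i$; $\langle\lambda|$ is the dual basis. $\lambda^\vee=(k-\lambda_n,\dots,k-\lambda_1)$, $\lambda'$ is the conjugate partition, $k^n=(k,\dots,k)$. For $a=(a_1,\dots,a_N)$ and $\rho\in\Pi_{n,k}$, $a_\rho=(a_{\rho_1+n},a_{\rho_2+n-1},\dots,a_{\rho_n+1})$ (used with $a=T$ and $a=t$). Factorial Schur functions: $s_\lambda(x|a)=\det[(x_j|a)^{\lambda_i+n-i}]_{1\le i,j\le n}/\det[(x_j|a)^{n-i}]_{1\le i,j\le n}$, $(x|a)^r=\prod_{i=1}^r(x-a_i)$. In $\gamma(\nu)$ the row index is $\alpha$ and the column index is $\beta$, both listed from $\nu$ (first) to $\emptyset$ (last), as in the displayed replacement column. $\sigma^+v_0=v_1$, $\sigma^+v_1=0$, $\sigma^-v_1=v_0$, $\sigma^-v_0=0$; $$L_j(x)=\begin{pmatrix}1-xt_j\sigma_j^-\sigma_j^+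 & x\sigma_j^+\\ \sigma_j^- & x\sigma_j^-\sigma_j^+\end{pmatrix},\qquad L'_j(x)=\begin{pmatrix}1+xt_j\sigma_j^+\sigma_j^- & x\sigma_j^+\\ \sigma_j^- & x\sigma_j^+\sigma_j^-\end{pmatrix},$$ $L_N\cdots L_1=\begin{pmatrix}A&B\\C&D\end{pmatrix}$, $L'_N\cdots L'_1=\begin{pmatrix}A'&B'\\C'&D'\end{pmatrix}$, $H(x)=A+qD$, $E(x)=A'+qD'=\sum_rE_rx^r$. The (normalised) partition function of the vicious walker model with start positions given by $\mu$ and end positions given by $\lambda$ is $\tilde Z_{\lambda,\mu}(x_1,\dots,x_n|t)=(x_1\cdots x_n)^k\langle\lambda|H(x_n^{-1})\cdots H(x_1^{-1})|\mu\rangle$. $C_{\lambda\mu}^{\nu,d}(T)\in\Lambda$ are the equivariant 3-point genus zero Gromov–Witten invariants of the Grassmannian $\mathrm{Gr}_{n,N}$, i.e. the structure constants of the equivariant quantum product of Schubert classes, $\sigma_\lambda\ast\sigma_\mu=\sum_{\nu,d}q^dC_{\lambda\mu}^{\nu,d}(T)\sigma_\nu$; they are obtained from the matrix elements $\langle\nu|\tilde S_\lambda|\mu\rangle$, where $\tilde S_\lambda=\sum_{\mu\subseteq\lambda}(-1)^{|\lambda/\mu|}\det(e_{\lambda_i-\mu_j-i+j}(t_1,\dots,t_{n+\lambda_i-i}))_{1\le i,j\le n}S_\mu$ and $S_\lambda=\det(E_{\lambda'_i-i+j})_{1\le i,j\le k}$ (with $E_r=0$ for $r<0$), as operators on $\mathcal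 V_n$.
   Formalization: The left sides are read as sums over all d of q^d C^{λ,d}, without the condition |λ|+|μ|-|ν|=dN (a single such d fails for n=k=1, λ=μ=(1), ν=∅); γ(ν) is indexed by the partitions contained in ν, listed from ν to ∅ in any order refining dominance. *)

theory Defs
  imports
    "HOL-Library.Poly_Mapping"
    "HOL-Computational_Algebra.Polynomial"
    "HOL-Computational_Algebra.Fraction_Field"
    "HOL-Combinatorics.Permutations"
    "Jordan_Normal_Form.Determinant"
begin

section \<open>Coefficient rings\<close>

text \<open>
  Polynomials over the integers in variables indexed by natural numbers. For given \<open>n\<close> and \<open>k\<close>,
  every object below only involves the variables with index \<open>1, \<dots>, N = n + k\<close>, i.e. it lives in the
  subring \<open>\<int>[T\<^sub>1, \<dots>, T\<^sub>N]\<close>. The type is an integral domain.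
\<close>
type_synonym Lam = "(nat \<Rightarrow>\<^sub>0 nat) \<Rightarrow>\<^sub>0 int"

text \<open>\<open>\<Lambda>[q]\<close> is \<^typ>\<open>Lam poly\<close>, the polynomial variable being \<open>q\<close>; quotients are taken in
  its field of fractions.\<close>
type_synonym LamqF = "Lam poly fract"

definition Tvar :: "nat \<Rightarrow> Lam" where
  "Tvar i = Poly_Mapping.single (Poly_Mapping.single i 1) 1"

definition tvar :: "nat \<Rightarrow> nat \<Rightarrow> nat \<Rightarrow> Lam" where
  "tvar n k i = Tvar (n + k + 1 - i)"

definition emb :: "Lam \<Rightarrow> LamqF" where
  "emb a = Fract [:a:] 1"

definition qF :: LamqF where
  "qF = Fract [:0, 1:] 1"

abbreviation TF :: "nat \<Rightarrow> LamqF" where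
  "TF \<equiv> \<lambda>i. emb (Tvar i)"

abbreviation tF :: "nat \<Rightarrow> nat \<Rightarrow> nat \<Rightarrow> LamqF" where
  "tF n k \<equiv> \<lambda>i. emb (tvar n k i)"


section \<open>Partitions in the bounding box\<close>

text \<open>A partition in \<open>\<Pi>\<^sub>n\<^sub>,\<^sub>k\<close> is the list of its \<open>n\<close> parts, zeros included, so that
  \<open>\<lambda>\<^sub>i\<close> is \<open>lam ! (i - 1)\<close>.\<close>
definition Parts :: "nat \<Rightarrow> nat \<Rightarrow> nat list set" where
  "Parts n k = {lam. length lam = n \<and> sorted_wrt (\<ge>) lam \<and> (\<forall>p\<in>set lam. p \<le> k)}"

definition subpart :: "nat list \<Rightarrow> nat list \<Rightarrow> bool" where
  "subpart mu lam \<longleftrightarrow> list_all2 (\<le>) mu lam"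

definition dual_part :: "nat \<Rightarrow> nat list \<Rightarrow> nat list" where
  "dual_part k lam = rev (map (\<lambda>p. k - p) lam)"

definition conj_part :: "nat list \<Rightarrow> nat \<Rightarrow> nat" where
  "conj_part lam j = card {i. i < length lam \<and> j \<le> lam ! i}"

text \<open>Dominance order, comparing partial sums. The sizes are not required to agree, since it is
  used to list partitions of different sizes.\<close>
definition dominated :: "nat list \<Rightarrow> nat list \<Rightarrow> bool" where
  "dominated al be \<longleftrightarrow> length al = length be \<and>
     (\<forall>m\<le>length al. sum_list (take m al) \<le> sum_list (take m be))"

text \<open>The index set of \<open>\<gamma>(\<nu>)\<close>: all partitions \<open>\<emptyset> \<subseteq> \<rho> \<subseteq> \<nu>\<close>, listed from \<open>\<nu>\<close> down to \<open>\<emptyset>\<close> in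
  an order that refines the dominance order.\<close>
definition index_listing :: "nat \<Rightarrow> nat \<Rightarrow> nat list \<Rightarrow> nat list list \<Rightarrow> bool" where
  "index_listing n k nu rs \<longleftrightarrow>
     distinct rs \<and> set rs = {rho \<in> Parts n k. subpart rho nu} \<and>
     sorted_wrt (\<lambda>al be. \<not> dominated al be) rs"

text \<open>\<open>a\<^sub>\<rho> = (a\<^bsub>\<rho>\<^sub>1+n\<^esub>, a\<^bsub>\<rho>\<^sub>2+n-1\<^esub>, \<dots>, a\<^bsub>\<rho>\<^sub>n+1\<^esub>)\<close>, as a function on the indices \<open>1, \<dots>, n\<close>.\<close>
definition at_part :: "nat \<Rightarrow> (nat \<Rightarrow> 'a) \<Rightarrow> nat list \<Rightarrow> nat \<Rightarrow> 'a" where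
  "at_part n a rho i = a (rho ! (i - 1) + n + 1 - i)"


section \<open>Factorial Schur functions and elementary symmetric polynomials\<close>

definition fact_power :: "'a::comm_ring_1 \<Rightarrow> (nat \<Rightarrow> 'a) \<Rightarrow> nat \<Rightarrow> 'a" where
  "fact_power x a r = (\<Prod>i=1..r. x - a i)"

text \<open>Matrices are indexed from \<open>0\<close>; variables \<open>x\<^sub>1, \<dots>, x\<^sub>n\<close> and parameters \<open>a\<^sub>1, a\<^sub>2, \<dots>\<close> from \<open>1\<close>.\<close>
definition fact_schur :: "nat \<Rightarrow> nat list \<Rightarrow> (nat \<Rightarrow> 'a::field) \<Rightarrow> (nat \<Rightarrow> 'a) \<Rightarrow> 'a" where
  "fact_schur n lam x a =
     det (mat n n (\<lambda>(i, j). fact_power (x (j + 1)) a (lam ! i + n - (i + 1)))) /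
     det (mat n n (\<lambda>(i, j). fact_power (x (j + 1)) a (n - (i + 1))))"

definition elem_sym :: "int \<Rightarrow> nat \<Rightarrow> (nat \<Rightarrow> 'a::comm_ring_1) \<Rightarrow> 'a" where
  "elem_sym r m a =
     (if r < 0 then 0 else (\<Sum>X | X \<subseteq> {1..m} \<and> card X = nat r. \<Prod>i\<in>X. a i))"


section \<open>Operators on the spin chain\<close>

text \<open>
  The basis vector \<open>v\<^bsub>\<epsilon>\<^sub>1\<^esub> \<otimes> \<cdots> \<otimes> v\<^bsub>\<epsilon>\<^sub>N\<^esub>\<close> is encoded by the set \<open>{j. \<epsilon>\<^sub>j = 1} \<subseteq> {1..N}\<close> and a vector
  by its coefficient function on these sets. All operators below only touch sites in \<open>{1..N}\<close>, so
  the values of a coefficient function on sets not contained in \<open>{1..N}\<close> never interact with the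
  values on subsets of \<open>{1..N}\<close>.
\<close>
type_synonym 'a vect = "nat set \<Rightarrow> 'a"
type_synonym 'a endo = "'a vect \<Rightarrow> 'a vect"

definition sigma_plus :: "nat \<Rightarrow> 'a::zero endo" where
  "sigma_plus j f S = (if j \<in> S then f (S - {j}) else 0)"

definition sigma_minus :: "nat \<Rightarrow> 'a::zero endo" where
  "sigma_minus j f S = (if j \<in> S then 0 else f (insert j S))"

text \<open>\<open>Block a b c d\<close> is the operator-valued \<open>2 \<times> 2\<close> matrix with rows \<open>(a, b)\<close> and \<open>(c, d)\<close>.\<close>
datatype 'a block =
  Block (blockA: "'a endo") (blockB: "'a endo") (blockC: "'a endo") (blockD: "'a endo")

fun block_mult :: "'a::comm_ring_1 block \<Rightarrow> 'a block \<Rightarrow> 'a block" where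
  "block_mult (Block a b c d) (Block a' b' c' d') =
     Block (\<lambda>f S. a (a' f) S + b (c' f) S) (\<lambda>f S. a (b' f) S + b (d' f) S)
           (\<lambda>f S. c (a' f) S + d (c' f) S) (\<lambda>f S. c (b' f) S + d (d' f) S)"

definition block_one :: "'a::comm_ring_1 block" where
  "block_one = Block (\<lambda>f. f) (\<lambda>f S. 0) (\<lambda>f S. 0) (\<lambda>f. f)"

definition L_op :: "(nat \<Rightarrow> 'a::comm_ring_1) \<Rightarrow> 'a \<Rightarrow> nat \<Rightarrow> 'a block" where
  "L_op a x j = Block
     (\<lambda>f S. f S - x * a j * sigma_minus j (sigma_plus j f) S)
     (\<lambda>f S. x * sigma_plus j f S)
     (sigma_minus j)
     (\<lambda>f S. x * sigma_minus j (sigma_plus j f) S)"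

definition L'_op :: "(nat \<Rightarrow> 'a::comm_ring_1) \<Rightarrow> 'a \<Rightarrow> nat \<Rightarrow> 'a block" where
  "L'_op a x j = Block
     (\<lambda>f S. f S + x * a j * sigma_plus j (sigma_minus j f) S)
     (\<lambda>f S. x * sigma_plus j f S)
     (sigma_minus j)
     (\<lambda>f S. x * sigma_plus j (sigma_minus j f) S)"

text \<open>\<open>monodromy L N\<close> is \<open>L\<^sub>N \<cdots> L\<^sub>1\<close>.\<close>
primrec monodromy :: "(nat \<Rightarrow> 'a::comm_ring_1 block) \<Rightarrow> nat \<Rightarrow> 'a block" where
  "monodromy L 0 = block_one"
| "monodromy L (Suc j) = block_mult (L (Suc j)) (monodromy L j)"

text \<open>The transfer matrices \<open>H(x)\<close> and \<open>E(x)\<close> over an arbitrary commutative ring, with the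
  equivariant parameters \<open>t\<^sub>j\<close> and the deformation parameter \<open>q\<close> given as ring elements \<open>a j\<close>, \<open>q\<close>.\<close>
definition H_op :: "nat \<Rightarrow> (nat \<Rightarrow> 'a::comm_ring_1) \<Rightarrow> 'a \<Rightarrow> 'a \<Rightarrow> 'a endo" where
  "H_op N a q x f S =
     blockA (monodromy (L_op a x) N) f S + q * blockD (monodromy (L_op a x) N) f S"

definition E_op :: "nat \<Rightarrow> (nat \<Rightarrow> 'a::comm_ring_1) \<Rightarrow> 'a \<Rightarrow> 'a \<Rightarrow> 'a endo" where
  "E_op N a q x f S =
     blockA (monodromy (L'_op a x) N) f S + q * blockD (monodromy (L'_op a x) N) f S"

text \<open>The coefficient \<open>E\<^sub>r\<close> of \<open>x\<^sup>r\<close> in \<open>E(x)\<close>: apply \<open>E(x)\<close>, with \<open>x\<close> the polynomial variable, to a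
  vector with constant entries and take coefficients.\<close>
definition E_coeff :: "nat \<Rightarrow> (nat \<Rightarrow> 'a::comm_ring_1) \<Rightarrow> 'a \<Rightarrow> int \<Rightarrow> 'a endo" where
  "E_coeff N a q r f S =
     (if r < 0 then 0
      else poly.coeff (E_op N (\<lambda>j. [:a j:]) [:q:] [:0, 1:] (\<lambda>S'. [:f S':]) S) (nat r))"

text \<open>\<open>S\<^sub>\<lambda> = det(E\<^bsub>\<lambda>'\<^sub>i-i+j\<^esub>)\<close>, by the Leibniz formula; each product of operators is taken in the
  order of the rows.\<close>
definition S_op :: "nat \<Rightarrow> nat \<Rightarrow> (nat \<Rightarrow> 'a::comm_ring_1) \<Rightarrow> 'a \<Rightarrow> nat list \<Rightarrow> 'a endo" where
  "S_op n k a q lam f S =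
     (\<Sum>p | p permutes {1..k}. of_int (sign p) *
        foldr (\<lambda>i. E_coeff (n + k) a q (int (conj_part lam i) - int i + int (p i)))
          [1..<k + 1] f S)"

definition S_tilde :: "nat \<Rightarrow> nat \<Rightarrow> (nat \<Rightarrow> 'a::comm_ring_1) \<Rightarrow> 'a \<Rightarrow> nat list \<Rightarrow> 'a endo" where
  "S_tilde n k a q lam f S =
     (\<Sum>mu | mu \<in> Parts n k \<and> subpart mu lam.
        (- 1) ^ (sum_list lam - sum_list mu) *
        det (mat n n (\<lambda>(i, j).
          elem_sym (int (lam ! i) - int (mu ! j) - int i + int j) (n + lam ! i - (i + 1)) a)) *
        S_op n k a q mu f S)"

definition part_state :: "nat \<Rightarrow> nat list \<Rightarrow> nat set" where
  "part_state n lam = (\<lambda>i. lam ! (n - i) + i) ` {1..n}"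

definition ket :: "nat \<Rightarrow> nat list \<Rightarrow> 'a::comm_ring_1 vect" where
  "ket n lam S = (if S = part_state n lam then 1 else 0)"

text \<open>\<open>\<langle>\<nu>|X|\<mu>\<rangle>\<close>\<close>
definition matrix_element :: "nat \<Rightarrow> nat list \<Rightarrow> 'a::comm_ring_1 endo \<Rightarrow> nat list \<Rightarrow> 'a" where
  "matrix_element n nu X mu = X (ket n mu) (part_state n nu)"


section \<open>Gromov--Witten invariants and the partition function\<close>

text \<open>\<open>GW n k \<lambda> \<mu> \<nu> d\<close> is \<open>C\<^sub>\<lambda>\<^sub>\<mu>\<^sup>\<nu>\<^sup>,\<^sup>d(T)\<close>. Under the identification \<open>\<sigma>\<^sub>\<mu> \<mapsto> |\<mu>\<rangle>\<close> the operator of quantum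
  multiplication by \<open>\<sigma>\<^sub>\<lambda>\<close> is \<open>S\<^sup>~\<^sub>\<lambda>\<close>, so \<open>C\<^sub>\<lambda>\<^sub>\<mu>\<^sup>\<nu>\<^sup>,\<^sup>d\<close> is the coefficient of \<open>q\<^sup>d\<close> in
  \<open>\<langle>\<nu>|S\<^sup>~\<^sub>\<lambda>|\<mu>\<rangle> \<in> \<Lambda>[q]\<close>. Equivariantly, \<open>C\<^sub>\<lambda>\<^sub>\<mu>\<^sup>\<nu>\<^sup>,\<^sup>d\<close> can be nonzero for several \<open>d\<close> with \<open>\<lambda>\<close>, \<open>\<mu>\<close>, \<open>\<nu>\<close>
  fixed, so identities for \<open>q\<^sup>d C\<^sub>\<lambda>\<^sub>\<mu>\<^sup>\<nu>\<^sup>,\<^sup>d\<close> are to be read with summation over \<open>d\<close>.\<close>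
definition GW :: "nat \<Rightarrow> nat \<Rightarrow> nat list \<Rightarrow> nat list \<Rightarrow> nat list \<Rightarrow> nat \<Rightarrow> Lam" where
  "GW n k lam mu nu d =
     poly.coeff (matrix_element n nu (S_tilde n k (\<lambda>j. [:tvar n k j:]) [:0, 1:] lam) mu) d"

text \<open>The variables \<open>x\<^sub>1, \<dots>, x\<^sub>n\<close> take nonzero values in the fraction field of \<open>\<Lambda>[q]\<close>; the operator
  \<open>H(x\<^sub>1\<^sup>-\<^sup>1)\<close> acts first.\<close>
definition Z_tilde :: "nat \<Rightarrow> nat \<Rightarrow> nat list \<Rightarrow> nat list \<Rightarrow> (nat \<Rightarrow> LamqF) \<Rightarrow> LamqF" where
  "Z_tilde n k lam mu x =
     (\<Prod>i=1..n. x i) ^ k *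
     matrix_element n lam
       (foldr (\<lambda>i. H_op (n + k) (tF n k) qF (inverse (x i))) (rev [1..<n + 1])) mu"

definition gamma_mat :: "nat \<Rightarrow> nat list list \<Rightarrow> LamqF mat" where
  "gamma_mat n rs = mat (length rs) (length rs)
     (\<lambda>(r, c). fact_schur n (rs ! c) (at_part n TF (rs ! r)) TF)"

definition Gamma_mat ::
  "nat \<Rightarrow> nat \<Rightarrow> nat list \<Rightarrow> nat list \<Rightarrow> nat list list \<Rightarrow> LamqF mat" where
  "Gamma_mat n k lam mu rs =
     replace_col (gamma_mat n rs)
       (vec (length rs) (\<lambda>r. Z_tilde n k lam mu (at_part n TF (rs ! r)))) 0"


section \<open>Existence of the listings\<close>

lemma finite_Parts: "finite (Parts n k)"
  by (rule finite_subset[OF _ finite_lists_length_eq[of "{..k}" n]]) (auto simp: Parts_def)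

lemma dominated_antisym:
  assumes "dominated al be" "dominated be al"
  shows "al = be"
proof -
  have len: "length al = length be" using assms by (simp add: dominated_def)
  have eq: "sum_list (take m al) = sum_list (take m be)" if "m \<le> length al" for m
    using assms that len by (auto simp: dominated_def intro: antisym)
  show ?thesis
  proof (rule nth_equalityI[OF len])
    fix i assume i: "i < length al"
    show "al ! i = be ! i"
      using eq[of i] eq[of "Suc i"] i len by (simp add: take_Suc_conv_app_nth)
  qed
qed

lemma index_listing_exists: "\<exists>rs. index_listing n k nu rs"
proof -
  define A where "A = {rho \<in> Parts n k. subpart rho nu}"
  define key where "key al = (\<Sum>m\<le>n. sum_list (take m al))" for al :: "nat list"
  have fin: "finite A" unfolding A_def using finite_Parts by simp
  obtain xs where xs: "set xs = A" "distinct xs" using finite_distinct_list[OF fin] by blast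
  define rs where "rs = rev (sort_key key xs)"
  have rs: "set rs = A" "distinct rs" using xs by (auto simp: rs_def)
  have len: "length al = n" if "al \<in> A" for al using that by (simp add: A_def Parts_def)
  have strict: "key al < key be" if "al \<in> A" "be \<in> A" "dominated al be" "al \<noteq> be" for al be
  proof -
    have le: "sum_list (take m al) \<le> sum_list (take m be)" if "m \<le> n" for m
      using \<open>dominated al be\<close> that len[OF \<open>al \<in> A\<close>] by (simp add: dominated_def)
    have "\<not> dominated be al" using that dominated_antisym by blast
    then obtain m where "m \<le> n" "sum_list (take m al) < sum_list (take m be)"
      using len[OF \<open>al \<in> A\<close>] len[OF \<open>be \<in> A\<close>] by (auto simp: dominated_def not_le)
    then show ?thesis unfolding key_def
      by (intro sum_strict_mono_ex1) (use le in auto)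
  qed
  have "sorted (map key (sort_key key xs))" by simp
  then have sorted: "sorted_wrt (\<lambda>al be. key be \<le> key al) rs"
    by (simp add: rs_def sorted_wrt_rev sorted_wrt_map)
  have "sorted_wrt (\<lambda>al be. \<not> dominated al be) rs"
    unfolding sorted_wrt_iff_nth_less
  proof (intro allI impI)
    fix i j assume ij: "i < j" "j < length rs"
    then have "key (rs ! j) \<le> key (rs ! i)" using sorted by (simp add: sorted_wrt_iff_nth_less)
    moreover have "rs ! i \<noteq> rs ! j" using ij rs(2) by (simp add: nth_eq_iff_index_eq)
    moreover have "rs ! i \<in> A" "rs ! j \<in> A" using ij rs(1) nth_mem[of _ rs] by auto
    ultimately show "\<not> dominated (rs ! i) (rs ! j)" using strict[of "rs ! i" "rs ! j"] by auto
  qed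
  with rs show ?thesis unfolding index_listing_def A_def by blast
qed

end

theory Submission
  imports Defs "Jordan_Normal_Form.Char_Poly" "HOL-Algebra.Algebraic_Closure_Type"
begin

text \<open>
  Both sides are compared on common left eigenvectors of all operators involved. Put
  \<open>P(z) = (z - t\<^sub>1) \<cdots> (z - t\<^sub>N) + (-1)\<^sup>n q\<close> and let \<open>z\<^sub>1, \<dots>, z\<^sub>n\<close> be roots of \<open>P\<close>. Let \<open>\<phi>\<close>
  be the linear functional on the \<open>n\<close>-particle space whose value at the state with occupied sites
  \<open>s\<^sub>1 > \<cdots> > s\<^sub>n\<close> is \<open>det ((z\<^sub>j - t\<^sub>1) \<cdots> (z\<^sub>j - t\<^bsub>s\<^sub>i - 1\<^esub>))\<close>, a determinant with one row per particle.
  Hops of particles become row operations, the exclusion of double occupancy becomes the vanishing of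
  a determinant with equal rows, and \<open>P(z\<^sub>j) = 0\<close> says that a hop from site \<open>N\<close> leads back to site
  \<open>1\<close>. Hence \<open>\<phi>\<close> is an eigenvector of \<open>E(x)\<close> with eigenvalue \<open>\<Prod>\<^sub>j (1 + x z\<^sub>j)\<close>
  (\<open>slater_E_op\<close>) and of \<open>x\<^sup>k H(1/x)\<close> with eigenvalue \<open>P(x) / \<Prod>\<^sub>j (x - z\<^sub>j)\<close> (\<open>slater_H_op\<close>).

  By the dual Jacobi-Trudi formula the operator \<open>S\<^sub>\<lambda>\<close> acts on \<open>\<phi>\<close> as the Schur polynomial
  \<open>s\<^sub>\<lambda>(z)\<close>, and the alternating sum that defines \<open>S\<^sup>~\<^sub>\<lambda>\<close> is the expansion of the factorial Schur
  function \<open>s\<^sub>\<lambda>(z|t)\<close> in Schur polynomials (\<open>factorial_schur_dual_jt\<close>). Since \<open>\<phi>|\<mu>\<rangle>\<close> is the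
  alternant \<open>a\<^sub>\<mu>(z|t)\<close>, the value of \<open>\<phi>\<close> at \<open>S\<^sup>~\<^sub>\<mu>|\<nu>\<^sup>\<or>\<rangle>\<close> is
  \<open>a\<^sub>\<mu>(z|t) a\<^bsub>\<nu>\<^sup>\<or>\<^esub>(z|t) / a\<^sub>\<emptyset>(z|t)\<close>. This is symmetric in the two partitions, which
  is how the commutativity of the quantum product enters.

  The value of \<open>\<phi>\<close> at the vector of partition functions that starts from \<open>|\<mu>\<rangle>\<close> is
  \<open>a\<^sub>\<mu>(z|t) \<Prod>\<^sub>i P(x\<^sub>i) / \<Prod>\<^sub>i\<^sub>,\<^sub>j (x\<^sub>i - z\<^sub>j)\<close>, and \<open>cauchy_identity\<close> expands the quotient of products as
  \<open>\<Sum>\<^sub>\<nu> s\<^sub>\<nu>(x|T) s\<^bsub>\<nu>\<^sup>\<or>\<^esub>(z|t)\<close>. As \<open>P\<close> has \<open>N\<close> distinct roots in a suitable field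
  (\<open>distinct_bethe_roots\<close>), the functionals \<open>\<phi>\<close> separate the vectors of the \<open>n\<close>-particle space
  (\<open>slater_complete\<close>), and therefore the normalised partition function from \<open>\<mu>\<close> to \<open>\<lambda>\<close> equals
  \<open>\<Sum>\<^sub>\<nu> s\<^sub>\<nu>(x|T) \<langle>\<lambda>|S\<^sup>~\<^sub>\<mu>|\<nu>\<^sup>\<or>\<rangle>\<close> (\<open>partition_function_factorial_schur\<close>).

  It remains to evaluate this at \<open>x = T\<^sub>\<rho>\<close>. Because \<open>s\<^sub>\<nu>(T\<^sub>\<rho>|T)\<close> vanishes unless \<open>\<nu> \<subseteq> \<rho>\<close> and is nonzero
  for \<open>\<nu> = \<rho>\<close>, the equations for \<open>\<rho> \<subseteq> \<nu>\<close> form a triangular linear system, which Cramer's rule solves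
  for the invariant belonging to \<open>\<nu>\<close>. At \<open>x = (T\<^sub>1, \<dots>, T\<^sub>n)\<close> only the term \<open>\<nu> = \<emptyset>\<close> survives.
\<close>

section \<open>Alternating products of row vectors\<close>

lemma det_mat: "det (mat n n (\<lambda>(i, j). f i j)) = (\<Sum>p | p permutes {0..<n}. signof p * (\<Prod>i = 0..<n. f i (p i)))"
proof -
  have "det (mat n n (\<lambda>(i, j). f i j)) =
      (\<Sum>p | p permutes {0..<n}. signof p * (\<Prod>i = 0..<n. mat n n (\<lambda>(i, j). f i j) $$ (i, p i)))"
    by (rule det_def') simp
  also have "\<dots> = (\<Sum>p | p permutes {0..<n}. signof p * (\<Prod>i = 0..<n. f i (p i)))"
    by (intro sum.cong refl arg_cong2[where f = "(*)"] prod.cong) (auto simp: permutes_in_image)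
  finally show ?thesis .
qed

text \<open>
  The value \<open>0\<close> for lists of the wrong length makes the rules below hold for all lists, and lets sums
  over all states of the chain pick out the states with the right number of particles.
\<close>
definition wedge :: "nat \<Rightarrow> (nat \<Rightarrow> 'a::comm_ring_1) list \<Rightarrow> 'a" where
  "wedge n rs = (if length rs = n then det (mat n n (\<lambda>(i, j). (rs ! i) j)) else 0)"

lemma wedge_leibniz:
  assumes "length rs = n"
  shows "wedge n rs = (\<Sum>p | p permutes {0..<n}. signof p * (\<Prod>i = 0..<n. (rs ! i) (p i)))"
  using assms by (simp add: wedge_def det_mat)

lemma wedge_linear:
  "wedge n (ps @ (\<lambda>j. c * u j + d * v j) # ss) = c * wedge n (ps @ u # ss) + d * wedge n (ps @ v # ss)"
proof (cases "length ps + length ss + 1 = n")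
  case True
  define k where "k = length ps"
  have k: "k \<in> {0..<n}" using True by (simp add: k_def)
  have split: "(\<Prod>i = 0..<n. ((ps @ w # ss) ! i) (p i)) =
      w (p k) * (\<Prod>i\<in>{0..<n} - {k}. ((ps @ u # ss) ! i) (p i))" for w p
  proof -
    have "(\<Prod>i\<in>{0..<n} - {k}. ((ps @ w # ss) ! i) (p i)) = (\<Prod>i\<in>{0..<n} - {k}. ((ps @ u # ss) ! i) (p i))"
      by (intro prod.cong refl) (auto simp: nth_append k_def nth_Cons split: nat.splits)
    then show ?thesis using k by (subst prod.remove[of _ k]) (auto simp: k_def)
  qed
  show ?thesis
    using True
    by (simp add: wedge_leibniz split[of "\<lambda>j. c * u j + d * v j"] split[of u] split[of v] sum_distrib_left
        flip: sum.distrib) (auto intro!: sum.cong simp: algebra_simps)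
next
  case False
  then show ?thesis by (auto simp: wedge_def)
qed

text \<open>
  Pauli exclusion: a configuration in which a particle arrives at an occupied site contributes nothing.
\<close>
lemma wedge_dup: "wedge n (ps @ u # u # ss) = 0"
proof (cases "length ps + length ss + 2 = n")
  case True
  have "det (mat n n (\<lambda>(i, j). ((ps @ u # u # ss) ! i) j)) = 0"
  proof (rule det_identical_rows[of _ n "length ps" "Suc (length ps)"])
    show "row (mat n n (\<lambda>(i, j). ((ps @ u # u # ss) ! i) j)) (length ps) =
      row (mat n n (\<lambda>(i, j). ((ps @ u # u # ss) ! i) j)) (Suc (length ps))"
      using True by (intro eq_vecI) (auto simp: nth_append)
  qed (use True in auto)
  then show ?thesis by (simp add: wedge_def)
qed (auto simp: wedge_def)

lemma wedge_add: "wedge n (ps @ (\<lambda>j. u j + v j) # ss) = wedge n (ps @ u # ss) + wedge n (ps @ v # ss)"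
  using wedge_linear[of n ps 1 u 1 v ss] by simp

lemma wedge_swap: "wedge n (ps @ u # v # ss) = - wedge n (ps @ v # u # ss)"
proof -
  have "0 = wedge n (ps @ (\<lambda>j. u j + v j) # (\<lambda>j. u j + v j) # ss)" by (simp add: wedge_dup)
  also have "\<dots> = wedge n (ps @ u # (\<lambda>j. u j + v j) # ss) + wedge n (ps @ v # (\<lambda>j. u j + v j) # ss)"
    by (rule wedge_add)
  also have "\<dots> = wedge n (ps @ u # v # ss) + wedge n (ps @ v # u # ss)"
    using wedge_add[of n "ps @ [u]" u v ss] wedge_add[of n "ps @ [v]" u v ss] by (simp add: wedge_dup)
  finally show ?thesis by (simp add: eq_neg_iff_add_eq_0)
qed

lemma wedge_move: "wedge n (ps @ u # vs @ ss) = (- 1) ^ length vs * wedge n (ps @ vs @ u # ss)"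
proof (induction vs arbitrary: ps)
  case (Cons v vs)
  have "wedge n (ps @ u # (v # vs) @ ss) = - wedge n ((ps @ [v]) @ u # vs @ ss)"
    by (simp add: wedge_swap[of n ps u v])
  then show ?case by (simp only: Cons.IH) simp
qed simp

lemma wedge_cong:
  assumes "length rs = length rs'" and "\<And>i j. i < length rs \<Longrightarrow> j < n \<Longrightarrow> (rs ! i) j = (rs' ! i) j"
  shows "wedge n rs = wedge n rs'"
  using assms by (auto simp: wedge_def intro!: arg_cong[of _ _ det] eq_matI)

lemma wedge_scale_columns:
  "wedge n (map (\<lambda>v j. d j * v j) rs) = (\<Prod>j<n. d j) * wedge n rs"
proof (cases "length rs = n")
  case True
  have eq: "(\<Prod>i = 0..<n. (map (\<lambda>v j. d j * v j) rs ! i) (p i)) = (\<Prod>j<n. d j) * (\<Prod>i = 0..<n. (rs ! i) (p i))"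
    if "p permutes {0..<n}" for p
  proof -
    have "(\<Prod>i = 0..<n. (map (\<lambda>v j. d j * v j) rs ! i) (p i)) = (\<Prod>i = 0..<n. d (p i) * (rs ! i) (p i))"
      using True by (intro prod.cong) auto
    also have "\<dots> = (\<Prod>i = 0..<n. d (p i)) * (\<Prod>i = 0..<n. (rs ! i) (p i))"
      by (rule prod.distrib)
    also have "(\<Prod>i = 0..<n. d (p i)) = (\<Prod>j<n. d j)"
      using prod.permute[OF that, of d, symmetric] by (simp only: comp_def atLeast0LessThan)
    finally show ?thesis .
  qed
  have "wedge n (map (\<lambda>v j. d j * v j) rs) = 
      (\<Sum>p | p permutes {0..<n}. (\<Prod>j<n. d j) * (signof p * (\<Prod>i = 0..<n. (rs ! i) (p i))))"
    using True eq by (subst wedge_leibniz) (auto intro!: sum.cong simp: algebra_simps)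
  then show ?thesis using True by (simp only: wedge_leibniz sum_distrib_left)
qed (simp add: wedge_def)

lemma (in comm_ring_hom) hom_wedge: "wedge n (map (\<lambda>v j. hom (v j)) rs) = hom (wedge n rs)"
  by (auto simp: wedge_def simp flip: hom_det intro!: arg_cong[of _ _ det] eq_matI)


section \<open>The transfer matrices as row operations\<close>

text \<open>
  Sites are listed in decreasing order, so that a new last site of the chain is added in front.
\<close>
definition dseq :: "nat set \<Rightarrow> nat list" where
  "dseq S = rev (sorted_list_of_set S)"

lemma dseq_empty [simp]: "dseq {} = []"
  by (simp add: dseq_def)

lemma dseq_insert_Suc: 
  assumes "S \<subseteq> {1..m}" shows "dseq (insert (Suc m) S) = Suc m # dseq S"
proof -
  have fin: "finite S" using assms finite_subset by blast
  have "sorted_list_of_set (insert (Suc m) S) = sorted_list_of_set S @ [Suc m]"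
  proof (rule sorted_distinct_set_unique)
    show "sorted (sorted_list_of_set S @ [Suc m])" using assms fin by (fastforce simp: sorted_append)
    show "distinct (sorted_list_of_set S @ [Suc m])" using assms fin by auto
  qed (use fin in \<open>auto simp: set_insort_key distinct_insort sorted_insort\<close>)
  then show ?thesis by (simp add: dseq_def)
qed

text \<open>
  The functional that sends the state \<open>S\<close> to the alternating product of the rows \<open>w\<^sub>s\<close>, \<open>s \<in> S\<close>. The
  prefix \<open>ps\<close> holds rows of particles at sites beyond \<open>m\<close>, and the suffix \<open>ss\<close> rows of particles that
  entered at site \<open>1\<close>; both are needed to run inductions over the length of the chain.
\<close>
definition slater :: 
  "nat \<Rightarrow> (nat \<Rightarrow> nat \<Rightarrow> 'a::comm_ring_1) \<Rightarrow> nat \<Rightarrow> 'a vect \<Rightarrow>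
   (nat \<Rightarrow> 'a) list \<Rightarrow> (nat \<Rightarrow> 'a) list \<Rightarrow> 'a" where
  "slater n w m f ps ss = (\<Sum>S\<in>Pow {1..m}. f S * wedge n (ps @ map w (dseq S) @ ss))"

lemma slater_0: "slater n w 0 f ps ss = f {} * wedge n (ps @ ss)"
  by (simp add: slater_def)

lemma slater_Suc:
  "slater n w (Suc m) f ps ss =
     slater n w m f ps ss + slater n w m (\<lambda>S. f (insert (Suc m) S)) (ps @ [w (Suc m)]) ss"
proof -
  have inj: "inj_on (insert (Suc m)) (Pow {1..m})"
  proof (rule inj_onI)
    fix S S' assume "S \<in> Pow {1..m}" "S' \<in> Pow {1..m}" and eq: "insert (Suc m) S = insert (Suc m) S'"
    then have "Suc m \<notin> S" "Suc m \<notin> S'" by auto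
    with eq show "S = S'" by (simp add: insert_ident)
  qed
  have "Pow {1..Suc m} = Pow {1..m} \<union> insert (Suc m) ` Pow {1..m}"
    by (simp add: atLeastAtMostSuc_conv Pow_insert)
  then have "slater n w (Suc m) f ps ss = slater n w m f ps ss +
      (\<Sum>S\<in>insert (Suc m) ` Pow {1..m}. f S * wedge n (ps @ map w (dseq S) @ ss))"
    unfolding slater_def by (simp, subst sum.union_disjoint) auto
  also have "(\<Sum>S\<in>insert (Suc m) ` Pow {1..m}. f S * wedge n (ps @ map w (dseq S) @ ss)) =
      slater n w m (\<lambda>S. f (insert (Suc m) S)) (ps @ [w (Suc m)]) ss"
    unfolding slater_def
    by (subst sum.reindex[OF inj]) (intro sum.cong, auto simp: dseq_insert_Suc)
  finally show ?thesis .
qed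

lemma slater_cong:
  assumes "\<And>S. S \<subseteq> {1..m} \<Longrightarrow> f S = g S"
  shows "slater n w m f ps ss = slater n w m g ps ss"
  unfolding slater_def using assms by (intro sum.cong) auto

lemma slater_linear:
  "slater n w m (\<lambda>S. c * f S + d * g S) ps ss = c * slater n w m f ps ss + d * slater n w m g ps ss"
  by (simp add: slater_def sum_distrib_left algebra_simps sum.distrib)

lemma slater_add: "slater n w m (\<lambda>S. f S + g S) ps ss = slater n w m f ps ss + slater n w m g ps ss"
  using slater_linear[of n w m 1 f 1 g] by simp

lemma slater_scale: "slater n w m (\<lambda>S. c * f S) ps ss = c * slater n w m f ps ss"
  using slater_linear[of n w m c f 0 f] by simp

lemma slater_zero: "slater n w m (\<lambda>S. 0) ps ss = 0"
  by (simp add: slater_def)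

lemma slater_prefix_linear:
  "slater n w m f (ps @ (\<lambda>j. c * u j + d * v j) # qs) ss = 
   c * slater n w m f (ps @ u # qs) ss + d * slater n w m f (ps @ v # qs) ss"
  by (simp add: slater_def wedge_linear sum_distrib_left algebra_simps sum.distrib)

lemma slater_prefix_dup: "slater n w m f (ps @ u # u # qs) ss = 0"
  by (simp add: slater_def wedge_dup)

lemma slater_prefix_swap: "slater n w m f (ps @ u # v # qs) ss = - slater n w m f (ps @ v # u # qs) ss"
  by (simp add: slater_def wedge_swap[of n ps u v] sum_negf)

lemma slater_prefix_scale: "slater n w m f (ps @ [\<lambda>j. c * u j]) ss = c * slater n w m f (ps @ [u]) ss"
  using slater_prefix_linear[of n w m f ps c u 0 u "[]" ss] by simp

lemma slater_prefix_cong: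
  assumes "\<And>j. j < n \<Longrightarrow> u j = v j"
  shows "slater n w m f [u] ss = slater n w m f [v] ss"
  unfolding slater_def using assms
  by (intro sum.cong refl arg_cong2[where f = "(*)"] wedge_cong) (auto simp: nth_Cons split: nat.splits)

text \<open>
  Only states with \<open>n - 1\<close> particles contribute, so that \<open>u\<close> moves past \<open>n - 1\<close> rows.
\<close>
lemma slater_rotate: "slater n w m f [u] [] = - ((- 1) ^ n) * slater n w m f [] [u]"
proof -
  have "wedge n (u # map w (dseq S)) = - ((- 1) ^ n) * wedge n (map w (dseq S) @ [u])" for S
  proof (cases "length (dseq S) + 1 = n")
    case True
    then show ?thesis using wedge_move[of n "[]" u "map w (dseq S)" "[]"] by auto
  qed (auto simp: wedge_def)
  then show ?thesis by (simp add: slater_def sum_distrib_left algebra_simps sum_negf)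
qed

lemma slater_scale_columns:
  "slater n (\<lambda>s j. d j * w s j) m f [] [] = (\<Prod>j<n. d j) * slater n w m f [] []"
proof -
  have "map (\<lambda>s j. d j * w s j) (dseq S) = map (\<lambda>v j. d j * v j) (map w (dseq S))" for S by simp
  then show ?thesis
    unfolding slater_def append_Nil append_Nil2 
    by (simp only: wedge_scale_columns sum_distrib_left mult.left_commute)
qed

lemma block_mult_sel:
  "blockA (block_mult b c) f S = blockA b (blockA c f) S + blockB b (blockC c f) S"
  "blockB (block_mult b c) f S = blockA b (blockB c f) S + blockB b (blockD c f) S"
  "blockC (block_mult b c) f S = blockC b (blockA c f) S + blockD b (blockC c f) S"
  "blockD (block_mult b c) f S = blockC b (blockB c f) S + blockD b (blockD c f) S"
  by (cases b; cases c; simp)+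

lemma L_op_sel:
  "blockA (L_op a x j) f S = (if j \<in> S then f S else (1 - x * a j) * f S)"
  "blockB (L_op a x j) f S = (if j \<in> S then x * f (S - {j}) else 0)"
  "blockC (L_op a x j) f S = (if j \<in> S then 0 else f (insert j S))"
  "blockD (L_op a x j) f S = (if j \<in> S then 0 else x * f S)"
  by (auto simp: L_op_def sigma_plus_def sigma_minus_def algebra_simps)

lemma L'_op_sel:
  "blockA (L'_op a x j) f S = (if j \<in> S then (1 + x * a j) * f S else f S)"
  "blockB (L'_op a x j) f S = (if j \<in> S then x * f (S - {j}) else 0)"
  "blockC (L'_op a x j) f S = (if j \<in> S then 0 else f (insert j S))"
  "blockD (L'_op a x j) f S = (if j \<in> S then x * f S else 0)"
  by (auto simp: L'_op_def sigma_plus_def sigma_minus_def algebra_simps insert_absorb)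

lemma block_one_sel:
  "blockA block_one f S = f S" "blockB block_one f S = 0" "blockC block_one f S = 0" "blockD block_one f S = f S"
  by (auto simp: block_one_def)

text \<open>
  The first \<open>m\<close> Lax matrices do not act on site \<open>j > m\<close>, so fixing a particle there commutes with them.
\<close>
lemma monodromy_L_local:
  assumes "m < j"
  shows "blockA (monodromy (L_op a x) m) f (insert j S) = blockA (monodromy (L_op a x) m) (\<lambda>S. f (insert j S)) S \<and>
         blockB (monodromy (L_op a x) m) f (insert j S) = blockB (monodromy (L_op a x) m) (\<lambda>S. f (insert j S)) S \<and>
         blockC (monodromy (L_op a x) m) f (insert j S) = blockC (monodromy (L_op a x) m) (\<lambda>S. f (insert j S)) S \<and>
         blockD (monodromy (L_op a x) m) f (insert j S) = blockD (monodromy (L_op a x) m) (\<lambda>S. f (insert j S)) S"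
  using assms
proof (induction m arbitrary: S)
  case (Suc m)
  have neq: "Suc m \<noteq> j" "j \<noteq> Suc m" using Suc.prems by auto
  have IH: "blockA (monodromy (L_op a x) m) f (insert j S) = blockA (monodromy (L_op a x) m) (\<lambda>S. f (insert j S)) S"
         "blockB (monodromy (L_op a x) m) f (insert j S) = blockB (monodromy (L_op a x) m) (\<lambda>S. f (insert j S)) S"
         "blockC (monodromy (L_op a x) m) f (insert j S) = blockC (monodromy (L_op a x) m) (\<lambda>S. f (insert j S)) S"
         "blockD (monodromy (L_op a x) m) f (insert j S) = blockD (monodromy (L_op a x) m) (\<lambda>S. f (insert j S)) S" for S
    using Suc by auto
  have set: "insert j S - {Suc m} = insert j (S - {Suc m})" "insert (Suc m) (insert j S) = insert j (insert (Suc m) S)" 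
    using neq by auto
  show ?case by (auto simp: block_mult_sel L_op_sel set IH neq)
qed (simp add: block_one_sel)

lemma monodromy_L'_local:
  assumes "m < j"
  shows "blockA (monodromy (L'_op a x) m) f (insert j S) = blockA (monodromy (L'_op a x) m) (\<lambda>S. f (insert j S)) S \<and>
         blockB (monodromy (L'_op a x) m) f (insert j S) = blockB (monodromy (L'_op a x) m) (\<lambda>S. f (insert j S)) S \<and>
         blockC (monodromy (L'_op a x) m) f (insert j S) = blockC (monodromy (L'_op a x) m) (\<lambda>S. f (insert j S)) S \<and>
         blockD (monodromy (L'_op a x) m) f (insert j S) = blockD (monodromy (L'_op a x) m) (\<lambda>S. f (insert j S)) S"
  using assms
proof (induction m arbitrary: S)
  case (Suc m)
  have neq: "Suc m \<noteq> j" "j \<noteq> Suc m" using Suc.prems by auto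
  have IH: "blockA (monodromy (L'_op a x) m) f (insert j S) = blockA (monodromy (L'_op a x) m) (\<lambda>S. f (insert j S)) S"
         "blockB (monodromy (L'_op a x) m) f (insert j S) = blockB (monodromy (L'_op a x) m) (\<lambda>S. f (insert j S)) S"
         "blockC (monodromy (L'_op a x) m) f (insert j S) = blockC (monodromy (L'_op a x) m) (\<lambda>S. f (insert j S)) S"
         "blockD (monodromy (L'_op a x) m) f (insert j S) = blockD (monodromy (L'_op a x) m) (\<lambda>S. f (insert j S)) S" for S
    using Suc by auto
  have set: "insert j S - {Suc m} = insert j (S - {Suc m})" "insert (Suc m) (insert j S) = insert j (insert (Suc m) S)" 
    using neq by auto
  show ?case by (auto simp: block_mult_sel L'_op_sel set IH neq)
qed (simp add: block_one_sel)

text \<open>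
  The factor at site \<open>m + 1\<close> split off from the monodromy matrix. If the site is occupied afterwards,
  its row joins the prefix. The entries \<open>A, C\<close> obey the same recursion as the entries \<open>B, D\<close>, because
  both are columns of a matrix that is multiplied from the left.
\<close>
lemma slater_L_step:
  fixes a :: "nat \<Rightarrow> 'a::comm_ring_1" and x :: 'a
  defines "M \<equiv> monodromy (L_op a x)"
  shows
  "slater n u (Suc m) (blockA (M (Suc m)) f) ps ss = (1 - x * a (Suc m)) * slater n u m (blockA (M m) f) ps ss +
     slater n u m (blockA (M m) (\<lambda>S. f (insert (Suc m) S))) (ps @ [u (Suc m)]) ss +
     x * slater n u m (blockC (M m) f) (ps @ [u (Suc m)]) ss" (is ?A)
  "slater n u (Suc m) (blockB (M (Suc m)) f) ps ss = (1 - x * a (Suc m)) * slater n u m (blockB (M m) f) ps ss +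
     slater n u m (blockB (M m) (\<lambda>S. f (insert (Suc m) S))) (ps @ [u (Suc m)]) ss +
     x * slater n u m (blockD (M m) f) (ps @ [u (Suc m)]) ss" (is ?B)
  "slater n u (Suc m) (blockC (M (Suc m)) f) ps ss = 
     slater n u m (blockA (M m) (\<lambda>S. f (insert (Suc m) S))) ps ss + x * slater n u m (blockC (M m) f) ps ss" (is ?C)
  "slater n u (Suc m) (blockD (M (Suc m)) f) ps ss = 
     slater n u m (blockB (M m) (\<lambda>S. f (insert (Suc m) S))) ps ss + x * slater n u m (blockD (M m) f) ps ss" (is ?D)
proof -
  note [simp] = block_mult_sel L_op_sel monodromy_L_local[of m "Suc m" a x, OF lessI, folded M_def]
  have M: "M (Suc m) = block_mult (L_op a x (Suc m)) (M m)" by (simp add: M_def)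
  have out: "Suc m \<notin> S" "insert (Suc m) S - {Suc m} = S" if "S \<subseteq> {1..m}" for S using that by auto
  let ?f = "\<lambda>S. f (insert (Suc m) S)"
  show ?A
  proof -
    have 1: "slater n u m (blockA (M (Suc m)) f) ps ss = slater n u m (\<lambda>S. (1 - x * a (Suc m)) * blockA (M m) f S) ps ss" for ps
      by (rule slater_cong) (simp add: M out)
    have 2: "slater n u m (\<lambda>S. blockA (M (Suc m)) f (insert (Suc m) S)) ps ss = 
       slater n u m (\<lambda>S. blockA (M m) ?f S + x * blockC (M m) f S) ps ss" for ps
      by (rule slater_cong) (simp add: M out)
    show ?thesis by (simp only: slater_Suc 1 2 slater_add slater_scale) (simp add: algebra_simps)
  qed
  show ?B
  proof -
    have 1: "slater n u m (blockB (M (Suc m)) f) ps ss = slater n u m (\<lambda>S. (1 - x * a (Suc m)) * blockB (M m) f S) ps ss" for ps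
      by (rule slater_cong) (simp add: M out)
    have 2: "slater n u m (\<lambda>S. blockB (M (Suc m)) f (insert (Suc m) S)) ps ss = 
       slater n u m (\<lambda>S. blockB (M m) ?f S + x * blockD (M m) f S) ps ss" for ps
      by (rule slater_cong) (simp add: M out)
    show ?thesis by (simp only: slater_Suc 1 2 slater_add slater_scale) (simp add: algebra_simps)
  qed
  show ?C
  proof -
    have 1: "slater n u m (blockC (M (Suc m)) f) ps ss = 
       slater n u m (\<lambda>S. blockA (M m) ?f S + x * blockC (M m) f S) ps ss" for ps
      by (rule slater_cong) (simp add: M out)
    have 2: "slater n u m (\<lambda>S. blockC (M (Suc m)) f (insert (Suc m) S)) ps ss = slater n u m (\<lambda>S. 0) ps ss" for ps
      by (rule slater_cong) (simp add: M)
    show ?thesis by (simp only: slater_Suc 1 2 slater_add slater_scale slater_zero) simp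
  qed
  show ?D
  proof -
    have 1: "slater n u m (blockD (M (Suc m)) f) ps ss = 
       slater n u m (\<lambda>S. blockB (M m) ?f S + x * blockD (M m) f S) ps ss" for ps
      by (rule slater_cong) (simp add: M out)
    have 2: "slater n u m (\<lambda>S. blockD (M (Suc m)) f (insert (Suc m) S)) ps ss = slater n u m (\<lambda>S. 0) ps ss" for ps
      by (rule slater_cong) (simp add: M)
    show ?thesis by (simp only: slater_Suc 1 2 slater_add slater_scale slater_zero) simp
  qed
qed

lemma slater_L'_step:
  fixes a :: "nat \<Rightarrow> 'a::comm_ring_1" and x :: 'a
  defines "M \<equiv> monodromy (L'_op a x)"
  shows
  "slater n u (Suc m) (blockA (M (Suc m)) f) ps ss = slater n u m (blockA (M m) f) ps ss +
     (1 + x * a (Suc m)) * slater n u m (blockA (M m) (\<lambda>S. f (insert (Suc m) S))) (ps @ [u (Suc m)]) ss +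
     x * slater n u m (blockC (M m) f) (ps @ [u (Suc m)]) ss" (is ?A)
  "slater n u (Suc m) (blockB (M (Suc m)) f) ps ss = slater n u m (blockB (M m) f) ps ss +
     (1 + x * a (Suc m)) * slater n u m (blockB (M m) (\<lambda>S. f (insert (Suc m) S))) (ps @ [u (Suc m)]) ss +
     x * slater n u m (blockD (M m) f) (ps @ [u (Suc m)]) ss" (is ?B)
  "slater n u (Suc m) (blockC (M (Suc m)) f) ps ss = 
     slater n u m (blockA (M m) (\<lambda>S. f (insert (Suc m) S))) ps ss + 
     x * slater n u m (blockC (M m) (\<lambda>S. f (insert (Suc m) S))) (ps @ [u (Suc m)]) ss" (is ?C)
  "slater n u (Suc m) (blockD (M (Suc m)) f) ps ss = 
     slater n u m (blockB (M m) (\<lambda>S. f (insert (Suc m) S))) ps ss + 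
     x * slater n u m (blockD (M m) (\<lambda>S. f (insert (Suc m) S))) (ps @ [u (Suc m)]) ss" (is ?D)
proof -
  note [simp] = block_mult_sel L'_op_sel monodromy_L'_local[of m "Suc m" a x, OF lessI, folded M_def]
  have M: "M (Suc m) = block_mult (L'_op a x (Suc m)) (M m)" by (simp add: M_def)
  have out: "Suc m \<notin> S" "insert (Suc m) S - {Suc m} = S" if "S \<subseteq> {1..m}" for S using that by auto
  let ?f = "\<lambda>S. f (insert (Suc m) S)"
  show ?A
  proof -
    have 1: "slater n u m (blockA (M (Suc m)) f) ps ss = slater n u m (blockA (M m) f) ps ss" for ps
      by (rule slater_cong) (simp add: M out)
    have 2: "slater n u m (\<lambda>S. blockA (M (Suc m)) f (insert (Suc m) S)) ps ss = 
       slater n u m (\<lambda>S. (1 + x * a (Suc m)) * blockA (M m) ?f S + x * blockC (M m) f S) ps ss" for ps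
      by (rule slater_cong) (simp add: M out)
    show ?thesis by (simp only: slater_Suc 1 2 slater_linear) simp
  qed
  show ?B
  proof -
    have 1: "slater n u m (blockB (M (Suc m)) f) ps ss = slater n u m (blockB (M m) f) ps ss" for ps
      by (rule slater_cong) (simp add: M out)
    have 2: "slater n u m (\<lambda>S. blockB (M (Suc m)) f (insert (Suc m) S)) ps ss = 
       slater n u m (\<lambda>S. (1 + x * a (Suc m)) * blockB (M m) ?f S + x * blockD (M m) f S) ps ss" for ps
      by (rule slater_cong) (simp add: M out)
    show ?thesis by (simp only: slater_Suc 1 2 slater_linear) simp
  qed
  show ?C
  proof -
    have 1: "slater n u m (blockC (M (Suc m)) f) ps ss = slater n u m (blockA (M m) ?f) ps ss" for ps
      by (rule slater_cong) (simp add: M out)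
    have 2: "slater n u m (\<lambda>S. blockC (M (Suc m)) f (insert (Suc m) S)) ps ss = 
       slater n u m (\<lambda>S. x * blockC (M m) ?f S) ps ss" for ps
      by (rule slater_cong) (simp add: M)
    show ?thesis by (simp only: slater_Suc 1 2 slater_scale)
  qed
  show ?D
  proof -
    have 1: "slater n u m (blockD (M (Suc m)) f) ps ss = slater n u m (blockB (M m) ?f) ps ss" for ps
      by (rule slater_cong) (simp add: M out)
    have 2: "slater n u m (\<lambda>S. blockD (M (Suc m)) f (insert (Suc m) S)) ps ss = 
       slater n u m (\<lambda>S. x * blockD (M m) ?f S) ps ss" for ps
      by (rule slater_cong) (simp add: M)
    show ?thesis by (simp only: slater_Suc 1 2 slater_scale)
  qed
qed

text \<open>
  The entry \<open>C\<close> leaves a particle on the auxiliary line, about to be dropped at site \<open>m + 1\<close> with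
  weight \<open>x\<close>. Counting it by the row \<open>w\<^bsub>m + 1\<^esub>\<close> turns the sum over all hops into a product: in each step
  the row \<open>u\<^bsub>m + 1\<^esub>\<close> is expanded, and the terms with a hop across site \<open>m + 1\<close> cancel.
\<close>
lemma slater_L_AC:
  fixes a :: "nat \<Rightarrow> 'a::comm_ring_1" and x :: 'a
  assumes u: "\<And>s. u (Suc s) = (\<lambda>j. (1 - x * a (Suc s)) * w (Suc s) j + (- x) * w (Suc (Suc s)) j)"
  defines "M \<equiv> monodromy (L_op a x)"
  shows "slater n u m (blockA (M m) f) ps [] + x * slater n u m (blockC (M m) f) (ps @ [w (Suc m)]) [] =
         (\<Prod>i=1..m. 1 - x * a i) * slater n w m f ps []"
proof (induction m arbitrary: f ps)
  case 0
  then show ?case by (simp add: M_def slater_0 block_one_sel)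
next
  case (Suc m)
  let ?f = "\<lambda>S. f (insert (Suc m) S)"
  have lin: "slater n u m g (ps @ [u (Suc m)]) [] = (1 - x * a (Suc m)) * slater n u m g (ps @ [w (Suc m)]) [] -
      x * slater n u m g (ps @ [w (Suc (Suc m))]) []" for g
    by (subst u) (simp only: slater_prefix_linear, simp)
  have dup: "slater n u m g (ps @ [w (Suc m), w (Suc m)]) [] = 0" for g
    using slater_prefix_dup[of n u m g ps "w (Suc m)" "[]"] by simp
  have IH: "slater n u m (blockA (M m) f) ps [] =
      (\<Prod>i=1..m. 1 - x * a i) * slater n w m f ps [] - x * slater n u m (blockC (M m) f) (ps @ [w (Suc m)]) []"
    using Suc.IH[of f ps] by (simp add: eq_diff_eq)
  have IH': "slater n u m (blockA (M m) ?f) (ps @ [w (Suc m)]) [] =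
      (\<Prod>i=1..m. 1 - x * a i) * slater n w m ?f (ps @ [w (Suc m)]) []"
    using Suc.IH[of ?f "ps @ [w (Suc m)]"] dup by simp
  show ?case
    unfolding slater_L_step[of n u m a x, folded M_def] lin IH' IH slater_Suc[of n w m f]
    by (simp add: algebra_simps)
qed

text \<open>
  When the auxiliary line is occupied at the start, the natural comparison is with an additional
  particle entering at site \<open>1\<close>, whose row \<open>w\<^sub>1\<close> is last in the decreasing order. The difference between
  the two gains a factor \<open>x\<close> at every site and a sign at every particle, hence the rows \<open>-w\<^sub>s\<close>. The
  second statement is carried along because the recursion mixes \<open>B\<close> and \<open>D\<close>.
\<close>
lemma slater_L_BD:
  fixes a :: "nat \<Rightarrow> 'a::comm_ring_1" and x :: 'a
  assumes u: "\<And>s. u (Suc s) = (\<lambda>j. (1 - x * a (Suc s)) * w (Suc s) j + (- x) * w (Suc (Suc s)) j)"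
  defines "M \<equiv> monodromy (L_op a x)" and "v \<equiv> (\<lambda>s j. (- 1) * w s j)"
  shows "slater n u m (blockD (M m) f) ps [] - x * slater n u m (blockC (M m) f) ps [w 1] = 
           x ^ m * slater n v m f ps [] \<and>
         slater n u m (blockB (M m) f) ps [] - x * slater n u m (blockA (M m) f) ps [w 1] =
           - (x ^ Suc m) * slater n v m f (ps @ [w (Suc m)]) []"
proof (induction m arbitrary: f ps)
  case 0
  then show ?case by (simp add: M_def slater_0 block_one_sel)
next
  case (Suc m)
  let ?f = "\<lambda>S. f (insert (Suc m) S)"
  have resD: "slater n u m (blockD (M m) f) ps [] = x * slater n u m (blockC (M m) f) ps [w 1] + x ^ m * slater n v m f ps []" for f ps
    using Suc.IH[of f ps] by (simp add: diff_eq_eq add.commute)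
  have resB: "slater n u m (blockB (M m) f) ps [] = x * slater n u m (blockA (M m) f) ps [w 1] - x ^ Suc m * slater n v m f (ps @ [w (Suc m)]) []" for f ps
    using Suc.IH[of f ps] by (simp add: diff_eq_eq add.commute)
  have lin: "slater n v m g (ps @ u (Suc m) # qs) ss = (1 - x * a (Suc m)) * slater n v m g (ps @ w (Suc m) # qs) ss -
      x * slater n v m g (ps @ w (Suc (Suc m)) # qs) ss" for g qs ss
    by (subst u) (simp only: slater_prefix_linear, simp)
  have dup: "slater n v m g (ps @ [w (Suc m), w (Suc m)]) [] = 0" for g
    using slater_prefix_dup[of n v m g ps "w (Suc m)" "[]"] by simp
  have vv: "slater n v m g (ps @ qs @ [v (Suc m)]) [] = - slater n v m g (ps @ qs @ [w (Suc m)]) []" for g ps qs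
    using slater_prefix_scale[of n v m g "ps @ qs" "- 1" "w (Suc m)" "[]"] by (simp add: v_def)
  show ?case
  proof
    show "slater n u (Suc m) (blockD (M (Suc m)) f) ps [] - x * slater n u (Suc m) (blockC (M (Suc m)) f) ps [w 1] =
      x ^ Suc m * slater n v (Suc m) f ps []"
      unfolding slater_L_step[of n u m a x, folded M_def] resD resB slater_Suc[of n v m f]
      by (simp add: vv[of ?f ps "[]", simplified] algebra_simps)
    show "slater n u (Suc m) (blockB (M (Suc m)) f) ps [] - x * slater n u (Suc m) (blockA (M (Suc m)) f) ps [w 1] =
      - (x ^ Suc (Suc m)) * slater n v (Suc m) f (ps @ [w (Suc (Suc m))]) []"
      unfolding slater_L_step[of n u m a x, folded M_def] resD resB slater_Suc[of n v m f]
      by (simp add: vv[of ?f ps "[w (Suc (Suc m))]", simplified] lin dup algebra_simps)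
  qed
qed

text \<open>
  The counterpart of \<open>slater_L_AC\<close> for \<open>E(x)\<close>, where every particle either stays or moves by one site:
  its row \<open>w\<^sub>s\<close> is replaced by \<open>u\<^sub>s = (1 + x a\<^sub>s) w\<^sub>s + x w\<^bsub>s + 1\<^esub>\<close>, and products of two equal rows drop out.
\<close>
lemma slater_L'_AC:
  fixes a :: "nat \<Rightarrow> 'a::comm_ring_1" and x :: 'a
  assumes u: "\<And>s. u (Suc s) = (\<lambda>j. (1 + x * a (Suc s)) * w (Suc s) j + x * w (Suc (Suc s)) j)"
  defines "M \<equiv> monodromy (L'_op a x)"
  shows "slater n w m (blockA (M m) f) ps [] + x * slater n w m (blockC (M m) f) (ps @ [w (Suc m)]) [] =
         slater n u m f ps []"
proof (induction m arbitrary: f ps)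
  case 0
  then show ?case by (simp add: M_def slater_0 block_one_sel)
next
  case (Suc m)
  let ?f = "\<lambda>S. f (insert (Suc m) S)"
  have lin: "slater n w m g (ps @ u (Suc m) # qs) [] = (1 + x * a (Suc m)) * slater n w m g (ps @ w (Suc m) # qs) [] +
      x * slater n w m g (ps @ w (Suc (Suc m)) # qs) []" for g qs
    by (subst u) (simp only: slater_prefix_linear)
  have dup: "slater n w m g (ps @ [w (Suc m), w (Suc m)]) [] = 0" for g
    using slater_prefix_dup[of n w m g ps "w (Suc m)" "[]"] by simp
  have swap: "slater n w m g (ps @ [w (Suc (Suc m)), w (Suc m)]) [] = - slater n w m g (ps @ [w (Suc m), w (Suc (Suc m))]) []" for g
    using slater_prefix_swap[of n w m g ps "w (Suc (Suc m))" "w (Suc m)" "[]"] by simp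
  have IH: "slater n u m f ps [] =
      slater n w m (blockA (M m) f) ps [] + x * slater n w m (blockC (M m) f) (ps @ [w (Suc m)]) []"
    using Suc.IH[of f ps] by simp
  have IH': "slater n u m ?f (ps @ [u (Suc m)]) [] =
      slater n w m (blockA (M m) ?f) (ps @ [u (Suc m)]) [] + x * slater n w m (blockC (M m) ?f) (ps @ [u (Suc m), w (Suc m)]) []"
    using Suc.IH[of ?f "ps @ [u (Suc m)]"] by simp
  show ?case
    unfolding slater_L'_step[of n w m a x, folded M_def] slater_Suc[of n u m f] IH' IH
    using lin[of "blockA (M m) ?f" "[]"] lin[of "blockC (M m) ?f" "[w (Suc m)]"] swap[of "blockC (M m) ?f"] dup[of "blockC (M m) ?f"]
    by (simp add: algebra_simps)
qed

text \<open>
  For \<open>E(x)\<close> an occupied auxiliary line has exactly the effect of an additional particle that enters at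
  site \<open>1\<close> with weight \<open>x\<close>. The condition \<open>m \<ge> 1\<close> is essential: the particle needs a site to enter.
\<close>
lemma slater_L'_BD:
  fixes w :: "nat \<Rightarrow> nat \<Rightarrow> 'a::comm_ring_1" and a :: "nat \<Rightarrow> 'a" and x :: 'a and n :: nat
  defines "M \<equiv> monodromy (L'_op a x)" 
  defines "resD \<equiv> \<lambda>m f ps. slater n w m (blockD (M m) f) ps [] - x * slater n w m (blockC (M m) f) ps [w 1]"
    and "resB \<equiv> \<lambda>m f ps. slater n w m (blockB (M m) f) ps [] - x * slater n w m (blockA (M m) f) ps [w 1]"
  assumes "m \<ge> 1" 
  shows "resD m f ps = 0"
proof -
  have stepD: "resD (Suc m) f ps = resB m (\<lambda>S. f (insert (Suc m) S)) ps + x * resD m (\<lambda>S. f (insert (Suc m) S)) (ps @ [w (Suc m)])" for m ps f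
    unfolding resD_def resB_def slater_L'_step[of n w m a x, folded M_def] by (simp add: algebra_simps)
  have stepB: "resB (Suc m) f ps = resB m f ps + (1 + x * a (Suc m)) * resB m (\<lambda>S. f (insert (Suc m) S)) (ps @ [w (Suc m)]) + x * resD m f (ps @ [w (Suc m)])" for m ps f
    unfolding resD_def resB_def slater_L'_step[of n w m a x, folded M_def] by (simp add: algebra_simps)
  have dup: "resD m g (ps @ [w (Suc m), w (Suc m)]) = 0" for m g ps
    using slater_prefix_dup[of n w m _ ps "w (Suc m)" "[]"] by (simp add: resD_def)
  have rel: "resB m f ps + x * resD m f (ps @ [w (Suc m)]) = 0" for m f ps
  proof (induction m arbitrary: f ps)
    case 0
    then show ?case by (simp add: resD_def resB_def M_def slater_0 block_one_sel)
  next
    case (Suc m)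
    have resD0: "resD (Suc m) f ps = 0" for ps
      using stepD[of m] Suc.IH by simp
    have resB1: "resB m (\<lambda>S. f (insert (Suc m) S)) (ps @ [w (Suc m)]) = 0"
      using Suc.IH[of "\<lambda>S. f (insert (Suc m) S)" "ps @ [w (Suc m)]"] dup by simp
    show ?case using Suc.IH[of f ps] by (simp add: resD0 stepB resB1)
  qed
  obtain m' where "m = Suc m'" using assms(4) by (cases m) auto
  then show ?thesis using stepD rel by simp
qed

text \<open>
  Sites are numbered from \<open>1\<close>, so site \<open>s\<close> carries the factorial power of degree \<open>s - 1\<close>.
\<close>
definition power_rows :: "(nat \<Rightarrow> 'a::comm_ring_1) \<Rightarrow> (nat \<Rightarrow> 'a) \<Rightarrow> nat \<Rightarrow> nat \<Rightarrow> 'a" where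
  "power_rows a z s j = fact_power (z j) a (s - 1)"

lemma power_rows_Suc: "power_rows a z (Suc (Suc s)) j = (z j - a (Suc s)) * power_rows a z (Suc s) j"
  by (simp add: power_rows_def fact_power_def mult.commute)

text \<open>
  Multiplying column \<open>j\<close> by \<open>1 - x z\<^sub>j\<close> turns the rows \<open>w\<^sub>s\<close> into the rows \<open>u\<^sub>s\<close> of the preceding lemmas. By
  the hypothesis on the \<open>z\<^sub>j\<close>, the row \<open>w\<^bsub>N + 1\<^esub>\<close> is a multiple of \<open>w\<^sub>1\<close>; this identifies the particle that
  \<open>C\<close> leaves on the auxiliary line with the particle that \<open>D\<close> lets in, and the two contributions cancel.
\<close>
lemma slater_H_op:
  fixes z :: "nat \<Rightarrow> 'a::comm_ring_1"
  assumes root: "\<And>j. j < n \<Longrightarrow> (\<Prod>i=1..N. z j - a i) = - ((- 1) ^ n) * q"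
  shows "(\<Prod>j<n. 1 - x * z j) * slater n (power_rows a z) N (H_op N a q x f) [] [] =
         ((\<Prod>i=1..N. 1 - x * a i) + (- 1) ^ n * q * x ^ N) * slater n (power_rows a z) N f [] []"
proof -
  define w where "w = power_rows a z"
  define u where "u = (\<lambda>s j. (1 - x * z j) * w s j)"
  define M where "M = monodromy (L_op a x)"
  have u: "u (Suc s) = (\<lambda>j. (1 - x * a (Suc s)) * w (Suc s) j + (- x) * w (Suc (Suc s)) j)" for s
    by (rule ext) (simp add: u_def w_def power_rows_Suc algebra_simps)
  \<comment> \<open>The Bethe equations as periodicity of the rows.\<close>
  have wN: "w (Suc N) j = (- ((- 1) ^ n) * q) * w 1 j" if "j < n" for j
    using root[OF that] by (simp add: w_def power_rows_def fact_power_def)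
  have C: "slater n u N g [w (Suc N)] [] = q * slater n u N g [] [w 1]" for g
  proof -
    have "slater n u N g [w (Suc N)] [] = slater n u N g [\<lambda>j. (- ((- 1) ^ n) * q) * w 1 j] []"
      by (rule slater_prefix_cong) (rule wN)
    also have "\<dots> = (- ((- 1) ^ n) * q) * (- ((- 1) ^ n) * slater n u N g [] [w 1])"
      using slater_prefix_scale[of n u N g "[]" "- ((- 1) ^ n) * q" "w 1" "[]"] slater_rotate[of n u N g "w 1"] by simp
    also have "\<dots> = q * slater n u N g [] [w 1]"
      by (simp add: algebra_simps flip: power_add mult_2 power_mult)
    finally show ?thesis .
  qed
  have neg: "slater n (\<lambda>s j. (- 1) * w s j) N f [] [] = (- 1) ^ n * slater n w N f [] []"
    using slater_scale_columns[of n "\<lambda>_. - 1" w N f] by simp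
  have "(\<Prod>j<n. 1 - x * z j) * slater n w N (H_op N a q x f) [] [] = slater n u N (H_op N a q x f) [] []"
    unfolding u_def by (rule slater_scale_columns[symmetric])
  also have "\<dots> = slater n u N (blockA (M N) f) [] [] + q * slater n u N (blockD (M N) f) [] []"
    using slater_linear[of n u N 1 "blockA (M N) f" q "blockD (M N) f" "[]" "[]"] 
    by (simp add: H_op_def[abs_def] M_def)
  also have "slater n u N (blockD (M N) f) [] [] = x * slater n u N (blockC (M N) f) [] [w 1] + x ^ N * ((- 1) ^ n * slater n w N f [] [])"
    using slater_L_BD[of u x a w n N f "[]", OF u, folded M_def] neg by (simp add: diff_eq_eq add.commute)
  also have "slater n u N (blockA (M N) f) [] [] = (\<Prod>i=1..N. 1 - x * a i) * slater n w N f [] [] - x * (q * slater n u N (blockC (M N) f) [] [w 1])"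
    using slater_L_AC[of u x a w n N f "[]", OF u, folded M_def] by (simp add: C eq_diff_eq)
  finally show ?thesis unfolding w_def[symmetric] by (simp add: algebra_simps)
qed

text \<open>
  As for \<open>H(x)\<close>, the periodicity \<open>w\<^bsub>N + 1\<^esub> \<sim> w\<^sub>1\<close> makes the contributions of \<open>C\<close> and \<open>D\<close> cancel. What
  remains is the product of the rows \<open>u\<^sub>s\<close>, which are the rows \<open>w\<^sub>s\<close> with column \<open>j\<close> scaled by \<open>1 + x z\<^sub>j\<close>.
\<close>
lemma slater_E_op:
  fixes z :: "nat \<Rightarrow> 'a::comm_ring_1"
  assumes root: "\<And>j. j < n \<Longrightarrow> (\<Prod>i=1..N. z j - a i) = - ((- 1) ^ n) * q" and "N \<ge> 1"
  shows "slater n (power_rows a z) N (E_op N a q x f) [] [] = 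
         (\<Prod>j<n. 1 + x * z j) * slater n (power_rows a z) N f [] []"
proof -
  define w where "w = power_rows a z"
  define u where "u = (\<lambda>s j. (1 + x * z j) * w s j)"
  define M where "M = monodromy (L'_op a x)"
  have u: "u (Suc s) = (\<lambda>j. (1 + x * a (Suc s)) * w (Suc s) j + x * w (Suc (Suc s)) j)" for s
    by (rule ext) (simp add: u_def w_def power_rows_Suc algebra_simps)
  have wN: "w (Suc N) j = (- ((- 1) ^ n) * q) * w 1 j" if "j < n" for j
    using root[OF that] by (simp add: w_def power_rows_def fact_power_def)
  have C: "slater n w N g [w (Suc N)] [] = q * slater n w N g [] [w 1]" for g
  proof -
    have "slater n w N g [w (Suc N)] [] = slater n w N g [\<lambda>j. (- ((- 1) ^ n) * q) * w 1 j] []"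
      by (rule slater_prefix_cong) (rule wN)
    also have "\<dots> = (- ((- 1) ^ n) * q) * (- ((- 1) ^ n) * slater n w N g [] [w 1])"
      using slater_prefix_scale[of n w N g "[]" "- ((- 1) ^ n) * q" "w 1" "[]"] slater_rotate[of n w N g "w 1"] by simp
    also have "\<dots> = q * slater n w N g [] [w 1]"
      by (simp add: algebra_simps flip: power_add mult_2 power_mult)
    finally show ?thesis .
  qed
  have "slater n w N (E_op N a q x f) [] [] = slater n w N (blockA (M N) f) [] [] + q * slater n w N (blockD (M N) f) [] []"
    using slater_linear[of n w N 1 "blockA (M N) f" q "blockD (M N) f" "[]" "[]"] 
    by (simp add: E_op_def[abs_def] M_def)
  also have "slater n w N (blockD (M N) f) [] [] = x * slater n w N (blockC (M N) f) [] [w 1]"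
    using slater_L'_BD[where n = n and w = w and m = N and f = f and ps = "[]" and a = a and x = x, folded M_def] assms(2) by simp
  also have "slater n w N (blockA (M N) f) [] [] = slater n u N f [] [] - x * (q * slater n w N (blockC (M N) f) [] [w 1])"
    using slater_L'_AC[of u x a w n N f "[]", OF u, folded M_def] by (simp add: C eq_diff_eq)
  also have "slater n u N f [] [] = (\<Prod>j<n. 1 + x * z j) * slater n w N f [] []"
    unfolding u_def by (rule slater_scale_columns)
  finally show ?thesis unfolding w_def[symmetric] by (simp add: algebra_simps)
qed

section \<open>Partitions in the box as sets of exponents\<close>

text \<open>
  The exponent \<open>\<lambda>\<^sub>i + n - i\<close> of row \<open>i\<close>, except that rows are counted from \<open>0\<close>. These exponents are the
  occupied sites of \<open>|\<lambda>\<rangle>\<close>, shifted to start at \<open>0\<close> and listed from the last to the first.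
\<close>
definition expo :: "nat \<Rightarrow> nat list \<Rightarrow> nat \<Rightarrow> nat" where
  "expo n lam i = lam ! i + n - (i + 1)"

lemma Parts_nth_mono: "lam \<in> Parts n k \<Longrightarrow> i \<le> j \<Longrightarrow> j < n \<Longrightarrow> lam ! j \<le> lam ! i"
  by (cases "i = j") (auto simp: Parts_def sorted_wrt_iff_nth_less)

lemma Parts_nth_le: "lam \<in> Parts n k \<Longrightarrow> i < n \<Longrightarrow> lam ! i \<le> k"
  by (auto simp: Parts_def)

lemma Parts_length: "lam \<in> Parts n k \<Longrightarrow> length lam = n"
  by (auto simp: Parts_def)

lemma expo_strict: 
  assumes "lam \<in> Parts n k" "i < j" "j < n" shows "expo n lam j < expo n lam i"
  using Parts_nth_mono[OF assms(1), of i j] assms by (simp add: expo_def)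

lemma expo_less: "lam \<in> Parts n k \<Longrightarrow> i < n \<Longrightarrow> expo n lam i < n + k"
  using Parts_nth_le[of lam n k i] by (simp add: expo_def)

lemma inj_on_expo: "lam \<in> Parts n k \<Longrightarrow> inj_on (expo n lam) {0..<n}"
  by (rule inj_onI) (metis atLeastLessThan_iff expo_strict less_irrefl nat_neq_iff)

lemma sorted_list_of_expo:
  assumes "lam \<in> Parts n k"
  shows "rev (sorted_list_of_set (expo n lam ` {0..<n})) = map (expo n lam) [0..<n]"
proof -
  have "sorted_list_of_set (expo n lam ` {0..<n}) = rev (map (expo n lam) [0..<n])"
  proof (rule sorted_distinct_set_unique)
    show "sorted (rev (map (expo n lam) [0..<n]))"
      unfolding sorted_wrt_rev unfolding sorted_wrt_iff_nth_less by (auto intro!: less_imp_le expo_strict[OF assms])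
    show "distinct (rev (map (expo n lam) [0..<n]))"
      using inj_on_expo[OF assms] by (simp add: distinct_map)
  qed auto
  then show ?thesis by simp
qed

lemma bij_betw_expo:
  "bij_betw (\<lambda>lam. expo n lam ` {0..<n}) (Parts n k) {S. S \<subseteq> {..<n + k} \<and> card S = n}"
proof (rule bij_betw_imageI)
  show "inj_on (\<lambda>lam. expo n lam ` {0..<n}) (Parts n k)"
  proof (rule inj_onI)
    fix lam mu assume lm: "lam \<in> Parts n k" "mu \<in> Parts n k" and eq: "expo n lam ` {0..<n} = expo n mu ` {0..<n}"
    have "map (expo n lam) [0..<n] = map (expo n mu) [0..<n]"
      unfolding sorted_list_of_expo[OF lm(1), symmetric] sorted_list_of_expo[OF lm(2), symmetric] eq ..
    then have "expo n lam i = expo n mu i" if "i < n" for i using that by auto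
    then have "lam ! i = mu ! i" if "i < n" for i
      using that by (force simp: expo_def)
    then show "lam = mu"
      using Parts_length lm by (intro nth_equalityI) auto
  qed
  show "(\<lambda>lam. expo n lam ` {0..<n}) ` Parts n k = {S. S \<subseteq> {..<n + k} \<and> card S = n}"
  proof (intro equalityI subsetI)
    fix S assume "S \<in> (\<lambda>lam. expo n lam ` {0..<n}) ` Parts n k"
    then show "S \<in> {S. S \<subseteq> {..<n + k} \<and> card S = n}"
      using expo_less inj_on_expo by (auto simp: card_image)
  next
    fix S assume "S \<in> {S. S \<subseteq> {..<n + k} \<and> card S = n}"
    then have S: "S \<subseteq> {..<n + k}" "card S = n" and fin: "finite S" using finite_subset by auto
    define xs where "xs = rev (sorted_list_of_set S)"
    have xs: "length xs = n" "set xs = S" using S fin by (auto simp: xs_def)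
    have "sorted_wrt (<) (sorted_list_of_set S)" by simp
    then have desc: "sorted_wrt (>) xs" by (simp add: xs_def sorted_wrt_rev)
    have dec: "xs ! j + (j - i) \<le> xs ! i" if "i \<le> j" "j < n" for i j
      using that
    proof (induction j rule: dec_induct)
      case (step j)
      have "xs ! Suc j < xs ! j" using desc step xs by (simp add: sorted_wrt_iff_nth_less)
      then show ?case using step by simp
    qed simp
    \<comment> \<open>The subtraction does not truncate: at least \<open>n - 1 - i\<close> smaller elements of \<open>S\<close> follow \<open>xs ! i\<close>.\<close>
    define lam where "lam = map (\<lambda>i. xs ! i - (n - 1 - i)) [0..<n]"
    have low: "n - 1 - i \<le> xs ! i" if "i < n" for i
    proof -
      have "i \<le> n - 1" "n - 1 < n" using that by auto
      from dec[OF this] show ?thesis by linarith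
    qed
    have up: "xs ! i + i < n + k" if "i < n" for i
    proof -
      have "xs ! 0 \<in> S" using xs that by (metis nth_mem order.strict_trans1 zero_le)
      then show ?thesis using dec[of 0 i] that S by auto
    qed
    have nth: "lam ! i = xs ! i - (n - 1 - i)" if "i < n" for i using that by (simp add: lam_def)
    have "lam \<in> Parts n k"
      unfolding Parts_def
    proof (intro CollectI conjI)
      show "sorted_wrt (\<ge>) lam"
        unfolding sorted_wrt_iff_nth_less
      proof (intro allI impI)
        fix i j assume "i < j" "j < length lam"
        then show "lam ! i \<ge> lam ! j" using dec[of i j] by (auto simp: nth lam_def)
      qed
      show "\<forall>p\<in>set lam. p \<le> k"
      proof
        fix p assume "p \<in> set lam"
        then obtain i where "i < n" "p = lam ! i" by (auto simp: in_set_conv_nth lam_def)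
        then show "p \<le> k" using up[of i] by (simp add: nth)
      qed
    qed (simp add: lam_def)
    moreover have "expo n lam ` {0..<n} = S"
    proof -
      have "expo n lam i = xs ! i" if "i < n" for i using low[OF that] that by (simp add: expo_def nth)
      then have "expo n lam ` {0..<n} = (\<lambda>i. xs ! i) ` {0..<n}" by auto
      also have "\<dots> = S" using xs nth_image[of n xs] by simp
      finally show ?thesis .
    qed
    ultimately show "S \<in> (\<lambda>lam. expo n lam ` {0..<n}) ` Parts n k" by blast
  qed
qed

lemma part_state_expo: 
  assumes "lam \<in> Parts n k" shows "part_state n lam = Suc ` expo n lam ` {0..<n}"
proof -
  have eq: "{1..n} = (\<lambda>l. n - l) ` {0..<n}"
  proof (intro equalityI subsetI)
    fix i assume "i \<in> {1..n}"
    then have "i = n - (n - i)" "n - i \<in> {0..<n}" by auto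
    then show "i \<in> (\<lambda>l. n - l) ` {0..<n}" by blast
  qed auto
  show ?thesis unfolding part_state_def eq image_image
    by (rule image_cong) (auto simp: expo_def)
qed

lemma dseq_part_state:
  assumes "lam \<in> Parts n k" shows "dseq (part_state n lam) = map (\<lambda>i. Suc (expo n lam i)) [0..<n]"
proof -
  have "sorted_list_of_set (part_state n lam) = rev (map (\<lambda>i. Suc (expo n lam i)) [0..<n])"
  proof (rule sorted_distinct_set_unique)
    show "sorted (rev (map (\<lambda>i. Suc (expo n lam i)) [0..<n]))"
      unfolding sorted_wrt_rev unfolding sorted_wrt_iff_nth_less by (auto intro!: less_imp_le expo_strict[OF assms])
    show "distinct (rev (map (\<lambda>i. Suc (expo n lam i)) [0..<n]))"
      using inj_on_expo[OF assms] by (auto simp: distinct_map inj_on_def)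
  qed (auto simp: part_state_expo[OF assms])
  then show ?thesis by (simp add: dseq_def)
qed

lemma bij_betw_part_state:
  "bij_betw (part_state n) (Parts n k) {S. S \<subseteq> {1..n + k} \<and> card S = n}"
proof -
  have "bij_betw (\<lambda>S. Suc ` S) {S. S \<subseteq> {..<n + k} \<and> card S = n} {S. S \<subseteq> {1..n + k} \<and> card S = n}"
  proof (rule bij_betwI[where g = "\<lambda>S. (\<lambda>i. i - 1) ` S"])
    show "(\<lambda>S. Suc ` S) \<in> {S. S \<subseteq> {..<n + k} \<and> card S = n} \<rightarrow> {S. S \<subseteq> {1..n + k} \<and> card S = n}"
      by (auto simp: card_image)
    show "(\<lambda>S. (\<lambda>i. i - 1) ` S) \<in> {S. S \<subseteq> {1..n + k} \<and> card S = n} \<rightarrow> {S. S \<subseteq> {..<n + k} \<and> card S = n}"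
    proof (intro Pi_I CollectI conjI)
      fix S assume S: "S \<in> {S. S \<subseteq> {1..n + k} \<and> card S = n}"
      then show "(\<lambda>i. i - 1) ` S \<subseteq> {..<n + k}" by (auto simp: subset_iff)
      show "card ((\<lambda>i. i - 1) ` S) = n" using S
        by (subst card_image) (auto intro!: inj_onI simp: subset_iff, metis One_nat_def eq_diff_iff)
    qed
    show "(\<lambda>i. i - 1) ` Suc ` S = S" for S by (simp add: image_image)
    show "Suc ` (\<lambda>i. i - 1) ` S = S" if "S \<in> {S. S \<subseteq> {1..n + k} \<and> card S = n}" for S
    proof -
      have "(\<lambda>i. Suc (i - 1)) ` S = (\<lambda>i. i) ` S" using that by (intro image_cong) auto
      then show ?thesis by (simp add: image_image)
    qed
  qed
  from bij_betw_trans[OF bij_betw_expo this] show ?thesis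
    by (rule bij_betw_cong[THEN iffD1, rotated]) (simp add: part_state_expo)
qed

section \<open>The Cauchy-Binet formula\<close>

lemma det_mat_cong:
  assumes "\<And>i j. i < n \<Longrightarrow> j < n \<Longrightarrow> f i j = g i j"
  shows "det (mat n n (\<lambda>(i, j). f i j)) = det (mat n n (\<lambda>(i, j). g i j))"
  using assms by (intro arg_cong[of _ _ det] eq_matI) auto

lemma det_mat_permute_rows:
  assumes "p permutes {0..<n}"
  shows "det (mat n n (\<lambda>(i, j). f (p i) j)) = signof p * det (mat n n (\<lambda>(i, j). f i j))"
proof -
  have "mat n n (\<lambda>(i, j). f (p i) j) = mat n n (\<lambda>(i, j). mat n n (\<lambda>(i, j). f i j) $$ (p i, j))"
    using assms by (intro eq_matI) (auto simp: permutes_in_image)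
  then show ?thesis using det_permute_rows[of "mat n n (\<lambda>(i, j). f i j)" n p] assms by simp
qed

text \<open>
  An injective map is determined by its image, that is a partition in the box, and by the order in which
  the elements of the image are taken.
\<close>
lemma bij_betw_injective_maps:
  "bij_betw (\<lambda>(lam, p). restrict (\<lambda>i. expo n lam (p i)) {0..<n})
     (Parts n k \<times> {p. p permutes {0..<n}}) {g \<in> {0..<n} \<rightarrow>\<^sub>E {..<n + k}. inj_on g {0..<n}}"
proof (rule bij_betw_imageI)
  let ?h = "\<lambda>(lam, p). restrict (\<lambda>i. expo n lam (p i)) {0..<n}"
  have im: "(\<lambda>i. expo n lam (p i)) ` {0..<n} = expo n lam ` {0..<n}" if "p permutes {0..<n}" for lam p
    using permutes_image[OF that] by (metis image_image)
  show "inj_on ?h (Parts n k \<times> {p. p permutes {0..<n}})"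
  proof (rule inj_onI, clarify)
    fix lam p mu r
    assume lm: "lam \<in> Parts n k" "mu \<in> Parts n k" and pr: "p permutes {0..<n}" "r permutes {0..<n}"
      and eq: "restrict (\<lambda>i. expo n lam (p i)) {0..<n} = restrict (\<lambda>i. expo n mu (r i)) {0..<n}"
    have eq': "expo n lam (p i) = expo n mu (r i)" if "i < n" for i
      using fun_cong[OF eq, of i] that by simp
    have "(\<lambda>i. expo n lam (p i)) ` {0..<n} = (\<lambda>i. expo n mu (r i)) ` {0..<n}"
      by (rule image_cong) (auto simp: eq')
    then have "expo n lam ` {0..<n} = expo n mu ` {0..<n}"
      by (simp only: im[OF pr(1)] im[OF pr(2)])
    then have lam: "lam = mu" 
      using lm by (rule inj_onD[OF bij_betw_imp_inj_on[OF bij_betw_expo]])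
    have "p i = r i" for i
    proof (cases "i < n")
      case True
      then show ?thesis
        using inj_onD[OF inj_on_expo[OF lm(1)], of "p i" "r i"] eq' lam permutes_in_image[OF pr(1)] permutes_in_image[OF pr(2)] by auto
    next
      case False
      then show ?thesis using pr by (auto simp: permutes_def)
    qed
    then show "lam = mu \<and> p = r" using lam by auto
  qed
  show "?h ` (Parts n k \<times> {p. p permutes {0..<n}}) = {g \<in> {0..<n} \<rightarrow>\<^sub>E {..<n + k}. inj_on g {0..<n}}"
  proof (intro equalityI subsetI)
    fix g assume "g \<in> ?h ` (Parts n k \<times> {p. p permutes {0..<n}})"
    then obtain lam p where lam: "lam \<in> Parts n k" and p: "p permutes {0..<n}"
      and g: "g = restrict (\<lambda>i. expo n lam (p i)) {0..<n}" by auto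
    have "inj_on (expo n lam \<circ> p) {0..<n}"
      using inj_on_expo[OF lam] permutes_image[OF p] permutes_inj_on[OF p] by (intro comp_inj_on) auto
    then have "inj_on g {0..<n}" by (simp add: g inj_on_def)
    moreover have "g \<in> {0..<n} \<rightarrow>\<^sub>E {..<n + k}"
      using expo_less[OF lam] permutes_in_image[OF p] by (auto simp: g)
    ultimately show "g \<in> {g \<in> {0..<n} \<rightarrow>\<^sub>E {..<n + k}. inj_on g {0..<n}}" by simp
  next
    fix g assume "g \<in> {g \<in> {0..<n} \<rightarrow>\<^sub>E {..<n + k}. inj_on g {0..<n}}"
    then have g: "g \<in> {0..<n} \<rightarrow>\<^sub>E {..<n + k}" "inj_on g {0..<n}" by auto
    have "g ` {0..<n} \<in> {S. S \<subseteq> {..<n + k} \<and> card S = n}"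
      using g by (auto simp: card_image)
    then obtain lam where lam: "lam \<in> Parts n k" "expo n lam ` {0..<n} = g ` {0..<n}"
      using bij_betw_imp_surj_on[OF bij_betw_expo, of n k] by (metis (no_types, lifting) imageE)
    define p where "p i = (if i < n then inv_into {0..<n} (expo n lam) (g i) else i)" for i
    have pin: "p i \<in> {0..<n}" "expo n lam (p i) = g i" if "i < n" for i
    proof -
      have "g i \<in> expo n lam ` {0..<n}" using lam(2) that by auto
      then show "p i \<in> {0..<n}" "expo n lam (p i) = g i" 
        using inv_into_into[of "g i" "expo n lam" "{0..<n}"] f_inv_into_f[of "g i" "expo n lam" "{0..<n}"] that by (auto simp: p_def)
    qed
    have "inj_on p {0..<n}"
      by (rule inj_onI) (metis atLeastLessThan_iff g(2) inj_onD pin(2))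
    then have "bij_betw p {0..<n} {0..<n}"
      using pin(1) by (intro bij_betw_imageI endo_inj_surj) auto
    then have "p permutes {0..<n}"
      by (rule bij_imp_permutes) (auto simp: p_def)
    moreover have "restrict (\<lambda>i. expo n lam (p i)) {0..<n} = g"
    proof (rule ext)
      fix i show "restrict (\<lambda>i. expo n lam (p i)) {0..<n} i = g i"
        using PiE_arb[OF g(1), of i] pin(2)[of i] by (cases "i < n") simp_all
    qed
    ultimately show "g \<in> ?h ` (Parts n k \<times> {p. p permutes {0..<n}})"
      using lam(1) by (intro image_eqI[of _ _ "(lam, p)"]) simp_all
  qed
qed

text \<open>
  The summands with a non-injective choice of columns have two equal rows. The others are grouped by the
  chosen set of columns, and the \<open>n\<close>-element subsets of \<open>{0, \<dots>, n + k - 1}\<close> are indexed by partitions.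
\<close>
theorem cauchy_binet:
  fixes A B :: "nat \<Rightarrow> nat \<Rightarrow> 'a::comm_ring_1"
  shows "det (mat n n (\<lambda>(i, j). \<Sum>s<n + k. A i s * B s j)) =
    (\<Sum>lam\<in>Parts n k. det (mat n n (\<lambda>(i, l). A i (expo n lam l))) * det (mat n n (\<lambda>(l, j). B (expo n lam l) j)))"
proof -
  let ?P = "{p. p permutes {0..<n}}"
  let ?G = "{0..<n} \<rightarrow>\<^sub>E {..<n + k}"
  let ?d = "\<lambda>g. det (mat n n (\<lambda>(i, j). B (g i) j))"
  have fP: "finite ?P" by (rule finite_permutations) simp
  have fG: "finite ?G" by (rule finite_PiE) auto
  have "det (mat n n (\<lambda>(i, j). \<Sum>s<n + k. A i s * B s j)) =
      (\<Sum>p\<in>?P. signof p * (\<Prod>i = 0..<n. \<Sum>s<n + k. A i s * B s (p i)))"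
    by (rule det_mat)
  also have "\<dots> = (\<Sum>p\<in>?P. \<Sum>g\<in>?G. signof p * (\<Prod>i = 0..<n. A i (g i) * B (g i) (p i)))"
    by (simp add: prod_sum_PiE sum_distrib_left)
  also have "\<dots> = (\<Sum>g\<in>?G. \<Sum>p\<in>?P. signof p * (\<Prod>i = 0..<n. A i (g i) * B (g i) (p i)))"
    by (rule sum.swap)
  also have "\<dots> = (\<Sum>g\<in>?G. (\<Prod>i = 0..<n. A i (g i)) * ?d g)"
    by (intro sum.cong refl, subst det_mat) (simp add: prod.distrib sum_distrib_left mult.left_commute)
  also have "\<dots> = (\<Sum>g\<in>{g \<in> ?G. inj_on g {0..<n}}. (\<Prod>i = 0..<n. A i (g i)) * ?d g)"
  proof (rule sum.mono_neutral_right[OF fG])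
    show "\<forall>g\<in>?G - {g \<in> ?G. inj_on g {0..<n}}. (\<Prod>i = 0..<n. A i (g i)) * ?d g = 0"
    proof
      fix g assume "g \<in> ?G - {g \<in> ?G. inj_on g {0..<n}}"
      then obtain i j where ij: "i < n" "j < n" "i \<noteq> j" "g i = g j" by (auto simp: inj_on_def)
      have "?d g = 0"
        by (rule det_identical_rows[of _ n i j]) (use ij in \<open>auto intro!: eq_vecI\<close>)
      then show "(\<Prod>i = 0..<n. A i (g i)) * ?d g = 0" by simp
    qed
  qed auto
  also have "\<dots> = (\<Sum>(lam, p)\<in>Parts n k \<times> ?P. (\<Prod>i = 0..<n. A i (expo n lam (p i))) * ?d (\<lambda>i. expo n lam (p i)))"
    by (subst sum.reindex_bij_betw[OF bij_betw_injective_maps, symmetric])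
      (auto intro!: sum.cong arg_cong2[where f = "(*)"] prod.cong det_mat_cong)
  also have "\<dots> = (\<Sum>lam\<in>Parts n k. \<Sum>p\<in>?P. (\<Prod>i = 0..<n. A i (expo n lam (p i))) * ?d (\<lambda>i. expo n lam (p i)))"
    by (rule sum.cartesian_product[symmetric])
  also have "\<dots> = (\<Sum>lam\<in>Parts n k. det (mat n n (\<lambda>(i, l). A i (expo n lam l))) * ?d (expo n lam))"
  proof (rule sum.cong[OF refl])
    fix lam
    have "(\<Sum>p\<in>?P. (\<Prod>i = 0..<n. A i (expo n lam (p i))) * ?d (\<lambda>i. expo n lam (p i))) =
      (\<Sum>p\<in>?P. (signof p * (\<Prod>i = 0..<n. A i (expo n lam (p i)))) * ?d (expo n lam))"
      by (intro sum.cong refl) (simp add: det_mat_permute_rows[where f = "\<lambda>l j. B (expo n lam l) j"] mult_ac)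
    then show "(\<Sum>p\<in>?P. (\<Prod>i = 0..<n. A i (expo n lam (p i))) * ?d (\<lambda>i. expo n lam (p i))) =
      det (mat n n (\<lambda>(i, l). A i (expo n lam l))) * ?d (expo n lam)"
      by (subst det_mat) (simp only: sum_distrib_right)
  qed
  finally show ?thesis .
qed

section \<open>Alternants\<close>

text \<open>
  The numerator of the factorial Schur function, and its denominator when \<open>lam\<close> is the empty partition.
  The variables are numbered from \<open>0\<close>, the parameters from \<open>1\<close>.
\<close>
definition alternant :: "nat \<Rightarrow> nat list \<Rightarrow> (nat \<Rightarrow> 'a::comm_ring_1) \<Rightarrow> (nat \<Rightarrow> 'a) \<Rightarrow> 'a" where
  "alternant n lam z a = det (mat n n (\<lambda>(i, j). fact_power (z j) a (expo n lam i)))"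

text \<open>
  The sign is written as \<open>(-1)\<^sup>r (-1)\<^sup>s\<close>, and not as \<open>(-1)\<^bsup>r - s\<^esup>\<close>, so that it splits into a row and a
  column factor of a matrix also where \<open>s > r\<close>.
\<close>
lemma elem_sym_expand:
  fixes x :: "'a::comm_ring_1"
  assumes "r < M"
  shows "fact_power x a r = (\<Sum>s<M. (- 1) ^ r * (- 1) ^ s * elem_sym (int r - int s) r a * x ^ s)"
proof -
  let ?g = "\<lambda>B. (\<Prod>i\<in>B. a i)"
  have "fact_power x a r = (\<Prod>i\<in>{1..r}. - a i + x)" by (simp add: fact_power_def)
  also have "\<dots> = (\<Sum>B\<in>Pow {1..r}. (\<Prod>i\<in>B. - a i) * (\<Prod>i\<in>{1..r} - B. x))"
    by (rule prod_add) simp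
  also have "\<dots> = (\<Sum>B\<in>Pow {1..r}. (- 1) ^ card B * x ^ (r - card B) * ?g B)"
  proof (rule sum.cong[OF refl])
    fix B assume "B \<in> Pow {1..r}"
    then have "B \<subseteq> {1..r}" "finite B" using finite_subset by auto
    then show "(\<Prod>i\<in>B. - a i) * (\<Prod>i\<in>{1..r} - B. x) = (- 1) ^ card B * x ^ (r - card B) * ?g B"
      by (simp add: prod_uminus card_Diff_subset mult_ac)
  qed
  also have "\<dots> = (\<Sum>c\<in>{..r}. \<Sum>B | B \<in> Pow {1..r} \<and> card B = c. (- 1) ^ card B * x ^ (r - card B) * ?g B)"
    by (rule sum.group[symmetric]) (auto intro: card_mono[where B = "{1..r}", simplified])
  also have "\<dots> = (\<Sum>c\<in>{..r}. (- 1) ^ c * x ^ (r - c) * elem_sym (int c) r a)"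
    by (intro sum.cong refl) (simp add: elem_sym_def sum_distrib_left)
  also have "\<dots> = (\<Sum>s\<in>{..r}. (- 1) ^ (r - s) * x ^ s * elem_sym (int r - int s) r a)"
    by (rule sum.reindex_bij_witness[where i = "\<lambda>s. r - s" and j = "\<lambda>s. r - s"]) (auto simp: of_nat_diff)
  also have "\<dots> = (\<Sum>s\<in>{..r}. (- 1) ^ r * (- 1) ^ s * elem_sym (int r - int s) r a * x ^ s)"
  proof (rule sum.cong[OF refl])
    fix s assume "s \<in> {..r}"
    then have "(- 1 :: 'a) ^ (r - s) = (- 1) ^ r * (- 1) ^ s" by (simp add: minus_one_power_iff)
    then show "(- 1) ^ (r - s) * x ^ s * elem_sym (int r - int s) r a = (- 1) ^ r * (- 1) ^ s * elem_sym (int r - int s) r a * x ^ s"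
      by (simp add: mult_ac)
  qed
  also have "\<dots> = (\<Sum>s<M. (- 1) ^ r * (- 1) ^ s * elem_sym (int r - int s) r a * x ^ s)"
    by (rule sum.mono_neutral_left) (use assms in \<open>auto simp: elem_sym_def\<close>)
  finally show ?thesis .
qed

text \<open>
  A permutation cannot map \<open>k + 1\<close> rows injectively into the \<open>k\<close> columns to the left of the zero block.
\<close>
lemma det_upper_right_zero_block:
  assumes "k < n" and "\<And>i j. i \<le> k \<Longrightarrow> k \<le> j \<Longrightarrow> j < n \<Longrightarrow> f i j = (0 :: 'a::comm_ring_1)"
  shows "det (mat n n (\<lambda>(i, j). f i j)) = 0"
  unfolding det_mat
proof (rule sum.neutral, intro ballI)
  fix p assume "p \<in> {p. p permutes {0..<n}}"
  then have p: "p permutes {0..<n}" by simp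
  have "\<exists>i\<le>k. k \<le> p i"
  proof (rule ccontr)
    assume "\<not> ?thesis"
    then have "p ` {..k} \<subseteq> {..<k}" by auto
    then have "card (p ` {..k}) \<le> k" using card_mono[of "{..<k}"] by auto
    moreover have "card (p ` {..k}) = Suc k"
      using permutes_inj_on[OF p] by (simp add: card_image)
    ultimately show False by simp
  qed
  then obtain i where i: "i \<le> k" "k \<le> p i" by blast
  have "p i < n" using permutes_in_image[OF p, of i] i assms(1) by simp
  then have "f i (p i) = 0" using i assms(2) by simp
  then have "(\<Prod>i = 0..<n. f i (p i)) = 0" using i assms(1) by (intro prod_zero) auto
  then show "signof p * (\<Prod>i = 0..<n. f i (p i)) = 0" by simp
qed

lemma det_mat_transpose: "det (mat n n (\<lambda>(i, j). f j i)) = det (mat n n (\<lambda>(i, j). f i j))"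
proof -
  have "mat n n (\<lambda>(i, j). f j i) = transpose_mat (mat n n (\<lambda>(i, j). f i j))" by (intro eq_matI) auto
  then show ?thesis using det_transpose[of "mat n n (\<lambda>(i, j). f i j)" n] by simp
qed

lemma det_mat_scale:
  "det (mat n n (\<lambda>(i, j). c i * d j * f i j)) = (\<Prod>i<n. c i) * (\<Prod>j<n. d j) * det (mat n n (\<lambda>(i, j). f i j))"
  for c d :: "nat \<Rightarrow> 'a::comm_ring_1"
proof -
  have eq: "(\<Prod>i = 0..<n. c i * d (p i) * f i (p i)) = (\<Prod>i<n. c i) * (\<Prod>j<n. d j) * (\<Prod>i = 0..<n. f i (p i))"
    if "p permutes {0..<n}" for p
  proof -
    have "(\<Prod>i = 0..<n. d (p i)) = (\<Prod>j<n. d j)"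
      using prod.permute[OF that, of d, symmetric] by (simp only: comp_def atLeast0LessThan)
    then show ?thesis by (simp add: prod.distrib atLeast0LessThan)
  qed
  show ?thesis unfolding det_mat sum_distrib_left
    by (rule sum.cong[OF refl]) (simp only: mem_Collect_eq eq, simp only: mult_ac)
qed

section \<open>Conjugate partitions and empty sites\<close>

text \<open>
  The rows of length at least \<open>j\<close> form an initial segment, of which the conjugate partition is the length.
\<close>
lemma less_conj_part_iff:
  assumes "lam \<in> Parts n k" "l < n"
  shows "l < conj_part lam j \<longleftrightarrow> j \<le> lam ! l"
proof -
  define D where "D = {i. i < n \<and> j \<le> lam ! i}"
  have c: "conj_part lam j = card D" using Parts_length[OF assms(1)] by (simp add: conj_part_def D_def)
  have fin: "finite D" by (simp add: D_def)
  have down: "i \<in> D" if "i \<le> i'" "i' \<in> D" for i i'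
    using that Parts_nth_mono[OF assms(1), of i i'] by (auto simp: D_def)
  show ?thesis
  proof
    assume "j \<le> lam ! l"
    then have "l \<in> D" using assms by (simp add: D_def)
    then have "{..l} \<subseteq> D" using down by auto
    then have "card {..l} \<le> card D" using fin by (rule card_mono[rotated])
    then show "l < conj_part lam j" by (simp add: c)
  next
    assume "l < conj_part lam j"
    show "j \<le> lam ! l"
    proof (rule ccontr)
      assume "\<not> j \<le> lam ! l"
      then have "l \<notin> D" by (simp add: D_def)
      then have "D \<subseteq> {..<l}" using down by (metis lessThan_iff linorder_not_less subsetI)
      then have "card D \<le> l" using card_mono[of "{..<l}" D] by simp
      then show False using \<open>l < conj_part lam j\<close> c by simp
    qed
  qed
qed

lemma conj_part_le: "length lam = n \<Longrightarrow> conj_part lam j \<le> n"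
  unfolding conj_part_def by (metis (no_types, lifting) card_Collect_less_nat card_mono finite_Collect_less_nat mem_Collect_eq subsetI)

lemma conj_part_antimono: "i \<le> j \<Longrightarrow> conj_part lam j \<le> conj_part lam i"
  unfolding conj_part_def by (rule card_mono) auto

text \<open>
  All sites (counted from \<open>0\<close>), the \<open>n\<close> occupied ones in decreasing order followed by the \<open>k\<close> empty ones
  in increasing order. The \<open>j\<close>-th empty site is \<open>n - 1 + j - \<lambda>'\<^sub>j\<close>.
\<close>
definition site_perm :: "nat \<Rightarrow> nat \<Rightarrow> nat list \<Rightarrow> nat \<Rightarrow> nat" where
  "site_perm n k lam p = 
     (if p < n then expo n lam p else if p < n + k then p - conj_part lam (p - n + 1) else p)"

lemma site_perm_permutes:
  assumes lam: "lam \<in> Parts n k"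
  shows "site_perm n k lam permutes {0..<n + k}"
proof -
  let ?s = "site_perm n k lam"
  have cle: "conj_part lam j \<le> n" for j using conj_part_le Parts_length[OF lam] by blast
  have hole: "?s p = p - conj_part lam (p - n + 1)" if "n \<le> p" "p < n + k" for p 
    using that by (simp add: site_perm_def)
  have ne: "?s p \<noteq> ?s r" if "p < n" "n \<le> r" "r < n + k" for p r
  proof -
    have "?s p = lam ! p + n - (p + 1)" using that by (simp add: site_perm_def expo_def)
    moreover have "p < conj_part lam (r - n + 1) \<longleftrightarrow> r - n + 1 \<le> lam ! p"
      by (rule less_conj_part_iff[OF lam that(1)])
    ultimately show ?thesis using hole[of r] cle[of "r - n + 1"] that by linarith
  qed
  have inc: "?s p < ?s r" if "n \<le> p" "p < r" "r < n + k" for p r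
    using conj_part_antimono[of "p - n + 1" "r - n + 1" lam] cle[of "p - n + 1"] hole[of p] hole[of r] that 
    by linarith
  have dec: "?s r < ?s p" if "p < r" "r < n" for p r
    using expo_strict[OF lam that] that by (simp add: site_perm_def)
  have "inj_on ?s {0..<n + k}"
  proof (rule linorder_inj_onI)
    fix p r assume "p < r" "p \<in> {0..<n + k}" "r \<in> {0..<n + k}"
    then show "?s p \<noteq> ?s r"
      using ne[of p r] inc[of p r] dec[of p r] by (cases "r < n"; cases "p < n") auto
  qed auto
  moreover have "?s ` {0..<n + k} \<subseteq> {0..<n + k}"
    using expo_less[OF lam] by (auto simp: site_perm_def)
  ultimately have "bij_betw ?s {0..<n + k} {0..<n + k}"
    by (intro bij_betw_imageI endo_inj_surj) auto
  then show ?thesis by (rule bij_imp_permutes) (auto simp: site_perm_def)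
qed

text \<open>
  Removing a box from the last nonempty row moves one particle from a site \<open>m\<close> to the empty site
  \<open>m - 1\<close>. This changes one column length by one and the permutation by one transposition.
\<close>
lemma sign_site_perm:
  assumes "lam \<in> Parts n k"
  shows "sign (site_perm n k lam) = (- 1) ^ (\<Sum>j<k. conj_part lam (j + 1)) * sign (site_perm n k (replicate n 0))"
  using assms
proof (induction "sum_list lam" arbitrary: lam rule: less_induct)
  case less
  note lam = \<open>lam \<in> Parts n k\<close>
  have len: "length lam = n" using Parts_length[OF lam] .
  show ?case
  proof (cases "\<exists>i<n. 0 < lam ! i")
    case False
    then have "lam = replicate n 0" using len by (intro nth_equalityI) auto
    moreover have "conj_part (replicate n 0) (Suc j) = 0" for j
      by (simp add: conj_part_def)
    ultimately show ?thesis by simp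
  next
    case True
    define l where "l = Max {i. i < n \<and> 0 < lam ! i}"
    have "l \<in> {i. i < n \<and> 0 < lam ! i}" unfolding l_def by (rule Max_in) (use True in auto)
    then have l: "l < n" "0 < lam ! l" by auto
    have after: "lam ! i = 0" if "l < i" "i < n" for i
    proof (rule ccontr)
      assume "lam ! i \<noteq> 0"
      then have "i \<le> l" unfolding l_def using that by (intro Max_ge) auto
      then show False using that by simp
    qed
    define mu where "mu = lam[l := lam ! l - 1]"
    have mu_nth: "mu ! i = (if i = l then lam ! l - 1 else lam ! i)" if "i < n" for i
      using that len by (simp add: mu_def)
    have mu: "mu \<in> Parts n k"
      unfolding Parts_def
    proof (intro CollectI conjI)
      show lmu: "length mu = n" by (simp add: mu_def len)
      show "sorted_wrt (\<ge>) mu"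
        unfolding sorted_wrt_iff_nth_less lmu
        using Parts_nth_mono[OF lam] after by (auto simp: mu_nth)
          (metis One_nat_def diff_le_self le_trans less_imp_le_nat)
      show "\<forall>p\<in>set mu. p \<le> k" 
        using Parts_nth_le[OF lam] lmu by (auto simp: in_set_conv_nth mu_nth) (metis diff_le_self le_trans l(1))
    qed
    have sum: "sum_list mu < sum_list lam"
      using l len elem_le_sum_list[of l lam] by (simp add: mu_def sum_list_update)
    have lenmu: "length mu = n" using Parts_length[OF mu] .
    have conj_l: "conj_part lam (lam ! l) = l + 1" "conj_part mu (lam ! l) = l"
    proof -
      have "{i. i < n \<and> lam ! l \<le> lam ! i} = {..l}"
        using after Parts_nth_mono[OF lam, of _ l] l by (auto simp: not_less[symmetric])
      then show "conj_part lam (lam ! l) = l + 1" by (simp add: conj_part_def len)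
      have "lam ! l \<le> mu ! i \<longleftrightarrow> i < l" if "i < n" for i
        using after[of i] Parts_nth_mono[OF lam, of i l] l mu_nth[OF that] that
        by (cases i l rule: linorder_cases) auto
      then have "{i. i < n \<and> lam ! l \<le> mu ! i} = {..<l}" using l by auto
      then show "conj_part mu (lam ! l) = l" by (simp add: conj_part_def lenmu)
    qed
    have conj_other: "conj_part mu j = conj_part lam j" if "j \<noteq> lam ! l" for j
      unfolding conj_part_def len lenmu using that l by (intro arg_cong[of _ _ card]) (auto simp: mu_nth split: if_splits)
    define m where "m = expo n lam l"
    have m: "expo n mu l = m - 1" "0 < m" "m < n + k"
      using l expo_less[OF lam l(1)] by (auto simp: m_def expo_def mu_nth)
    have expo_other: "expo n mu i = expo n lam i" if "i < n" "i \<noteq> l" for i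
      using that by (simp add: expo_def mu_nth)
    note pl = site_perm_permutes[OF lam] and pm = site_perm_permutes[OF mu]
    have atl: "site_perm n k lam l = m" "site_perm n k mu l = m - 1"
      using l m by (auto simp: site_perm_def m_def)
    \<comment> \<open>At a position other than that of the moved particle and of the new hole both permutations have the
      same value, which by injectivity is neither \<open>m\<close> nor \<open>m - 1\<close>.\<close>
    have comp: "site_perm n k lam = transpose m (m - 1) \<circ> site_perm n k mu"
    proof (rule ext)
      fix p
      have avoid: "site_perm n k lam p \<noteq> m" "site_perm n k mu p \<noteq> m - 1" if "p \<noteq> l"
        using that atl permutes_inj[OF pl] permutes_inj[OF pm] by (metis injD)+
      have same: "site_perm n k lam p = (transpose m (m - 1) \<circ> site_perm n k mu) p" 
        if "p \<noteq> l" "site_perm n k lam p = site_perm n k mu p"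
        using avoid[OF that(1)] that(2) by (simp add: transpose_def)
      consider "p = l" | "p < n" "p \<noteq> l" | "n \<le> p" "p < n + k" "p - n + 1 = lam ! l" 
        | "n \<le> p" "p < n + k" "p - n + 1 \<noteq> lam ! l" | "n + k \<le> p" by linarith
      then show "site_perm n k lam p = (transpose m (m - 1) \<circ> site_perm n k mu) p"
      proof cases
        case 1
        then show ?thesis using atl by simp
      next
        case 2
        then show ?thesis using expo_other by (intro same) (auto simp: site_perm_def)
      next
        case 3
        then have "site_perm n k lam p = m - 1" "site_perm n k mu p = m"
          using l by (auto simp: site_perm_def conj_l m_def expo_def)
        then show ?thesis by simp
      next
        case 4
        then show ?thesis using l conj_other by (intro same) (auto simp: site_perm_def)
      next
        case 5
        then show ?thesis using l by (intro same) (auto simp: site_perm_def)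
      qed
    qed
    have sum_conj: "(\<Sum>j<k. conj_part lam (j + 1)) = Suc (\<Sum>j<k. conj_part mu (j + 1))"
    proof -
      \<comment> \<open>The shortened column has number \<open>lam ! l\<close>, counted from \<open>1\<close>.\<close>
      define j0 where "j0 = lam ! l - 1"
      have j0: "j0 \<in> {..<k}" "j0 + 1 = lam ! l" using l Parts_nth_le[OF lam l(1)] by (auto simp: j0_def)
      have "(\<Sum>j\<in>{..<k} - {j0}. conj_part lam (j + 1)) = (\<Sum>j\<in>{..<k} - {j0}. conj_part mu (j + 1))"
        using j0 by (intro sum.cong) (auto simp: conj_other)
      then show ?thesis using j0 conj_l by (simp add: sum.remove[OF finite_lessThan j0(1)])
    qed
    have "sign (site_perm n k lam) = - sign (site_perm n k mu)"
      unfolding comp using m permutation_permutes[THEN iffD2, of "site_perm n k mu"] pm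
      by (subst sign_compose) (auto simp: sign_swap_id permutation_swap_id intro: permutes_imp_permutation[of "{0..<n + k}"])
    also have "\<dots> = (- 1) ^ (\<Sum>j<k. conj_part lam (j + 1)) * sign (site_perm n k (replicate n 0))"
      unfolding less.hyps[OF sum mu] sum_conj by simp
    finally show ?thesis .
  qed
qed

section \<open>The dual Jacobi-Trudi formula\<close>

text \<open>
  Elementary symmetric polynomials as coefficients of the eigenvalue \<open>\<Prod>\<^sub>j (1 + z\<^sub>j x)\<close> of \<open>E(x)\<close>.
\<close>
definition esym :: "nat \<Rightarrow> (nat \<Rightarrow> 'a::comm_ring_1) \<Rightarrow> int \<Rightarrow> 'a" where
  "esym n z r = (if r < 0 then 0 else poly.coeff (\<Prod>j<n. [:1, z j:]) (nat r))"

text \<open>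
  The determinant \<open>det (e\<^bsub>\<lambda>'\<^sub>i - i + j\<^esub>(z))\<close> in the same Leibniz form as the operator \<open>S\<^sub>\<lambda>\<close>.
\<close>
definition dual_jt :: "nat \<Rightarrow> nat \<Rightarrow> nat list \<Rightarrow> (nat \<Rightarrow> 'a::comm_ring_1) \<Rightarrow> 'a" where
  "dual_jt n k lam z = 
     (\<Sum>p | p permutes {1..k}. of_int (sign p) * (\<Prod>i = 1..k. esym n z (int (conj_part lam i) - int i + int (p i))))"

lemma degree_prod_linear: "Polynomial.degree (\<Prod>j<n. [:1, z j:]) \<le> (n :: nat)" for z :: "nat \<Rightarrow> 'a::comm_ring_1"
proof (induction n)
  case (Suc n)
  have "Polynomial.degree ((\<Prod>j<n. [:1, z j:]) * [:1, z n:]) \<le> Polynomial.degree (\<Prod>j<n. [:1, z j:]) + Polynomial.degree [:1, z n:]"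
    by (rule degree_mult_le)
  also have "\<dots> \<le> n + 1" using Suc.IH by (intro add_mono) auto
  finally show ?case by simp
qed simp

lemma esym_0: "esym n z 0 = 1"
  by (simp add: esym_def poly_0_coeff_0[symmetric] poly_prod)

lemma esym_gt: "int n < r \<Longrightarrow> esym n z r = 0"
  by (auto simp: esym_def intro!: coeff_eq_0 le_less_trans[OF degree_prod_linear])

text \<open>
  At \<open>u = -1\<close> and \<open>y = z\<^sub>j\<close> this is the linear relation between powers of \<open>z\<^sub>j\<close> on which the dual
  Jacobi-Trudi formula rests.
\<close>
lemma sum_esym_homogeneous:
  fixes z :: "nat \<Rightarrow> 'a::comm_ring_1"
  shows "(\<Sum>r\<le>n. esym n z (int r) * u ^ r * y ^ (n - r)) = (\<Prod>j<n. y + z j * u)"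
proof (induction n)
  case (Suc n)
  define p where "p = (\<Prod>j<n. [:1, z j:])"
  have e: "esym n z (int r) = poly.coeff p r" for r by (simp add: esym_def p_def)
  have eS: "esym (Suc n) z (int r) = poly.coeff p r + z n * (case r of 0 \<Rightarrow> 0 | Suc r' \<Rightarrow> poly.coeff p r')" for r
  proof -
    have "(\<Prod>j<Suc n. [:1, z j:]) = [:1, z n:] * p" by (simp add: p_def mult.commute)
    then show ?thesis by (simp add: esym_def coeff_pCons split: nat.splits)
  qed
  have top: "poly.coeff p (Suc n) = 0"
    using degree_prod_linear[of z n] by (intro coeff_eq_0) (simp add: p_def)
  have "(\<Sum>r\<le>Suc n. esym (Suc n) z (int r) * u ^ r * y ^ (Suc n - r)) =
     (\<Sum>r\<le>Suc n. poly.coeff p r * u ^ r * y ^ (Suc n - r)) +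
     (\<Sum>r\<le>Suc n. z n * (case r of 0 \<Rightarrow> 0 | Suc r' \<Rightarrow> poly.coeff p r') * u ^ r * y ^ (Suc n - r))"
    by (simp only: eS flip: sum.distrib) (simp add: algebra_simps)
  also have "(\<Sum>r\<le>Suc n. poly.coeff p r * u ^ r * y ^ (Suc n - r)) = (\<Sum>r\<le>n. y * (poly.coeff p r * u ^ r * y ^ (n - r)))"
    by (simp only: sum.atMost_Suc top) (auto intro!: sum.cong simp: Suc_diff_le)
  also have "(\<Sum>r\<le>Suc n. z n * (case r of 0 \<Rightarrow> 0 | Suc r' \<Rightarrow> poly.coeff p r') * u ^ r * y ^ (Suc n - r)) =
     (\<Sum>r\<le>n. (z n * u) * (poly.coeff p r * u ^ r * y ^ (n - r)))"
    by (subst sum.atMost_Suc_shift) (auto intro!: sum.cong simp: algebra_simps)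
  finally show ?case using Suc.IH by (simp add: e algebra_simps flip: sum_distrib_left)
qed (simp add: esym_0)

lemma det_mat_block_upper_right_zero:
  fixes f :: "nat \<Rightarrow> nat \<Rightarrow> 'a::idom"
  assumes "\<And>i j. i < n \<Longrightarrow> n \<le> j \<Longrightarrow> j < n + k \<Longrightarrow> f i j = 0"
  shows "det (mat (n + k) (n + k) (\<lambda>(i, j). f i j)) = 
         det (mat n n (\<lambda>(i, j). f i j)) * det (mat k k (\<lambda>(i, j). f (n + i) (n + j)))"
proof -
  have "mat (n + k) (n + k) (\<lambda>(i, j). f i j) = four_block_mat (mat n n (\<lambda>(i, j). f i j)) (0\<^sub>m n k)
      (mat k n (\<lambda>(i, j). f (n + i) j)) (mat k k (\<lambda>(i, j). f (n + i) (n + j)))"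
    using assms by (intro eq_matI) auto
  then show ?thesis by (simp add: det_four_block_mat_upper_right_zero[where n = n and m = k])
qed

lemma det_mat_block_lower_left_zero:
  fixes f :: "nat \<Rightarrow> nat \<Rightarrow> 'a::idom"
  assumes "\<And>i j. n \<le> i \<Longrightarrow> i < n + k \<Longrightarrow> j < n \<Longrightarrow> f i j = 0"
  shows "det (mat (n + k) (n + k) (\<lambda>(i, j). f i j)) = 
         det (mat n n (\<lambda>(i, j). f i j)) * det (mat k k (\<lambda>(i, j). f (n + i) (n + j)))"
  using det_mat_block_upper_right_zero[of n k "\<lambda>i j. f j i"] assms
  by (simp add: det_mat_transpose[of _ f] det_mat_transpose[of k "\<lambda>i j. f (n + i) (n + j)"])

lemma det_mat_mult:
  "det (mat n n (\<lambda>(i, j). \<Sum>s<n. A i s * B s j)) = 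
   det (mat n n (\<lambda>(i, j). A i j)) * det (mat n n (\<lambda>(i, j). B i j))" for A B :: "nat \<Rightarrow> nat \<Rightarrow> 'a::comm_ring_1"
proof -
  have "mat n n (\<lambda>(i, j). \<Sum>s<n. A i s * B s j) = mat n n (\<lambda>(i, j). A i j) * mat n n (\<lambda>(i, j). B i j)"
    by (intro eq_matI) (auto simp: scalar_prod_def atLeast0LessThan)
  then show ?thesis by (simp add: det_mult[of _ n])
qed

lemma det_mat_lower_triangular:
  fixes f :: "nat \<Rightarrow> nat \<Rightarrow> 'a::comm_ring_1"
  assumes "\<And>i j. i < j \<Longrightarrow> j < n \<Longrightarrow> f i j = 0"
  shows "det (mat n n (\<lambda>(i, j). f i j)) = (\<Prod>i<n. f i i)"
proof -
  have "det (mat n n (\<lambda>(i, j). f i j)) = prod_list (diag_mat (mat n n (\<lambda>(i, j). f i j)))"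
    by (rule det_lower_triangular[where n = n]) (use assms in auto)
  also have "diag_mat (mat n n (\<lambda>(i, j). f i j)) = map (\<lambda>i. f i i) [0..<n]"
    by (auto simp: diag_mat_def)
  finally show ?thesis using prod.distinct_set_conv_list[of "[0..<n]" "\<lambda>i. f i i"] by (simp add: atLeast0LessThan)
qed

lemma det_mat_upper_triangular:
  fixes f :: "nat \<Rightarrow> nat \<Rightarrow> 'a::comm_ring_1"
  assumes "\<And>i j. j < i \<Longrightarrow> i < n \<Longrightarrow> f i j = 0"
  shows "det (mat n n (\<lambda>(i, j). f i j)) = (\<Prod>i<n. f i i)"
  using det_mat_lower_triangular[of n "\<lambda>i j. f j i"] assms by (simp add: det_mat_transpose[of n f])

lemma conj_part_replicate: "conj_part (replicate n 0) (Suc j) = 0"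
  by (simp add: conj_part_def)

lemma replicate_Parts: "c \<le> k \<Longrightarrow> replicate n c \<in> Parts n k"
  by (auto simp: Parts_def sorted_wrt_iff_nth_less)

lemma dual_jt_det:
  "dual_jt n k lam z = det (mat k k (\<lambda>(i, j). esym n z (int (conj_part lam (j + 1)) - int j + int i)))"
proof -
  let ?g = "\<lambda>i j. esym n z (int (conj_part lam (i + 1)) - int i + int j)"
  let ?h = "\<lambda>i j. esym n z (int (conj_part lam i) - int i + int j)"
  have bij: "bij_betw Suc {0..<k} {1..k}" by (simp add: bij_betw_def image_Suc_atLeastLessThan atLeastLessThanSuc_atLeastAtMost)
  have bij': "bij_betw (\<lambda>i. i - 1) {1..k} {0..<k}" 
    by (rule bij_betw_byWitness[where f' = Suc]) auto
  have "det (mat k k (\<lambda>(i, j). esym n z (int (conj_part lam (j + 1)) - int j + int i))) = det (mat k k (\<lambda>(i, j). ?g i j))"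
    by (rule det_mat_transpose)
  also have "\<dots> = (\<Sum>p | p permutes {0..<k}. signof p * (\<Prod>i = 0..<k. ?g i (p i)))" by (rule det_mat)
  also have "\<dots> = (\<Sum>p | p permutes {1..k}. of_int (sign p) * (\<Prod>i = 1..k. ?h i (p i)))"
  proof (rule sum.reindex_bij_witness[where j = "map_permutation {0..<k} Suc" and i = "map_permutation {1..k} (\<lambda>i. i - 1)"])
    fix p assume "p \<in> {p. p permutes {0..<k}}"
    then have p: "p permutes {0..<k}" by simp
    show "map_permutation {1..k} (\<lambda>i. i - 1) (map_permutation {0..<k} Suc p) = p"
      by (rule map_permutation_compose_inv[OF bij p]) simp
    show "map_permutation {0..<k} Suc p \<in> {p. p permutes {1..k}}"
      using map_permutation_permutes[OF bij p] by simp
    have "(\<Prod>i = 1..k. ?h i (map_permutation {0..<k} Suc p i)) = (\<Prod>i = 0..<k. ?h (Suc i) (map_permutation {0..<k} Suc p (Suc i)))"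
      by (rule prod.reindex_bij_betw[OF bij, symmetric])
    also have "\<dots> = (\<Prod>i = 0..<k. ?g i (p i))"
      by (intro prod.cong refl) (simp add: map_permutation_apply algebra_simps)
    finally show "of_int (sign (map_permutation {0..<k} Suc p)) * (\<Prod>i = 1..k. ?h i (map_permutation {0..<k} Suc p i)) = 
        signof p * (\<Prod>i = 0..<k. ?g i (p i))"
      using p by (simp add: sign_map_permutation)
  next
    fix p assume "p \<in> {p. p permutes {1..k}}"
    then have p: "p permutes {1..k}" by simp
    show "map_permutation {0..<k} Suc (map_permutation {1..k} (\<lambda>i. i - 1) p) = p"
      by (rule map_permutation_compose_inv[OF bij' p]) simp
    show "map_permutation {1..k} (\<lambda>i. i - 1) p \<in> {p. p permutes {0..<k}}"
      using map_permutation_permutes[OF bij' p] by simp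
  qed
  finally show ?thesis by (simp add: dual_jt_def)
qed

text \<open>
  A complementary minor argument. Let \<open>Q(y) = \<Prod>\<^sub>j (y - z\<^sub>j)\<close>, a polynomial whose coefficients are the
  \<open>\<plusminus> e\<^sub>r(z)\<close>. The rows of a square matrix of size \<open>n + k\<close> are the unit vectors of the occupied sites
  and the coefficient vectors of \<open>y\<^sup>i Q(y)\<close> for \<open>i < k\<close>; its determinant is the minor of the latter at the empty
  sites, that is \<open>\<plusminus> det (e\<^bsub>\<lambda>'\<^sub>i - i + j\<^esub>)\<close>. Multiplication with the matrix \<open>Y\<close> that evaluates at the \<open>z\<^sub>j\<close> and
  completes this by coordinates kills \<open>y\<^sup>i Q(y)\<close> at the \<open>z\<^sub>j\<close> and leaves the alternant of \<open>\<lambda>\<close>. Up to sign,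
  \<open>det Y\<close> is the alternant of the empty partition.
\<close>
theorem dual_jacobi_trudi:
  fixes z :: "nat \<Rightarrow> 'a::idom"
  assumes lam: "lam \<in> Parts n k"
  shows "det (mat n n (\<lambda>(i, j). z j ^ expo n lam i)) = 
         det (mat n n (\<lambda>(i, j). z j ^ expo n (replicate n 0) i)) * dual_jt n k lam z"
proof -
  define N where "N = n + k"
  \<comment> \<open>\<open>cf i\<close> is the coefficient vector of \<open>y\<^sup>i Q(y)\<close>.\<close>
  define cf where "cf i s = (if s \<le> n + i then (- 1) ^ (n + i - s) * esym n z (int (n + i) - int s) else 0)" for i s
  define Y where "Y s c = (if c < n then z c ^ s else if s = c then 1 else 0)" for s c
  define Ec where "Ec mu = det (mat k k (\<lambda>(i, j). cf i (site_perm n k mu (n + j))))" for mu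
  have cf_root: "(\<Sum>s<N. cf i s * z c ^ s) = 0" if "i < k" "c < n" for i c
  proof -
    have "(\<Sum>s<N. cf i s * z c ^ s) = (\<Sum>s\<in>{i..n + i}. cf i s * z c ^ s)"
      by (rule sum.mono_neutral_right) (use that in \<open>auto simp: N_def cf_def esym_gt\<close>)
    also have "\<dots> = (\<Sum>r\<le>n. z c ^ i * (esym n z (int r) * (- 1) ^ r * z c ^ (n - r)))"
      by (rule sum.reindex_bij_witness[where i = "\<lambda>r. n + i - r" and j = "\<lambda>s. n + i - s"])
        (auto simp: cf_def of_nat_diff mult_ac simp flip: power_add)
    also have "\<dots> = z c ^ i * (\<Prod>j<n. z c + z j * (- 1))"
      by (simp only: sum_distrib_left[symmetric] sum_esym_homogeneous)
    also have "(\<Prod>j<n. z c + z j * (- 1)) = 0" using that by (intro prod_zero) auto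
    finally show ?thesis by simp
  qed
  \<comment> \<open>The leading coefficient of \<open>y\<^sup>i Q(y)\<close> is \<open>1\<close>, at \<open>y\<^bsup>n + i\<^esup>\<close>.\<close>
  have cf_tri: "det (mat k k (\<lambda>(i, j). cf i (n + j))) = 1"
    by (subst det_mat_lower_triangular) (auto simp: cf_def esym_0)
  have main: "det (mat n n (\<lambda>(i, j). z j ^ expo n mu i)) = 
      Ec mu * (signof (site_perm n k mu) * det (mat N N (\<lambda>(i, j). Y i j)))" if mu: "mu \<in> Parts n k" for mu
  proof -
    define \<pi> where "\<pi> = site_perm n k mu"
    have perm: "\<pi> permutes {0..<N}" unfolding \<pi>_def N_def by (rule site_perm_permutes[OF mu])
    define M where "M p s = (if p < n then if p = s then 1 else 0 else cf (p - n) (\<pi> s))" for p s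
    have prod: "(\<Sum>s<N. M p s * Y (\<pi> s) c) = (if p < n then Y (\<pi> p) c else if c < n then 0 else cf (p - n) c)"
      if "p < N" "c < N" for p c
    proof (cases "p < n")
      case True
      then show ?thesis using that by (simp add: M_def if_distrib[of "\<lambda>x. x * _"] sum.delta' cong: if_cong)
    next
      case False
      then have "(\<Sum>s<N. M p s * Y (\<pi> s) c) = (\<Sum>s<N. cf (p - n) (\<pi> s) * Y (\<pi> s) c)" by (simp add: M_def)
      also have "\<dots> = (\<Sum>s<N. cf (p - n) s * Y s c)"
        using sum.permute[OF perm, of "\<lambda>s. cf (p - n) s * Y s c"] by (simp add: comp_def atLeast0LessThan)
      also have "\<dots> = (if c < n then 0 else cf (p - n) c)"
      proof (cases "c < n")
        case True
        then show ?thesis using cf_root[of "p - n" c] that False by (simp add: Y_def N_def)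
      next
        case c: False
        then have "(\<Sum>s<N. cf (p - n) s * Y s c) = (\<Sum>s<N. if s = c then cf (p - n) s else 0)"
          by (intro sum.cong) (auto simp: Y_def)
        then show ?thesis using c that by simp
      qed
      finally show ?thesis using False by simp
    qed
    have "det (mat N N (\<lambda>(p, c). \<Sum>s<N. M p s * Y (\<pi> s) c)) = 
        det (mat N N (\<lambda>(p, c). if p < n then Y (\<pi> p) c else if c < n then 0 else cf (p - n) c))"
      by (rule det_mat_cong) (rule prod)
    also have "\<dots> = det (mat n n (\<lambda>(p, c). if p < n then Y (\<pi> p) c else if c < n then 0 else cf (p - n) c)) * 
        det (mat k k (\<lambda>(i, j). cf i (n + j)))"
      unfolding N_def by (subst det_mat_block_lower_left_zero) auto
    also have "det (mat n n (\<lambda>(p, c). if p < n then Y (\<pi> p) c else if c < n then 0 else cf (p - n) c)) = 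
        det (mat n n (\<lambda>(i, j). z j ^ expo n mu i))"
      by (rule det_mat_cong) (simp add: Y_def \<pi>_def site_perm_def)
    finally have lhs: "det (mat N N (\<lambda>(p, c). \<Sum>s<N. M p s * Y (\<pi> s) c)) = det (mat n n (\<lambda>(i, j). z j ^ expo n mu i))"
      by (simp add: cf_tri)
    have "det (mat N N (\<lambda>(p, s). M p s)) = det (mat n n (\<lambda>(p, s). M p s)) * det (mat k k (\<lambda>(i, j). M (n + i) (n + j)))"
      unfolding N_def by (rule det_mat_block_upper_right_zero) (simp add: M_def)
    also have "det (mat n n (\<lambda>(p, s). M p s)) = 1"
      by (subst det_mat_lower_triangular) (auto simp: M_def)
    also have "det (mat k k (\<lambda>(i, j). M (n + i) (n + j))) = Ec mu"
      by (simp add: M_def Ec_def \<pi>_def)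
    finally have detM: "det (mat N N (\<lambda>(p, s). M p s)) = Ec mu" by simp
    have "det (mat N N (\<lambda>(p, c). \<Sum>s<N. M p s * Y (\<pi> s) c)) = 
        det (mat N N (\<lambda>(p, s). M p s)) * det (mat N N (\<lambda>(s, c). Y (\<pi> s) c))"
      by (rule det_mat_mult)
    also have "det (mat N N (\<lambda>(s, c). Y (\<pi> s) c)) = signof \<pi> * det (mat N N (\<lambda>(i, j). Y i j))"
      by (rule det_mat_permute_rows[OF perm])
    finally show ?thesis using lhs detM by (simp add: \<pi>_def)
  qed
  have "Ec (replicate n 0) = det (mat k k (\<lambda>(i, j). cf i (n + j)))"
    unfolding Ec_def by (rule det_mat_cong) (simp add: site_perm_def conj_part_replicate)
  \<comment> \<open>The case of the empty partition removes \<open>det Y\<close> from the formula.\<close>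
  then have empty: "det (mat n n (\<lambda>(i, j). z j ^ expo n (replicate n 0) i)) = 
      signof (site_perm n k (replicate n 0)) * det (mat N N (\<lambda>(i, j). Y i j))"
    using main[OF replicate_Parts[of 0 k n]] cf_tri by simp
  let ?c = "\<lambda>j. conj_part lam (j + 1)"
  have "Ec lam = det (mat k k (\<lambda>(i, j). (- 1) ^ i * ((- 1) ^ j * (- 1) ^ ?c j) * esym n z (int (?c j) - int j + int i)))"
    unfolding Ec_def
  proof (rule det_mat_cong)
    fix i j assume ij: "i < k" "j < k"
    have c: "?c j \<le> n" using conj_part_le Parts_length[OF lam] by blast
    have s: "site_perm n k lam (n + j) = n + j - ?c j" using ij by (simp add: site_perm_def)
    show "cf i (site_perm n k lam (n + j)) = (- 1) ^ i * ((- 1) ^ j * (- 1) ^ ?c j) * esym n z (int (?c j) - int j + int i)"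
    proof (cases "j \<le> ?c j + i")
      case True
      have idx: "int (n + i) - int (n + j - ?c j) = int (?c j) - int j + int i" using c by (simp add: of_nat_diff)
      have eq: "n + i - (n + j - ?c j) + 2 * j = i + j + ?c j" using c True by linarith
      have "even (n + i - (n + j - ?c j)) \<longleftrightarrow> even (i + j + ?c j)"
        unfolding eq[symmetric] by (simp only: dvd_add_left_iff[OF dvd_triv_left])
      then have "(- 1 :: 'a) ^ (n + i - (n + j - ?c j)) = (- 1) ^ (i + j + ?c j)"
        by (simp only: minus_one_power_iff)
      then show ?thesis using c True unfolding s cf_def idx by (simp add: power_add)
    next
      case False
      then show ?thesis using c by (auto simp: s cf_def esym_def)
    qed
  qed
  also have "\<dots> = (\<Prod>i<k. (- 1) ^ i) * (\<Prod>j<k. (- 1) ^ j * (- 1) ^ ?c j) * dual_jt n k lam z"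
    unfolding dual_jt_det by (rule det_mat_scale)
  also have "(\<Prod>i<k. (- 1) ^ i) * (\<Prod>j<k. (- 1) ^ j * (- 1) ^ ?c j) = (- 1 :: 'a) ^ (\<Sum>j<k. ?c j)"
  proof -
    have "(\<Prod>i<k. (- 1 :: 'a) ^ i) * (\<Prod>i<k. (- 1) ^ i) = 1"
      unfolding prod.distrib[symmetric] by (rule prod.neutral) (simp flip: power_mult_distrib)
    then show ?thesis by (simp add: prod.distrib power_sum flip: mult.assoc)
  qed
  finally have Ec: "Ec lam = (- 1) ^ (\<Sum>j<k. ?c j) * dual_jt n k lam z" .
  have sq: "(- 1 :: 'a) ^ m * (- 1) ^ m = 1" for m by (simp flip: power_mult_distrib)
  have "det (mat n n (\<lambda>(i, j). z j ^ expo n lam i)) = 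
     ((- 1) ^ (\<Sum>j<k. ?c j) * (- 1) ^ (\<Sum>j<k. ?c j)) * dual_jt n k lam z * 
     (signof (site_perm n k (replicate n 0)) * det (mat N N (\<lambda>(i, j). Y i j)))"
    unfolding main[OF lam] Ec sign_site_perm[OF lam] by (simp add: mult_ac)
  then show ?thesis unfolding empty sq by (simp add: mult_ac)
qed

section \<open>Factorial Schur functions in terms of Schur functions\<close>

lemma elem_sym_0: "elem_sym 0 m a = 1"
proof -
  have "{B. B \<subseteq> {1..m} \<and> card B = 0} = {{}}" using finite_subset[of _ "{1..m}"] by auto
  then show ?thesis by (simp add: elem_sym_def)
qed

lemma elem_sym_neg: "r < 0 \<Longrightarrow> elem_sym r m a = 0"
  by (simp add: elem_sym_def)

text \<open>
  The coefficients of the expansion of factorial Schur functions in Schur functions, up to sign.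
\<close>
abbreviation transition_det :: "nat \<Rightarrow> nat list \<Rightarrow> nat list \<Rightarrow> (nat \<Rightarrow> 'a::comm_ring_1) \<Rightarrow> 'a" where
  "transition_det n lam mu a \<equiv> det (mat n n (\<lambda>(i, j).
     elem_sym (int (lam ! i) - int (mu ! j) - int i + int j) (n + lam ! i - (i + 1)) a))"

lemma not_subpart_obtain:
  assumes "lam \<in> Parts n k" "mu \<in> Parts n k" "\<not> subpart mu lam"
  obtains l where "l < n" "lam ! l < mu ! l"
  using assms Parts_length by (force simp: subpart_def list_all2_conv_all_nth not_le)

text \<open>
  If \<open>\<mu>\<^sub>l > \<lambda>\<^sub>l\<close>, all entries weakly below and to the left of the diagonal entry \<open>l\<close> have negative degree.
\<close>
lemma transition_det_not_subpart:
  assumes "lam \<in> Parts n k" "mu \<in> Parts n k" "\<not> subpart mu lam"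
  shows "transition_det n lam mu a = 0"
proof -
  obtain l0 where l0: "l0 < n" "lam ! l0 < mu ! l0" using not_subpart_obtain[OF assms] .
  have "det (mat n n (\<lambda>(j, i). elem_sym (int (lam ! i) - int (mu ! j) - int i + int j) (n + lam ! i - (i + 1)) a)) = 0"
  proof (rule det_upper_right_zero_block[OF l0(1)])
    fix j i assume "j \<le> l0" "l0 \<le> i" "i < n"
    then have "lam ! i \<le> lam ! l0" "mu ! l0 \<le> mu ! j"
      using Parts_nth_mono[OF assms(1), of l0 i] Parts_nth_mono[OF assms(2), of j l0] l0 by auto
    then show "elem_sym (int (lam ! i) - int (mu ! j) - int i + int j) (n + lam ! i - (i + 1)) a = 0"
      using l0 \<open>j \<le> l0\<close> \<open>l0 \<le> i\<close> by (intro elem_sym_neg) linarith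
  qed
  then show ?thesis by (subst det_mat_transpose[symmetric])
qed

lemma sum_expo: 
  assumes "lam \<in> Parts n k" shows "(\<Sum>i<n. expo n lam i) = sum_list lam + (\<Sum>i<n. n - (i + 1))"
proof -
  have "(\<Sum>i<n. expo n lam i) = (\<Sum>i<n. lam ! i + (n - (i + 1)))"
    by (intro sum.cong) (auto simp: expo_def)
  also have "\<dots> = sum_list lam + (\<Sum>i<n. n - (i + 1))"
    unfolding sum.distrib using Parts_length[OF assms] by (simp add: sum_list_sum_nth atLeast0LessThan)
  finally show ?thesis .
qed

lemma sum_list_subpart: "subpart mu lam \<Longrightarrow> sum_list mu \<le> sum_list lam"
  unfolding subpart_def by (induction rule: list_all2_induct) auto

lemma alternant_expand:
  fixes z a :: "nat \<Rightarrow> 'a::comm_ring_1"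
  assumes lam: "lam \<in> Parts n k"
  shows "alternant n lam z a = (\<Sum>mu | mu \<in> Parts n k \<and> subpart mu lam.
     (- 1) ^ (sum_list lam - sum_list mu) * transition_det n lam mu a * 
     det (mat n n (\<lambda>(i, j). z j ^ expo n mu i)))"
proof -
  let ?A = "\<lambda>i s. (- 1) ^ expo n lam i * (- 1) ^ s * elem_sym (int (expo n lam i) - int s) (expo n lam i) a"
  have "alternant n lam z a = det (mat n n (\<lambda>(i, j). \<Sum>s<n + k. ?A i s * z j ^ s))"
    unfolding alternant_def by (rule det_mat_cong) (rule elem_sym_expand, rule expo_less[OF lam])
  also have "\<dots> = (\<Sum>mu\<in>Parts n k. det (mat n n (\<lambda>(i, l). ?A i (expo n mu l))) * det (mat n n (\<lambda>(l, j). z j ^ expo n mu l)))"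
    by (rule cauchy_binet)
  also have "\<dots> = (\<Sum>mu\<in>Parts n k. (- 1) ^ (sum_list lam + sum_list mu) * transition_det n lam mu a * 
     det (mat n n (\<lambda>(l, j). z j ^ expo n mu l)))"
  proof (rule sum.cong[OF refl])
    fix mu assume mu: "mu \<in> Parts n k"
    have "det (mat n n (\<lambda>(i, l). ?A i (expo n mu l))) = (\<Prod>i<n. (- 1) ^ expo n lam i) * (\<Prod>i<n. (- 1) ^ expo n mu i) * 
       det (mat n n (\<lambda>(i, l). elem_sym (int (expo n lam i) - int (expo n mu l)) (expo n lam i) a))"
      by (rule det_mat_scale)
    also have "(\<Prod>i<n. (- 1 :: 'a) ^ expo n lam i) * (\<Prod>i<n. (- 1) ^ expo n mu i) = (- 1) ^ (sum_list lam + sum_list mu)"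
    proof -
      have "(\<Prod>i<n. (- 1 :: 'a) ^ expo n lam i) * (\<Prod>i<n. (- 1) ^ expo n mu i) = 
         (- 1) ^ ((\<Sum>i<n. expo n lam i) + (\<Sum>i<n. expo n mu i))"
        by (simp add: power_sum power_add)
      also have "\<dots> = (- 1) ^ (sum_list lam + sum_list mu)"
      proof -
        have "(\<Sum>i<n. expo n lam i) + (\<Sum>i<n. expo n mu i) = sum_list lam + sum_list mu + 2 * (\<Sum>i<n. n - (i + 1))"
          unfolding sum_expo[OF lam] sum_expo[OF mu] by simp
        then show ?thesis by (simp only: power_add power_mult) simp
      qed
      finally show ?thesis .
    qed
    also have "det (mat n n (\<lambda>(i, l). elem_sym (int (expo n lam i) - int (expo n mu l)) (expo n lam i) a)) = transition_det n lam mu a"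
      by (rule det_mat_cong) (simp add: expo_def of_nat_diff algebra_simps)
    finally show "det (mat n n (\<lambda>(i, l). ?A i (expo n mu l))) * det (mat n n (\<lambda>(l, j). z j ^ expo n mu l)) =
      (- 1) ^ (sum_list lam + sum_list mu) * transition_det n lam mu a * det (mat n n (\<lambda>(l, j). z j ^ expo n mu l))" by simp
  qed
  also have "\<dots> = (\<Sum>mu | mu \<in> Parts n k \<and> subpart mu lam. (- 1) ^ (sum_list lam + sum_list mu) * transition_det n lam mu a * 
     det (mat n n (\<lambda>(l, j). z j ^ expo n mu l)))"
  proof (rule sum.mono_neutral_right)
    show "\<forall>mu\<in>Parts n k - {mu. mu \<in> Parts n k \<and> subpart mu lam}. (- 1) ^ (sum_list lam + sum_list mu) * transition_det n lam mu a * 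
       det (mat n n (\<lambda>(l, j). z j ^ expo n mu l)) = 0"
    proof
      fix mu assume "mu \<in> Parts n k - {mu. mu \<in> Parts n k \<and> subpart mu lam}"
      then have "transition_det n lam mu a = 0" by (intro transition_det_not_subpart[OF lam]) auto
      then show "(- 1) ^ (sum_list lam + sum_list mu) * transition_det n lam mu a * det (mat n n (\<lambda>(l, j). z j ^ expo n mu l)) = 0"
        by (simp only: mult_zero_left mult_zero_right)
    qed
  qed (auto simp: finite_Parts)
  also have "\<dots> = (\<Sum>mu | mu \<in> Parts n k \<and> subpart mu lam. (- 1) ^ (sum_list lam - sum_list mu) * transition_det n lam mu a * 
     det (mat n n (\<lambda>(l, j). z j ^ expo n mu l)))"
  proof (rule sum.cong[OF refl])
    fix mu assume "mu \<in> {mu. mu \<in> Parts n k \<and> subpart mu lam}"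
    then have "sum_list mu \<le> sum_list lam" using sum_list_subpart by auto
    then have "(- 1 :: 'a) ^ (sum_list lam + sum_list mu) = (- 1) ^ (sum_list lam - sum_list mu)"
      by (simp add: minus_one_power_iff)
    then show "(- 1) ^ (sum_list lam + sum_list mu) * transition_det n lam mu a * det (mat n n (\<lambda>(l, j). z j ^ expo n mu l)) =
       (- 1) ^ (sum_list lam - sum_list mu) * transition_det n lam mu a * det (mat n n (\<lambda>(l, j). z j ^ expo n mu l))" by simp
  qed
  finally show ?thesis .
qed

abbreviation empty_part :: "nat \<Rightarrow> nat list" where "empty_part n \<equiv> replicate n 0"

text \<open>
  Only the empty partition is contained in the empty partition, so the expansion has a single term. In
  particular the denominator of a factorial Schur function does not depend on the parameters.
\<close>
lemma alternant_empty:
  fixes z a :: "nat \<Rightarrow> 'a::comm_ring_1"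
  shows "alternant n (empty_part n) z a = det (mat n n (\<lambda>(i, j). z j ^ expo n (empty_part n) i))"
proof -
  have "{mu. mu \<in> Parts n 0 \<and> subpart mu (empty_part n)} = {empty_part n}"
    by (auto simp: Parts_def subpart_def list_all2_conv_all_nth sorted_wrt_iff_nth_less intro!: nth_equalityI)
  moreover have "transition_det n (empty_part n) (empty_part n) a = 1"
    by (subst det_mat_upper_triangular) (auto simp: elem_sym_neg elem_sym_0)
  ultimately show ?thesis
    using alternant_expand[of "empty_part n" n 0 z a] replicate_Parts[of 0 0 n] by simp
qed

text \<open>
  The factor on the right is the eigenvalue of \<open>S\<^sup>~\<^sub>\<lambda>\<close>; it is the factorial Schur function by the
  expansion of the alternant and the dual Jacobi-Trudi formula for each term.
\<close>
theorem factorial_schur_dual_jt: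
  fixes z a :: "nat \<Rightarrow> 'a::idom"
  assumes lam: "lam \<in> Parts n k"
  shows "alternant n lam z a = alternant n (empty_part n) z a * (\<Sum>mu | mu \<in> Parts n k \<and> subpart mu lam.
     (- 1) ^ (sum_list lam - sum_list mu) * transition_det n lam mu a * dual_jt n k mu z)"
proof -
  have "alternant n lam z a = (\<Sum>mu | mu \<in> Parts n k \<and> subpart mu lam.
     (- 1) ^ (sum_list lam - sum_list mu) * transition_det n lam mu a * 
     (alternant n (empty_part n) z a * dual_jt n k mu z))"
    unfolding alternant_expand[OF lam, of z a] alternant_empty
    by (intro sum.cong refl) (simp add: dual_jacobi_trudi)
  then show ?thesis by (simp only: sum_distrib_left mult_ac)
qed

section \<open>The Cauchy kernel\<close>

lemma fact_power_Suc: "fact_power x a (Suc r) = fact_power x a r * (x - a (Suc r))"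
  by (simp add: fact_power_def)

lemma divided_difference_aux:
  fixes x z :: "'a::comm_ring_1"
  shows "(x - z) * (\<Sum>m<N. (\<Prod>i = m + 2..N. x - a i) * fact_power z a m) = fact_power x a N - fact_power z a N"
proof (induction N)
  case (Suc N)
  define G where "G = (\<Sum>m<N. (\<Prod>i = m + 2..N. x - a i) * fact_power z a m)"
  have "(\<Sum>m<N. (\<Prod>i = m + 2..Suc N. x - a i) * fact_power z a m) = (x - a (Suc N)) * G"
    unfolding sum_distrib_left G_def by (intro sum.cong refl) (simp add: mult_ac)
  then have "(\<Sum>m<Suc N. (\<Prod>i = m + 2..Suc N. x - a i) * fact_power z a m) = (x - a (Suc N)) * G + fact_power z a N"
    by simp
  then have "(x - z) * (\<Sum>m<Suc N. (\<Prod>i = m + 2..Suc N. x - a i) * fact_power z a m) = 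
    (x - a (Suc N)) * ((x - z) * G) + (x - z) * fact_power z a N"
    by (simp only:) (simp add: algebra_simps)
  also have "\<dots> = fact_power x a (Suc N) - fact_power z a (Suc N)"
    unfolding G_def Suc.IH by (simp add: fact_power_Suc algebra_simps)
  finally show ?case .
qed (simp add: fact_power_def)

text \<open>
  The expansion is in factorial powers of \<open>x\<close> for the parameters in reversed order. For the parameters
  \<open>t\<close> the reversed sequence is \<open>T\<close>, which is why \<open>s\<^sub>\<nu>(x|T)\<close> appears next to \<open>s\<^bsub>\<nu>\<^sup>\<or>\<^esub>(z|t)\<close>.
\<close>
lemma divided_difference:
  fixes x z :: "'a::comm_ring_1"
  assumes b: "\<And>i. 1 \<le> i \<Longrightarrow> i \<le> N \<Longrightarrow> b i = a (N + 1 - i)"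
  shows "(x - z) * (\<Sum>m<N. fact_power x b (N - 1 - m) * fact_power z a m) = fact_power x a N - fact_power z a N"
proof -
  have "fact_power x b (N - 1 - m) = (\<Prod>i = m + 2..N. x - a i)" if "m < N" for m
    unfolding fact_power_def
    by (rule prod.reindex_bij_witness[where i = "\<lambda>i. N + 1 - i" and j = "\<lambda>i. N + 1 - i"]) (use that in \<open>auto simp: b\<close>)
  then have "(\<Sum>m<N. fact_power x b (N - 1 - m) * fact_power z a m) = (\<Sum>m<N. (\<Prod>i = m + 2..N. x - a i) * fact_power z a m)"
    by (intro sum.cong) auto
  then show ?thesis by (simp only: divided_difference_aux)
qed

text \<open>
  The sign of the reversal of \<open>n\<close> rows, which cancels in \<open>cauchy_identity\<close>.
\<close>
definition rsign :: "nat \<Rightarrow> 'a::comm_ring_1" where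
  "rsign n = signof (\<lambda>i. if i < n then n - 1 - i else i)"

lemma reversal_permutes: "(\<lambda>i. if i < n then n - 1 - i else i) permutes {0..<n :: nat}"
  by (rule bij_imp_permutes, rule bij_betw_byWitness[where f' = "\<lambda>i. n - 1 - i"]) auto

lemma rsign_square: "rsign n * rsign n = 1"
  by (simp add: rsign_def flip: of_int_mult)

lemma det_mat_reverse_rows: 
  "det (mat n n (\<lambda>(i, j). f (n - 1 - i) j)) = rsign n * det (mat n n (\<lambda>(i, j). f i j))"
  for f :: "nat \<Rightarrow> nat \<Rightarrow> 'a::comm_ring_1"
proof -
  have "det (mat n n (\<lambda>(i, j). f (n - 1 - i) j)) = det (mat n n (\<lambda>(i, j). f (if i < n then n - 1 - i else i) j))"
    by (rule det_mat_cong) simp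
  also have "\<dots> = rsign n * det (mat n n (\<lambda>(i, j). f i j))"
    unfolding rsign_def by (rule det_mat_permute_rows[OF reversal_permutes])
  finally show ?thesis .
qed

lemma dual_part_nth: "lam \<in> Parts n k \<Longrightarrow> i < n \<Longrightarrow> dual_part k lam ! i = k - lam ! (n - 1 - i)"
  using Parts_length[of lam n k] by (simp add: dual_part_def rev_nth)

lemma dual_part_Parts:
  assumes "lam \<in> Parts n k" shows "dual_part k lam \<in> Parts n k"
proof -
  have len: "length (dual_part k lam) = n" using Parts_length[OF assms] by (simp add: dual_part_def)
  have "dual_part k lam ! j \<le> dual_part k lam ! i" if "i < j" "j < n" for i j
  proof -
    have "lam ! (n - 1 - i) \<le> lam ! (n - 1 - j)" using that by (intro Parts_nth_mono[OF assms]) auto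
    then show ?thesis using that by (simp add: dual_part_nth[OF assms])
  qed
  then show ?thesis using len by (auto simp: Parts_def sorted_wrt_iff_nth_less dual_part_def)
qed

lemma dual_part_dual: 
  assumes "lam \<in> Parts n k" shows "dual_part k (dual_part k lam) = lam"
proof -
  have "map (\<lambda>p. k - (k - p)) lam = lam" using assms by (auto simp: Parts_def intro: map_idI)
  then show ?thesis by (simp add: dual_part_def rev_map comp_def)
qed

lemma expo_dual:
  assumes "lam \<in> Parts n k" "l < n"
  shows "expo n (dual_part k lam) (n - 1 - l) = n + k - 1 - expo n lam l"
proof -
  have "dual_part k lam ! (n - 1 - l) = k - lam ! l"
    using dual_part_nth[OF assms(1), of "n - 1 - l"] assms(2) by simp
  then show ?thesis using Parts_nth_le[OF assms] assms(2) by (simp add: expo_def)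
qed

text \<open>
  By Cauchy-Binet, with the exponents \<open>m\<close> and \<open>n + k - 1 - m\<close> paired. The complementary exponents of
  \<open>\<lambda>\<close> are the exponents of the dual partition in reversed order.
\<close>
theorem cauchy_kernel:
  fixes x z a b :: "nat \<Rightarrow> 'a::comm_ring_1"
  shows "det (mat n n (\<lambda>(i, j). \<Sum>m<n + k. fact_power (x i) b (n + k - 1 - m) * fact_power (z j) a m)) =
    rsign n * (\<Sum>lam\<in>Parts n k. alternant n (dual_part k lam) x b * alternant n lam z a)"
proof -
  have "det (mat n n (\<lambda>(i, j). \<Sum>m<n + k. fact_power (x i) b (n + k - 1 - m) * fact_power (z j) a m)) =
    (\<Sum>lam\<in>Parts n k. det (mat n n (\<lambda>(i, l). fact_power (x i) b (n + k - 1 - expo n lam l))) * 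
      det (mat n n (\<lambda>(l, j). fact_power (z j) a (expo n lam l))))"
    by (rule cauchy_binet)
  also have "\<dots> = (\<Sum>lam\<in>Parts n k. rsign n * alternant n (dual_part k lam) x b * alternant n lam z a)"
  proof (rule sum.cong[OF refl])
    fix lam assume lam: "lam \<in> Parts n k"
    have "det (mat n n (\<lambda>(i, l). fact_power (x i) b (n + k - 1 - expo n lam l))) = 
        det (mat n n (\<lambda>(l, i). fact_power (x i) b (n + k - 1 - expo n lam l)))"
      by (rule det_mat_transpose)
    also have "\<dots> = det (mat n n (\<lambda>(l, i). fact_power (x i) b (expo n (dual_part k lam) (n - 1 - l))))"
      by (rule det_mat_cong) (simp only: expo_dual[OF lam])
    also have "\<dots> = rsign n * alternant n (dual_part k lam) x b"
      unfolding alternant_def by (rule det_mat_reverse_rows)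
    finally show "det (mat n n (\<lambda>(i, l). fact_power (x i) b (n + k - 1 - expo n lam l))) * 
      det (mat n n (\<lambda>(l, j). fact_power (z j) a (expo n lam l))) = rsign n * alternant n (dual_part k lam) x b * alternant n lam z a"
      by (simp add: alternant_def)
  qed
  finally show ?thesis by (simp only: sum_distrib_left mult.assoc)
qed

text \<open>
  With the \<open>z\<^sub>j\<close> themselves as parameters the matrix becomes triangular after reversal of its rows, with
  products of differences \<open>z\<^sub>i - z\<^sub>l\<close> on the diagonal.
\<close>
lemma alternant_empty_nonzero:
  fixes z a :: "nat \<Rightarrow> 'a::idom"
  assumes "inj_on z {..<n}" shows "alternant n (empty_part n) z a \<noteq> 0"
proof -
  \<comment> \<open>The choice of parameters that makes the matrix triangular.\<close>
  let ?b = "\<lambda>i. z (i - 1)"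
  let ?f = "\<lambda>i j. fact_power (z j) ?b i"
  have "alternant n (empty_part n) z a = alternant n (empty_part n) z ?b"
    by (simp only: alternant_empty)
  also have "\<dots> = det (mat n n (\<lambda>(i, j). ?f (n - 1 - i) j))"
    unfolding alternant_def by (rule det_mat_cong) (simp add: expo_def)
  also have "\<dots> = rsign n * det (mat n n (\<lambda>(i, j). ?f i j))"
    by (rule det_mat_reverse_rows)
  also have "det (mat n n (\<lambda>(i, j). ?f i j)) = (\<Prod>i<n. ?f i i)"
    by (rule det_mat_upper_triangular) (auto simp: fact_power_def intro!: bexI[of _ "Suc _"])
  finally have eq: "alternant n (empty_part n) z a = rsign n * (\<Prod>i<n. ?f i i)" .
  have "?f i i \<noteq> 0" if "i < n" for i
  proof
    assume "?f i i = 0"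
    then obtain l where l: "l \<in> {1..i}" "z i = z (l - 1)" by (auto simp: fact_power_def)
    then have "i = l - 1" using that by (intro inj_onD[OF assms]) auto
    then show False using l by auto
  qed
  moreover have "rsign n \<noteq> (0 :: 'a)" using rsign_square[where 'a = 'a, of n] by auto
  ultimately show ?thesis unfolding eq by auto
qed

text \<open>
  Where \<open>P(z\<^sub>j) = 0\<close>, the divided difference of \<open>P\<close> at \<open>x\<^sub>i\<close> and \<open>z\<^sub>j\<close> is \<open>P(x\<^sub>i) / (x\<^sub>i - z\<^sub>j)\<close>, so its
  determinant is \<open>\<Prod>\<^sub>i P(x\<^sub>i)\<close> times the Cauchy determinant \<open>det (1 / (x\<^sub>i - z\<^sub>j))\<close>. The same computation
  with \<open>k = 0\<close> and \<open>P(y) = \<Prod>\<^sub>j (y - z\<^sub>j)\<close> evaluates the Cauchy determinant itself, with the same sign.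
\<close>
theorem cauchy_identity:
  fixes x z a b :: "nat \<Rightarrow> 'a::field" and c :: 'a
  assumes b: "\<And>i. 1 \<le> i \<Longrightarrow> i \<le> n + k \<Longrightarrow> b i = a (n + k + 1 - i)"
    and root: "\<And>j. j < n \<Longrightarrow> fact_power (z j) a (n + k) + c = 0"
    and ne: "\<And>i j. i < n \<Longrightarrow> j < n \<Longrightarrow> x i \<noteq> z j"
  shows "(\<Prod>i<n. fact_power (x i) a (n + k) + c) * alternant n (empty_part n) x b * alternant n (empty_part n) z a =
    (\<Prod>i<n. \<Prod>j<n. x i - z j) * (\<Sum>lam\<in>Parts n k. alternant n (dual_part k lam) x b * alternant n lam z a)"
proof -
  let ?R = "det (mat n n (\<lambda>(i, j). 1 / (x i - z j)))"
  \<comment> \<open>Stated for arbitrary \<open>k\<close> and parameters, as it is used twice.\<close>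
  have K: "rsign n * (\<Sum>lam\<in>Parts n k'. alternant n (dual_part k' lam) x b' * alternant n lam z a') = 
      (\<Prod>i<n. fact_power (x i) a' (n + k') + c') * ?R" 
    if b': "\<And>i. 1 \<le> i \<Longrightarrow> i \<le> n + k' \<Longrightarrow> b' i = a' (n + k' + 1 - i)"
      and root': "\<And>j. j < n \<Longrightarrow> fact_power (z j) a' (n + k') + c' = 0" for a' b' :: "nat \<Rightarrow> 'a" and c' k'
  proof -
    have "rsign n * (\<Sum>lam\<in>Parts n k'. alternant n (dual_part k' lam) x b' * alternant n lam z a') = 
      det (mat n n (\<lambda>(i, j). \<Sum>m<n + k'. fact_power (x i) b' (n + k' - 1 - m) * fact_power (z j) a' m))"
      by (rule cauchy_kernel[symmetric])
    also have "\<dots> = det (mat n n (\<lambda>(i, j). (fact_power (x i) a' (n + k') + c') * 1 * (1 / (x i - z j))))"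
    proof (rule det_mat_cong)
      fix i j assume ij: "i < n" "j < n"
      have "(x i - z j) * (\<Sum>m<n + k'. fact_power (x i) b' (n + k' - 1 - m) * fact_power (z j) a' m) = 
        fact_power (x i) a' (n + k') - fact_power (z j) a' (n + k')"
        by (rule divided_difference) (rule b')
      also have "\<dots> = fact_power (x i) a' (n + k') + c'" using root'[OF ij(2)] by (simp add: algebra_simps eq_neg_iff_add_eq_0)
      finally show "(\<Sum>m<n + k'. fact_power (x i) b' (n + k' - 1 - m) * fact_power (z j) a' m) = 
        (fact_power (x i) a' (n + k') + c') * 1 * (1 / (x i - z j))"
        using ne[OF ij] by (simp add: field_simps)
    qed
    also have "\<dots> = (\<Prod>i<n. fact_power (x i) a' (n + k') + c') * (\<Prod>j<n. 1) * ?R"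
      by (rule det_mat_scale)
    finally show ?thesis by simp
  qed
  \<comment> \<open>The case \<open>k = 0\<close>, \<open>P(y) = \<Prod>\<^sub>j (y - z\<^sub>j)\<close>; the only partition in the box is empty.\<close>
  let ?a = "\<lambda>i. z (i - 1)" 
  let ?b = "\<lambda>i. ?a (n + 1 - i)"
  have Parts0: "Parts n 0 = {empty_part n}"
    using replicate_Parts[of 0 0 n] by (auto simp: Parts_def intro!: nth_equalityI)
  have "dual_part 0 (empty_part n) = empty_part n" by (simp add: dual_part_def)
  moreover have "rsign n * (\<Sum>lam\<in>Parts n 0. alternant n (dual_part 0 lam) x ?b * alternant n lam z ?a) = 
      (\<Prod>i<n. fact_power (x i) ?a (n + 0) + 0) * ?R"
  proof (rule K)
    fix j assume "j < n"
    then show "fact_power (z j) ?a (n + 0) + 0 = 0" by (auto simp: fact_power_def intro!: bexI[of _ "Suc j"])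
  qed simp
  moreover have "fact_power (x i) ?a (n + 0) = (\<Prod>j<n. x i - z j)" for i
    unfolding fact_power_def by (rule prod.reindex_bij_witness[where i = Suc and j = "\<lambda>i. i - 1"]) auto
  ultimately have small: "rsign n * (alternant n (empty_part n) x b * alternant n (empty_part n) z a) = (\<Prod>i<n. \<Prod>j<n. x i - z j) * ?R"
    by (simp add: Parts0 alternant_empty)
  have big: "rsign n * (\<Sum>lam\<in>Parts n k. alternant n (dual_part k lam) x b * alternant n lam z a) = 
      (\<Prod>i<n. fact_power (x i) a (n + k) + c) * ?R"
    by (rule K) (use b root in auto)
  have "rsign n * ((\<Prod>i<n. fact_power (x i) a (n + k) + c) * alternant n (empty_part n) x b * alternant n (empty_part n) z a) =
     (\<Prod>i<n. fact_power (x i) a (n + k) + c) * (rsign n * (alternant n (empty_part n) x b * alternant n (empty_part n) z a))"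
    by (simp only: mult_ac)
  also have "\<dots> = (\<Prod>i<n. \<Prod>j<n. x i - z j) * ((\<Prod>i<n. fact_power (x i) a (n + k) + c) * ?R)"
    unfolding small by (simp only: mult_ac)
  also have "\<dots> = rsign n * ((\<Prod>i<n. \<Prod>j<n. x i - z j) * (\<Sum>lam\<in>Parts n k. alternant n (dual_part k lam) x b * alternant n lam z a))"
    unfolding big[symmetric] by (simp only: mult_ac)
  finally have fin: "rsign n * ((\<Prod>i<n. fact_power (x i) a (n + k) + c) * alternant n (empty_part n) x b * alternant n (empty_part n) z a) =
     rsign n * ((\<Prod>i<n. \<Prod>j<n. x i - z j) * (\<Sum>lam\<in>Parts n k. alternant n (dual_part k lam) x b * alternant n lam z a))" .
  have "rsign n \<noteq> (0 :: 'a)" using rsign_square[where 'a = 'a, of n] by auto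
  from mult_left_cancel[OF this, THEN iffD1, OF fin] show ?thesis .
qed

section \<open>Change of coefficients in the transfer matrices\<close>

context comm_ring_hom begin

lemma monodromy_L_hom:
  "hom (blockA (monodromy (L_op a x) m) f S) = blockA (monodromy (L_op (\<lambda>i. hom (a i)) (hom x)) m) (\<lambda>S. hom (f S)) S \<and>
   hom (blockB (monodromy (L_op a x) m) f S) = blockB (monodromy (L_op (\<lambda>i. hom (a i)) (hom x)) m) (\<lambda>S. hom (f S)) S \<and>
   hom (blockC (monodromy (L_op a x) m) f S) = blockC (monodromy (L_op (\<lambda>i. hom (a i)) (hom x)) m) (\<lambda>S. hom (f S)) S \<and>
   hom (blockD (monodromy (L_op a x) m) f S) = blockD (monodromy (L_op (\<lambda>i. hom (a i)) (hom x)) m) (\<lambda>S. hom (f S)) S"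
proof (induction m arbitrary: S)
  case (Suc m)
  show ?case by (auto simp: block_mult_sel L_op_sel hom_distribs Suc.IH)
qed (simp add: block_one_sel)

lemma monodromy_L'_hom:
  "hom (blockA (monodromy (L'_op a x) m) f S) = blockA (monodromy (L'_op (\<lambda>i. hom (a i)) (hom x)) m) (\<lambda>S. hom (f S)) S \<and>
   hom (blockB (monodromy (L'_op a x) m) f S) = blockB (monodromy (L'_op (\<lambda>i. hom (a i)) (hom x)) m) (\<lambda>S. hom (f S)) S \<and>
   hom (blockC (monodromy (L'_op a x) m) f S) = blockC (monodromy (L'_op (\<lambda>i. hom (a i)) (hom x)) m) (\<lambda>S. hom (f S)) S \<and>
   hom (blockD (monodromy (L'_op a x) m) f S) = blockD (monodromy (L'_op (\<lambda>i. hom (a i)) (hom x)) m) (\<lambda>S. hom (f S)) S"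
proof (induction m arbitrary: S)
  case (Suc m)
  show ?case by (auto simp: block_mult_sel L'_op_sel hom_distribs Suc.IH)
qed (simp add: block_one_sel)

lemma H_op_hom: "hom (H_op N a q x f S) = H_op N (\<lambda>i. hom (a i)) (hom q) (hom x) (\<lambda>S. hom (f S)) S"
  by (simp add: H_op_def hom_distribs monodromy_L_hom)

lemma E_op_hom: "hom (E_op N a q x f S) = E_op N (\<lambda>i. hom (a i)) (hom q) (hom x) (\<lambda>S. hom (f S)) S"
  by (simp add: E_op_def hom_distribs monodromy_L'_hom)

lemma elem_sym_hom: "hom (elem_sym r m a) = elem_sym r m (\<lambda>i. hom (a i))"
  by (simp add: elem_sym_def hom_distribs)

lemma det_mat_hom: "hom (det (mat n n (\<lambda>(i, j). f i j))) = det (mat n n (\<lambda>(i, j). hom (f i j)))"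
  unfolding hom_det[symmetric] by (intro arg_cong[of _ _ det] eq_matI) auto

lemma fact_power_hom: "hom (fact_power x a r) = fact_power (hom x) (\<lambda>i. hom (a i)) r"
  by (simp add: fact_power_def hom_distribs)

end

lemma const_poly_hom: "comm_ring_hom (\<lambda>c :: 'a::comm_ring_1. [:c:])"
  by unfold_locales (auto simp: pCons_one)

section \<open>Eigenvalues of the operators\<close>

lemma slater_sum:
  "slater n w m (\<lambda>S. \<Sum>i\<in>I. c i * g i S) ps ss = (\<Sum>i\<in>I. c i * slater n w m (g i) ps ss)"
proof -
  have "slater n w m (\<lambda>S. \<Sum>i\<in>I. c i * g i S) ps ss = 
    (\<Sum>S\<in>Pow {1..m}. \<Sum>i\<in>I. c i * (g i S * wedge n (ps @ map w (dseq S) @ ss)))"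
    by (simp add: slater_def sum_distrib_right mult.assoc)
  also have "\<dots> = (\<Sum>i\<in>I. \<Sum>S\<in>Pow {1..m}. c i * (g i S * wedge n (ps @ map w (dseq S) @ ss)))"
    by (rule sum.swap)
  finally show ?thesis by (simp add: slater_def sum_distrib_left)
qed

text \<open>
  Used to pass from \<open>E(x)\<close>, with \<open>x\<close> a polynomial variable, to its coefficients \<open>E\<^sub>r\<close>.
\<close>
lemma slater_coeff:
  fixes g :: "'a::comm_ring_1 poly vect"
  shows "slater n (power_rows a z) m (\<lambda>S. poly.coeff (g S) r) [] [] = 
         poly.coeff (slater n (power_rows (\<lambda>i. [:a i:]) (\<lambda>j. [:z j:])) m g [] []) r"
proof -
  interpret comm_ring_hom "\<lambda>c :: 'a. [:c:]" by (rule const_poly_hom)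
  have "wedge n (map (power_rows (\<lambda>i. [:a i:]) (\<lambda>j. [:z j:])) l) = [:wedge n (map (power_rows a z) l):]" for l
  proof -
    have "map (power_rows (\<lambda>i. [:a i:]) (\<lambda>j. [:z j:])) l = map (\<lambda>v j. [:v j:]) (map (power_rows a z) l)"
      by (simp add: power_rows_def[abs_def] fact_power_hom)
    then show ?thesis by (simp only: hom_wedge)
  qed
  then show ?thesis by (simp add: slater_def coeff_sum mult.commute)
qed

text \<open>
  The operators have coefficients in \<open>'r\<close>, and the Bethe equations \<open>P(z\<^sub>j) = 0\<close> are solved in an
  extension \<open>'a\<close>.
\<close>
locale bethe = comm_ring_hom hom for hom :: "'r::comm_ring_1 \<Rightarrow> 'a::comm_ring_1" +
  fixes n N :: nat and a :: "nat \<Rightarrow> 'r" and q :: 'r and z :: "nat \<Rightarrow> 'a"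
  assumes root: "\<And>j. j < n \<Longrightarrow> fact_power (z j) (\<lambda>i. hom (a i)) N + (- 1) ^ n * hom q = 0"
begin

definition phi :: "'r vect \<Rightarrow> 'a" where
  "phi f = slater n (power_rows (\<lambda>i. hom (a i)) z) N (\<lambda>S. hom (f S)) [] []"

lemma root': "j < n \<Longrightarrow> (\<Prod>i=1..N. z j - hom (a i)) = - ((- 1) ^ n) * hom q"
  using root[of j] by (simp add: fact_power_def eq_neg_iff_add_eq_0)

lemma phi_sum: "phi (\<lambda>S. \<Sum>i\<in>I. c i * g i S) = (\<Sum>i\<in>I. hom (c i) * phi (g i))"
  unfolding phi_def hom_distribs by (rule slater_sum)

lemma phi_H_op:
  "(\<Prod>j<n. 1 - hom x * z j) * phi (H_op N a q x f) =
   ((\<Prod>i=1..N. 1 - hom x * hom (a i)) + (- 1) ^ n * hom q * hom x ^ N) * phi f"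
  unfolding phi_def H_op_hom by (rule slater_H_op) (rule root')

lemma phi_E_coeff:
  assumes "N \<ge> 1"
  shows "phi (E_coeff N a q r f) = esym n z r * phi f"
proof (cases "r < 0")
  case True
  then show ?thesis by (simp add: phi_def E_coeff_def[abs_def] slater_zero esym_def)
next
  case False
  interpret P: map_poly_comm_ring_hom hom ..
  interpret C: comm_ring_hom "\<lambda>c :: 'a. [:c:]" by (rule const_poly_hom)
  let ?a = "\<lambda>i. [:hom (a i):]"
  let ?z = "\<lambda>j. [:z j:]"
  have E: "hom (E_coeff N a q r f S) = poly.coeff (E_op N ?a [:hom q:] [:0, 1:] (\<lambda>S. [:hom (f S):]) S) (nat r)" for S
  proof -
    have "hom (E_coeff N a q r f S) = 
      poly.coeff (map_poly hom (E_op N (\<lambda>j. [:a j:]) [:q:] [:0, 1:] (\<lambda>S'. [:f S':]) S)) (nat r)"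
      using False by (simp add: E_coeff_def)
    also have "map_poly hom (E_op N (\<lambda>j. [:a j:]) [:q:] [:0, 1:] (\<lambda>S'. [:f S':]) S) =
      E_op N ?a [:hom q:] [:0, 1:] (\<lambda>S. [:hom (f S):]) S"
      by (simp add: P.E_op_hom hom_distribs)
    finally show ?thesis .
  qed
  have "phi (E_coeff N a q r f) = 
    poly.coeff (slater n (power_rows ?a ?z) N (E_op N ?a [:hom q:] [:0, 1:] (\<lambda>S. [:hom (f S):])) [] []) (nat r)"
    unfolding phi_def E by (rule slater_coeff)
  also have "slater n (power_rows ?a ?z) N (E_op N ?a [:hom q:] [:0, 1:] (\<lambda>S. [:hom (f S):])) [] [] =
    (\<Prod>j<n. 1 + [:0, 1:] * ?z j) * slater n (power_rows ?a ?z) N (\<lambda>S. [:hom (f S):]) [] []"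
  proof (rule slater_E_op[OF _ assms])
    fix j assume "j < n"
    have "(\<Prod>i = 1..N. ?z j - ?a i) = [:(\<Prod>i=1..N. z j - hom (a i)):]"
      by (simp add: C.hom_prod)
    then show "(\<Prod>i = 1..N. ?z j - ?a i) = - ((- 1) ^ n) * [:hom q:]"
      using root'[OF \<open>j < n\<close>] by (simp add: C.hom_mult C.hom_uminus C.hom_power pCons_one)
  qed
  also have "(\<Prod>j<n. 1 + [:0, 1:] * ?z j) = (\<Prod>j<n. [:1, z j:])"
  proof (rule prod.cong[OF refl])
    fix j
    have "poly.coeff (1 + [:0, 1:] * ?z j) m = poly.coeff [:1, z j:] m" for m
      by (cases m) (simp_all add: coeff_pCons)
    then show "1 + [:0, 1:] * ?z j = [:1, z j:]" by (rule poly_eqI)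
  qed
  also have "slater n (power_rows ?a ?z) N (\<lambda>S. [:hom (f S):]) [] [] = [:phi f:]"
  proof -
    have "poly.coeff (slater n (power_rows ?a ?z) N (\<lambda>S. [:hom (f S):]) [] []) m = poly.coeff [:phi f:] m" for m
      unfolding slater_coeff[symmetric] phi_def by (cases m) (simp_all add: slater_zero)
    then show ?thesis by (rule poly_eqI)
  qed
  finally show ?thesis using False by (simp add: esym_def mult.commute)
qed

text \<open>
  For \<open>k = 0\<close> no operator \<open>E\<^sub>r\<close> occurs; otherwise the chain is nonempty, as \<open>phi_E_coeff\<close> requires.
\<close>
lemma phi_S_op:
  assumes "N = n + k"
  shows "phi (S_op n k a q lam f) = dual_jt n k lam z * phi f"
proof -
  let ?e = "\<lambda>p i. int (conj_part lam i) - int i + int (p i)"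
  have "phi (foldr (\<lambda>i. E_coeff (n + k) a q (?e p i)) is f) = (\<Prod>i\<leftarrow>is. esym n z (?e p i)) * phi f"
    if "k \<ge> 1" for p "is"
    using phi_E_coeff that assms by (induction "is") (auto simp: mult_ac)
  then have fold: "phi (foldr (\<lambda>i. E_coeff (n + k) a q (?e p i)) [1..<k + 1] f) = (\<Prod>i = 1..k. esym n z (?e p i)) * phi f" for p
    by (cases "k \<ge> 1") (simp_all add: prod.distinct_set_conv_list[symmetric] atLeastLessThanSuc_atLeastAtMost not_less_eq_eq del: upt_Suc)
  show ?thesis
    unfolding S_op_def[abs_def] phi_sum fold dual_jt_def
    by (simp add: sum_distrib_right hom_distribs mult.assoc)
qed

end

lemma phi_S_tilde:
  fixes hom :: "'r::comm_ring_1 \<Rightarrow> 'a::idom"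
  assumes "bethe hom n (n + k) a q z" and lam: "lam \<in> Parts n k"
  shows "alternant n (empty_part n) z (\<lambda>i. hom (a i)) * bethe.phi hom n (n + k) a z (S_tilde n k a q lam f) = 
         alternant n lam z (\<lambda>i. hom (a i)) * bethe.phi hom n (n + k) a z f"
proof -
  interpret bethe hom n "n + k" a q z by fact
  have "phi (S_tilde n k a q lam f) = 
    (\<Sum>mu | mu \<in> Parts n k \<and> subpart mu lam. hom ((- 1) ^ (sum_list lam - sum_list mu) * transition_det n lam mu a) * phi (S_op n k a q mu f))"
    unfolding S_tilde_def[abs_def] by (rule phi_sum)
  also have "\<dots> = (\<Sum>mu | mu \<in> Parts n k \<and> subpart mu lam. 
    (- 1) ^ (sum_list lam - sum_list mu) * transition_det n lam mu (\<lambda>i. hom (a i)) * dual_jt n k mu z) * phi f"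
    by (simp add: phi_S_op hom_distribs det_mat_hom elem_sym_hom sum_distrib_right mult.assoc)
  finally show ?thesis by (simp add: factorial_schur_dual_jt[OF lam] mult.assoc)
qed

text \<open>
  The rows of a state \<open>|\<lambda>\<rangle>\<close> are those of the alternant of \<open>\<lambda>\<close>, in the same order.
\<close>
lemma slater_alternants:
  "slater n (power_rows a z) (n + k) f [] [] = (\<Sum>lam\<in>Parts n k. f (part_state n lam) * alternant n lam z a)"
proof -
  have wedge: "wedge n (map (power_rows a z) (dseq (part_state n lam))) = alternant n lam z a" if "lam \<in> Parts n k" for lam
    unfolding dseq_part_state[OF that] wedge_def alternant_def
    by (auto simp: power_rows_def intro!: arg_cong[of _ _ det] eq_matI)
  have "slater n (power_rows a z) (n + k) f [] [] = 
    (\<Sum>S\<in>{S. S \<subseteq> {1..n + k} \<and> card S = n}. f S * wedge n (map (power_rows a z) (dseq S)))"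
    unfolding slater_def append_Nil append_Nil2
    by (rule sum.mono_neutral_right) (auto simp: wedge_def dseq_def)
  also have "\<dots> = (\<Sum>lam\<in>Parts n k. f (part_state n lam) * wedge n (map (power_rows a z) (dseq (part_state n lam))))"
    by (rule sum.reindex_bij_betw[OF bij_betw_part_state, symmetric])
  finally show ?thesis by (simp add: wedge)
qed

lemma part_state_eq_iff:
  "lam \<in> Parts n k \<Longrightarrow> mu \<in> Parts n k \<Longrightarrow> part_state n lam = part_state n mu \<longleftrightarrow> lam = mu"
  using bij_betw_imp_inj_on[OF bij_betw_part_state, of n k] by (auto dest: inj_onD)

lemma (in bethe) phi_ket:
  assumes "N = n + k" "lam \<in> Parts n k"
  shows "phi (ket n lam) = alternant n lam z (\<lambda>i. hom (a i))"
proof -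
  have "phi (ket n lam) = (\<Sum>mu\<in>Parts n k. if mu = lam then alternant n mu z (\<lambda>i. hom (a i)) else 0)"
    unfolding phi_def unfolding assms(1) slater_alternants
    by (intro sum.cong refl) (auto simp: ket_def part_state_eq_iff[OF _ assms(2)])
  then show ?thesis using assms(2) by (simp add: finite_Parts)
qed

section \<open>Completeness of the eigenfunctionals\<close>

text \<open>
  The minors of the identity matrix.
\<close>
lemma det_kronecker_expo:
  assumes "lam \<in> Parts n k" "mu \<in> Parts n k"
  shows "det (mat n n (\<lambda>(i, j). if expo n lam i = expo n mu j then 1 else 0)) = (if lam = mu then 1 else 0 :: 'a::comm_ring_1)"
proof (cases "lam = mu")
  case True
  have "expo n mu i \<noteq> expo n mu j" if "i < j" "j < n" for i j
    using expo_strict[OF assms(2) that] by simp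
  then show ?thesis using True by (subst det_mat_lower_triangular) auto
next
  case False
  have "expo n lam ` {0..<n} \<noteq> expo n mu ` {0..<n}"
    using False inj_onD[OF bij_betw_imp_inj_on[OF bij_betw_expo] _ assms] by blast
  moreover have "card (expo n lam ` {0..<n}) = card (expo n mu ` {0..<n})"
    using inj_on_expo assms by (simp add: card_image)
  ultimately have "\<not> expo n lam ` {0..<n} \<subseteq> expo n mu ` {0..<n}"
    by (metis card_subset_eq finite_atLeastLessThan finite_imageI)
  then obtain i where "i \<in> {0..<n}" and out: "expo n lam i \<notin> expo n mu ` {0..<n}" by blast
  then have "i < n" by simp
  note i = this out
  have "det (mat n n (\<lambda>(i, j). if expo n lam i = expo n mu j then 1 else 0 :: 'a)) = 0"
    unfolding det_mat
  proof (rule sum.neutral, intro ballI)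
    fix p assume "p \<in> {p. p permutes {0..<n}}"
    then have "p i < n" using permutes_in_image[of p "{0..<n}" i] i by simp
    then have "(\<Prod>i = 0..<n. if expo n lam i = expo n mu (p i) then 1 else 0 :: 'a) = 0"
      using i by (intro prod_zero) (auto intro!: bexI[of _ i])
    then show "signof p * (\<Prod>i = 0..<n. if expo n lam i = expo n mu (p i) then 1 else 0 :: 'a) = 0" by simp
  qed
  then show ?thesis using False by simp
qed

lemma right_inverse_exists:
  fixes W :: "nat \<Rightarrow> nat \<Rightarrow> 'a::field"
  assumes "det (mat N N (\<lambda>(i, j). W i j)) \<noteq> 0"
  obtains U where "\<And>i j. i < N \<Longrightarrow> j < N \<Longrightarrow> (\<Sum>r<N. W i r * U r j) = (if i = j then 1 else 0)"
proof
  let ?W = "mat N N (\<lambda>(i, j). W i j)"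
  fix i j assume ij: "i < N" "j < N"
  have "?W * adj_mat ?W = det ?W \<cdot>\<^sub>m 1\<^sub>m N" using adj_mat[of ?W N] by simp
  then have "(?W * adj_mat ?W) $$ (i, j) = det ?W * (if i = j then 1 else 0)" using ij by simp
  moreover have "(?W * adj_mat ?W) $$ (i, j) = (\<Sum>r<N. W i r * adj_mat ?W $$ (r, j))"
    using ij adj_mat(1)[of ?W N] by (simp add: scalar_prod_def atLeast0LessThan)
  ultimately have "(\<Sum>r<N. W i r * adj_mat ?W $$ (r, j)) = det ?W * (if i = j then 1 else 0)" by simp
  then show "(\<Sum>r<N. W i r * (adj_mat ?W $$ (r, j) / det ?W)) = (if i = j then 1 else 0)"
    using assms by (simp flip: sum_divide_distrib)
qed

text \<open>
  The matrix with entries \<open>w\<^sub>s(y\<^sub>r)\<close>, for all sites \<open>s\<close> and all roots \<open>y\<^sub>r\<close>, is invertible. By Cauchy-Binet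
  the matrix of its minors of size \<open>n\<close> is invertible as well, with the minors of the inverse as inverse.
  These minors are the values of the eigenfunctionals at the basis vectors.
\<close>
theorem slater_complete:
  fixes y a :: "nat \<Rightarrow> 'a::field"
  assumes y: "inj_on y {..<n + k}"
    and zero: "\<And>rho. rho \<in> Parts n k \<Longrightarrow> slater n (power_rows a (\<lambda>j. y (expo n rho j))) (n + k) f [] [] = 0"
    and mu: "mu \<in> Parts n k"
  shows "f (part_state n mu) = 0"
proof -
  let ?W = "\<lambda>s r. fact_power (y r) a s"
  have "det (mat (n + k) (n + k) (\<lambda>(s, r). ?W (n + k - 1 - s) r)) = alternant (n + k) (empty_part (n + k)) y a"
    unfolding alternant_def by (rule det_mat_cong) (simp add: expo_def)
  then have "det (mat (n + k) (n + k) (\<lambda>(s, r). ?W s r)) \<noteq> 0"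
    using alternant_empty_nonzero[OF y, of a] det_mat_reverse_rows[of "n + k" ?W] by auto
  then obtain U where U: "\<And>i j. i < n + k \<Longrightarrow> j < n + k \<Longrightarrow> (\<Sum>r<n + k. ?W i r * U r j) = (if i = j then 1 else 0)"
    by (rule right_inverse_exists) blast
  let ?u = "\<lambda>rho. det (mat n n (\<lambda>(l, j). U (expo n rho l) (expo n mu j)))"
  have inverse: "(\<Sum>rho\<in>Parts n k. alternant n lam (\<lambda>j. y (expo n rho j)) a * ?u rho) = (if lam = mu then 1 else 0)"
    if lam: "lam \<in> Parts n k" for lam
  proof -
    have "(\<Sum>rho\<in>Parts n k. alternant n lam (\<lambda>j. y (expo n rho j)) a * ?u rho) = 
      det (mat n n (\<lambda>(i, j). \<Sum>r<n + k. ?W (expo n lam i) r * U r (expo n mu j)))"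
      unfolding alternant_def by (rule cauchy_binet[symmetric])
    also have "\<dots> = det (mat n n (\<lambda>(i, j). if expo n lam i = expo n mu j then 1 else 0))"
      by (rule det_mat_cong) (simp add: U expo_less[OF lam] expo_less[OF mu])
    finally show ?thesis using det_kronecker_expo[OF lam mu, where 'a = 'a] by simp
  qed
  have "0 = (\<Sum>rho\<in>Parts n k. slater n (power_rows a (\<lambda>j. y (expo n rho j))) (n + k) f [] [] * ?u rho)"
    by (simp add: zero)
  also have "\<dots> = (\<Sum>rho\<in>Parts n k. \<Sum>lam\<in>Parts n k. f (part_state n lam) * (alternant n lam (\<lambda>j. y (expo n rho j)) a * ?u rho))"
    by (simp add: slater_alternants sum_distrib_right mult.assoc)
  also have "\<dots> = (\<Sum>lam\<in>Parts n k. \<Sum>rho\<in>Parts n k. f (part_state n lam) * (alternant n lam (\<lambda>j. y (expo n rho j)) a * ?u rho))"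
    by (rule sum.swap)
  also have "\<dots> = (\<Sum>lam\<in>Parts n k. if lam = mu then f (part_state n lam) else 0)"
    by (intro sum.cong refl) (simp add: inverse flip: sum_distrib_left)
  also have "\<dots> = f (part_state n mu)" using mu by (simp add: finite_Parts)
  finally show ?thesis by simp
qed

section \<open>The expansion of the partition function\<close>

text \<open>
  The difference of both sides is the coordinate at \<open>\<lambda>\<close> of a vector that all eigenfunctionals
  annihilate. The homomorphisms \<open>h1\<close> and \<open>h2\<close> bring the two sides, which live over different rings, into
  the field that contains the roots; multiplication by \<open>a\<^sub>\<emptyset>(x|T)\<close> clears the denominators of the
  factorial Schur functions.
\<close>
theorem partition_function_expansion:
  fixes h1 :: "'r::comm_ring_1 \<Rightarrow> 'a::field" and h2 :: "'s::field \<Rightarrow> 'a" and y b :: "nat \<Rightarrow> 'a"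
  assumes h1: "comm_ring_hom h1" and h2: "comm_ring_hom h2"
    and a: "\<And>i. h1 (a1 i) = a i" "\<And>i. h2 (a2 i) = a i" and q: "h1 q1 = c" "h2 q2 = c"
    and y: "inj_on y {..<n + k}" "\<And>r. r < n + k \<Longrightarrow> fact_power (y r) a (n + k) + (- 1) ^ n * c = 0"
    and b: "\<And>i. 1 \<le> i \<Longrightarrow> i \<le> n + k \<Longrightarrow> b i = a (n + k + 1 - i)"
    and v: "\<And>i. i < n \<Longrightarrow> h2 (x (Suc i)) = v i" "\<And>i. i < n \<Longrightarrow> v i \<noteq> 0" 
      "\<And>i r. i < n \<Longrightarrow> r < n + k \<Longrightarrow> v i \<noteq> y r"
    and lam: "lam \<in> Parts n k" and mu: "mu \<in> Parts n k"
  shows "alternant n (empty_part n) v b * ((\<Prod>i<n. v i) ^ k * 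
       h2 (matrix_element n lam (foldr (\<lambda>i. H_op (n + k) a2 q2 (inverse (x i))) (rev [1..<n + 1])) mu)) =
     (\<Sum>nu\<in>Parts n k. alternant n nu v b * h1 (matrix_element n lam (S_tilde n k a1 q1 mu) (dual_part k nu)))"
proof -
  interpret h1: comm_ring_hom h1 by fact
  interpret h2: comm_ring_hom h2 by fact
  let ?N = "n + k"
  let ?al = "alternant n (empty_part n) v b"
  let ?Z = "foldr (\<lambda>i. H_op (n + k) a2 q2 (inverse (x i))) (rev [1..<n + 1]) (ket n mu)"
  let ?T = "\<lambda>nu. S_tilde n k a1 q1 mu (ket n (dual_part k nu))"
  \<comment> \<open>The vector to be annihilated by all eigenfunctionals.\<close>
  define g where "g S = ?al * (\<Prod>i<n. v i) ^ k * h2 (?Z S) - (\<Sum>nu\<in>Parts n k. alternant n nu v b * h1 (?T nu S))" for S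
  have "slater n (power_rows a (\<lambda>j. y (expo n rho j))) ?N g [] [] = 0" if rho: "rho \<in> Parts n k" for rho
  proof -
    define z where "z = (\<lambda>j. y (expo n rho j))"
    have z_root: "fact_power (z j) a ?N + (- 1) ^ n * c = 0" if "j < n" for j
      using y(2) expo_less[OF rho that] by (simp add: z_def)
    interpret B1: bethe h1 n ?N a1 q1 z by unfold_locales (use z_root a q in simp)
    interpret B2: bethe h2 n ?N a2 q2 z by unfold_locales (use z_root a q in simp)
    have z_inj: "inj_on z {..<n}"
      using inj_on_expo[OF rho] y(1) expo_less[OF rho] by (auto simp: z_def inj_on_def)
    have az: "alternant n (empty_part n) z a \<noteq> 0" by (rule alternant_empty_nonzero[OF z_inj])
    have ne: "v i \<noteq> z j" if "i < n" "j < n" for i j using v(3) expo_less[OF rho that(2)] that by (simp add: z_def)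
    \<comment> \<open>The common denominator, up to powers of the \<open>x\<^sub>i\<close>, of the eigenvalues of the operators \<open>H(1/x\<^sub>i)\<close>.\<close>
    define D where "D = (\<Prod>i<n. \<Prod>j<n. v i - z j)"
    have D: "D \<noteq> 0" using ne by (auto simp: D_def)
    let ?P = "\<lambda>i. fact_power (v i) a ?N + (- 1) ^ n * c"
    have H: "(\<Prod>j<n. v i - z j) * (v i ^ k * B2.phi (H_op ?N a2 q2 (inverse (x (Suc i))) f)) = ?P i * B2.phi f"
      if i: "i < n" for i f
    proof -
      have x: "h2 (inverse (x (Suc i))) = inverse (v i)" 
      proof -
        have "x (Suc i) \<noteq> 0" using v(1,2)[OF i] by auto
        then have "h2 (x (Suc i)) * h2 (inverse (x (Suc i))) = 1" by (simp flip: h2.hom_mult)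
        then show ?thesis using v(1)[OF i] by (metis inverse_unique)
      qed
      have "(\<Prod>j<n. v i - z j) = v i ^ n * (\<Prod>j<n. 1 - inverse (v i) * z j)"
      proof -
        have "(\<Prod>j<n. v i - z j) = (\<Prod>j<n. v i * (1 - inverse (v i) * z j))"
          using v(2)[OF i] by (intro prod.cong refl) (simp add: algebra_simps)
        then show ?thesis by (simp add: prod.distrib)
      qed
      moreover have "?P i = v i ^ ?N * ((\<Prod>l=1..?N. 1 - inverse (v i) * a l) + (- 1) ^ n * c * inverse (v i) ^ ?N)"
      proof -
        have "fact_power (v i) a ?N = (\<Prod>l=1..?N. v i * (1 - inverse (v i) * a l))"
          unfolding fact_power_def using v(2)[OF i] by (intro prod.cong refl) (simp add: algebra_simps)
        then have "fact_power (v i) a ?N = v i ^ ?N * (\<Prod>l=1..?N. 1 - inverse (v i) * a l)"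
          by (simp add: prod.distrib)
        moreover have "v i ^ ?N * ((- 1) ^ n * c * inverse (v i) ^ ?N) = (- 1) ^ n * c"
          using v(2)[OF i] by (simp add: power_inverse)
        ultimately show ?thesis by (simp only: distrib_left)
      qed
      ultimately show ?thesis
        using B2.phi_H_op[of "inverse (x (Suc i))" f] unfolding x a q
        by (simp add: power_add mult_ac)
    qed
    have fold: "(\<Prod>i\<leftarrow>is. \<Prod>j<n. v i - z j) * ((\<Prod>i\<leftarrow>is. v i) ^ k * B2.phi (foldr (\<lambda>i. H_op ?N a2 q2 (inverse (x i))) (map Suc is) f)) =
       (\<Prod>i\<leftarrow>is. ?P i) * B2.phi f" if "set is \<subseteq> {..<n}" for "is" f
      using that
    proof (induction "is")
      case (Cons i "is")
      let ?F = "foldr (\<lambda>i. H_op ?N a2 q2 (inverse (x i))) (map Suc is) f"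
      have "(\<Prod>i\<leftarrow>i # is. \<Prod>j<n. v i - z j) * ((\<Prod>i\<leftarrow>i # is. v i) ^ k * B2.phi (H_op ?N a2 q2 (inverse (x (Suc i))) ?F)) =
        (\<Prod>i\<leftarrow>is. \<Prod>j<n. v i - z j) * (\<Prod>i\<leftarrow>is. v i) ^ k * ((\<Prod>j<n. v i - z j) * (v i ^ k * B2.phi (H_op ?N a2 q2 (inverse (x (Suc i))) ?F)))"
        by (simp add: power_mult_distrib mult_ac)
      also have "\<dots> = ?P i * ((\<Prod>i\<leftarrow>is. \<Prod>j<n. v i - z j) * ((\<Prod>i\<leftarrow>is. v i) ^ k * B2.phi ?F))"
        using Cons.prems by (subst H) (simp_all add: mult_ac)
      also have "\<dots> = ?P i * ((\<Prod>i\<leftarrow>is. ?P i) * B2.phi f)"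
        using Cons.prems by (subst Cons.IH) simp_all
      finally show ?case by (simp add: mult.assoc)
    qed simp
    have list: "(\<Prod>i\<leftarrow>rev [0..<n]. F i) = (\<Prod>i<n. F i)" for F :: "nat \<Rightarrow> 'a"
      using prod.distinct_set_conv_list[of "rev [0..<n]" F] by (simp add: atLeast0LessThan)
    have Suc_list: "map Suc (rev [0..<n]) = rev [1..<n + 1]" by (simp add: map_Suc_upt rev_map[symmetric] del: upt_Suc)
    have phiZ: "D * ((\<Prod>i<n. v i) ^ k * B2.phi ?Z) = (\<Prod>i<n. ?P i) * alternant n mu z a"
      using fold[of "rev [0..<n]" "ket n mu"] B2.phi_ket[OF refl mu] unfolding list Suc_list D_def a 
      by (simp add: atLeast0LessThan del: upt_Suc)
    have cauchy: "(\<Prod>i<n. ?P i) * ?al * alternant n (empty_part n) z a = 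
      D * (\<Sum>nu\<in>Parts n k. alternant n nu v b * alternant n (dual_part k nu) z a)"
    proof -
      have "(\<Sum>nu\<in>Parts n k. alternant n nu v b * alternant n (dual_part k nu) z a) = 
        (\<Sum>lam\<in>Parts n k. alternant n (dual_part k lam) v b * alternant n lam z a)"
        by (rule sum.reindex_bij_witness[where i = "dual_part k" and j = "dual_part k"])
          (auto simp: dual_part_dual dual_part_Parts)
      then show ?thesis unfolding D_def using cauchy_identity[OF b z_root ne] by simp
    qed
    have phiT: "alternant n (empty_part n) z a * B1.phi (?T nu) = alternant n mu z a * alternant n (dual_part k nu) z a"
      if "nu \<in> Parts n k" for nu
      using phi_S_tilde[OF B1.bethe_axioms mu, of "ket n (dual_part k nu)"] B1.phi_ket[OF refl dual_part_Parts[OF that]]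
      by (simp add: a)
    let ?s = "\<lambda>f. slater n (power_rows a z) ?N f [] []"
    have "?s g = ?al * (\<Prod>i<n. v i) ^ k * B2.phi ?Z - (\<Sum>nu\<in>Parts n k. alternant n nu v b * B1.phi (?T nu))"
      using slater_linear[of n "power_rows a z" ?N "?al * (\<Prod>i<n. v i) ^ k" "\<lambda>S. h2 (?Z S)" "- 1" 
          "\<lambda>S. \<Sum>nu\<in>Parts n k. alternant n nu v b * h1 (?T nu S)" "[]" "[]"]
      unfolding slater_sum by (simp add: g_def[abs_def] B1.phi_def B2.phi_def a)
    then have "D * alternant n (empty_part n) z a * ?s g = 
       ?al * alternant n (empty_part n) z a * (D * ((\<Prod>i<n. v i) ^ k * B2.phi ?Z)) -
       D * (\<Sum>nu\<in>Parts n k. alternant n nu v b * (alternant n (empty_part n) z a * B1.phi (?T nu)))"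
      by (simp add: right_diff_distrib sum_distrib_left mult_ac)
    also have "\<dots> = alternant n mu z a * ((\<Prod>i<n. ?P i) * ?al * alternant n (empty_part n) z a) -
       D * (\<Sum>nu\<in>Parts n k. alternant n nu v b * (alternant n mu z a * alternant n (dual_part k nu) z a))"
      unfolding phiZ by (simp add: phiT mult_ac)
    also have "\<dots> = 0" unfolding cauchy by (simp add: sum_distrib_left mult_ac)
    finally show ?thesis using D az by (simp add: z_def)
  qed
  then have "g (part_state n lam) = 0" by (rule slater_complete[OF y(1) _ lam])
  then show ?thesis by (simp add: g_def matrix_element_def mult.assoc)
qed

section \<open>A field in which the Bethe equations split\<close>

text \<open>
  For an algebraically closed field \<open>L\<close>, the roots of \<open>P\<close> are taken in the algebraic closure of \<open>L(q)\<close>.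
\<close>
definition const_emb :: "'l::field \<Rightarrow> 'l poly fract alg_closure" where
  "const_emb c = to_ac (to_fract [:c:])"

definition generic_q :: "'l::field poly fract alg_closure" where
  "generic_q = to_ac (to_fract [:0, 1:])"

lemma const_emb_hom: "inj_comm_ring_hom (const_emb :: 'l::field \<Rightarrow> _)"
proof -
  have add: "[:x + y:] = [:x:] + [:y:]" and mult: "[:x * y:] = [:x:] * [:y:]" for x y :: 'l by simp_all
  show ?thesis
  proof unfold_locales
    fix x y :: 'l
    show "const_emb (x + y) = const_emb x + const_emb y"
      unfolding const_emb_def add by (simp only: to_fract_add to_ac_add)
    show "const_emb (x * y) = const_emb x * const_emb y"
      unfolding const_emb_def mult by (simp only: to_fract_mult to_ac_mult)
  qed (simp_all add: const_emb_def pCons_one)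
qed

lemma generic_q_transcendental: 
  assumes "c \<noteq> 0" shows "const_emb v + const_emb c * generic_q \<noteq> 0"
proof -
  have "const_emb v + const_emb c * generic_q = to_ac (to_fract ([:v:] + [:c:] * [:0, 1:]))"
    by (simp only: const_emb_def generic_q_def to_ac_add to_ac_mult to_fract_add to_fract_mult)
  then show ?thesis using assms by simp
qed

text \<open>
  A multiple root would be a root of the derivative. The derivative does not involve \<open>q\<close>, so all its
  roots lie in the algebraically closed field \<open>L\<close>; but at an element of \<open>L\<close> the polynomial takes a value
  \<open>v + c q\<close> with \<open>v, c \<in> L\<close> and \<open>c \<noteq> 0\<close>, which is nonzero because \<open>q\<close> is transcendental over \<open>L\<close>.
\<close>
theorem distinct_bethe_roots:
  fixes s :: "nat \<Rightarrow> 'l::alg_closed_field" and c :: 'l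
  assumes s: "inj_on s {1..N}" and c: "c \<noteq> 0"
  obtains y :: "nat \<Rightarrow> 'l poly fract alg_closure" where
    "inj_on y {..<N}" "\<And>r. r < N \<Longrightarrow> fact_power (y r) (\<lambda>i. const_emb (s i)) N + const_emb c * generic_q = 0"
proof (cases "N = 0")
  case True
  then show ?thesis by (intro that[of "\<lambda>_. 0"]) auto
next
  case False
  interpret g: inj_comm_ring_hom "const_emb :: 'l \<Rightarrow> _" by (rule const_emb_hom)
  interpret P: map_poly_inj_comm_ring_hom "const_emb :: 'l \<Rightarrow> _" ..
  interpret i: idom_hom "const_emb :: 'l \<Rightarrow> _" ..
  define p0 where "p0 = (\<Prod>i=1..N. [:- s i, 1:])"
  define d where "d = const_emb c * generic_q"
  define p where "p = map_poly const_emb p0 + [:d:]"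
  have p0_poly: "poly p0 v = fact_power v s N" for v by (simp add: p0_def poly_prod fact_power_def)
  have p_poly: "poly p v = fact_power v (\<lambda>i. const_emb (s i)) N + d" for v
    by (simp add: p_def p0_def poly_prod fact_power_def g.hom_uminus P.hom_prod hom_distribs)
  have deg0: "Polynomial.degree p0 = N" by (simp add: p0_def degree_prod_sum_eq)
  have deg: "Polynomial.degree p = N"
    unfolding p_def using False deg0 by (subst degree_add_eq_left) auto
  have "pderiv p0 \<noteq> 0"
  proof
    assume "pderiv p0 = 0"
    define r where "r = (\<Prod>i\<in>{1..N} - {1}. [:- s i, 1:])"
    have "p0 = [:- s 1, 1:] * r" unfolding p0_def r_def using False by (subst prod.remove[of _ 1]) auto
    then have "pderiv p0 = [:- s 1, 1:] * pderiv r + r"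
      by (simp only: pderiv_mult) (simp add: pderiv_pCons)
    then have "poly (pderiv p0) (s 1) = poly r (s 1)" by simp
    then have "poly r (s 1) = 0" using \<open>pderiv p0 = 0\<close> by simp
    then have "\<exists>i\<in>{1..N} - {1}. poly [:- s i, 1:] (s 1) = 0"
      unfolding r_def poly_prod by (simp only: prod_zero_iff finite_Diff finite_atLeastAtMost)
    then obtain i where "i \<in> {1..N} - {1}" "s 1 = s i" by fastforce
    then show False using inj_onD[OF s, of 1 i] False by auto
  qed
  then obtain U where U: "pderiv p0 = smult (Polynomial.lead_coeff (pderiv p0)) (\<Prod>u\<in>#U. [:- u, 1:])"
    using alg_closed_imp_factorization by blast
  have simple: "poly (pderiv p) v \<noteq> 0" if v: "poly p v = 0" for v
  proof
    assume v': "poly (pderiv p) v = 0"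
    have "pderiv p = map_poly const_emb (pderiv p0)"
      by (simp add: p_def pderiv_add pderiv_pCons i.map_poly_pderiv)
    also have "\<dots> = map_poly const_emb (smult (Polynomial.lead_coeff (pderiv p0)) (\<Prod>u\<in>#U. [:- u, 1:]))" by (simp only: U[symmetric])
    also have "\<dots> = smult (const_emb (Polynomial.lead_coeff (pderiv p0))) (\<Prod>u\<in>#U. [:- const_emb u, 1:])"
      by (simp add: hom_distribs g.hom_uminus P.hom_prod_mset image_mset.compositionality comp_def)
    finally have "(\<Prod>u\<in>#U. v - const_emb u) = 0"
      using v' \<open>pderiv p0 \<noteq> 0\<close> by (simp add: poly_prod_mset)
    then obtain u where u: "v = const_emb u" by auto
    have "const_emb (poly p0 u) + d = 0" 
      using v unfolding p_def u by simp
    then show False using generic_q_transcendental[OF c] by (simp add: d_def)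
  qed
  have "p \<noteq> 0" using deg False by auto
  then obtain A where A: "size A = Polynomial.degree p" "p = smult (Polynomial.lead_coeff p) (\<Prod>x\<in>#A. [:- x, 1:])"
    using alg_closed_imp_factorization by blast
  have root: "poly p x = 0" if "x \<in># A" for x
    by (subst A(2)) (use that in \<open>auto simp: poly_prod_mset\<close>)
  have "count A x \<le> 1" for x
  proof (rule ccontr)
    assume "\<not> ?thesis"
    then have "{#x, x#} \<subseteq># A" by (simp add: subseteq_mset_def)
    then obtain B where "A = {#x, x#} + B" by (metis subset_mset.le_iff_add)
    then have "p = [:- x, 1:] * ([:- x, 1:] * Polynomial.smult (Polynomial.lead_coeff p) (\<Prod>x\<in>#B. [:- x, 1:]))"
      using A(2) by (simp add: mult_ac)
    then obtain R where eq: "p = [:- x, 1:] * ([:- x, 1:] * R)" by blast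
    have "poly (pderiv p) x = 0" unfolding eq pderiv_mult poly_add poly_mult by simp
    moreover have "poly p x = 0" unfolding eq poly_mult by simp
    ultimately show False using simple by blast
  qed
  \<comment> \<open>All multiplicities are one.\<close>
  then have "card (set_mset A) = size A"
    by (metis count_greater_eq_one_iff le_antisym mset_set_set_mset_msubset size_mset_set count_mset_set(1) finite_set_mset multiset_eq_iff count_eq_zero_iff count_mset_set(3))
  then have "card (set_mset A) = N" using A(1) deg by simp
  then obtain y where y: "bij_betw y {0..<N} (set_mset A)"
    using ex_bij_betw_nat_finite[of "set_mset A"] by auto
  show ?thesis
  proof
    show "inj_on y {..<N}" using y by (simp add: bij_betw_def atLeast0LessThan)
    fix r assume "r < N"
    then have "poly p (y r) = 0" using y by (intro root) (auto simp: bij_betw_def)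
    then show "fact_power (y r) (\<lambda>i. const_emb (s i)) N + const_emb c * generic_q = 0"
      by (simp add: p_poly d_def)
  qed
qed

text \<open>
  For injective \<open>h\<close>, the extension of \<open>h\<close> to the field of fractions; every representation of \<open>x\<close> as a
  fraction then yields the same value.
\<close>
definition fract_lift :: "('a::idom \<Rightarrow> 'b::field) \<Rightarrow> 'a fract \<Rightarrow> 'b" where
  "fract_lift h x = (SOME v. \<exists>a b. b \<noteq> 0 \<and> x = Fract a b \<and> v = h a / h b)"

lemma fract_lift_Fract:
  assumes h: "inj_comm_ring_hom h" and b: "b \<noteq> 0"
  shows "fract_lift h (Fract a b) = h a / h b"
proof -
  interpret inj_comm_ring_hom h by fact
  show ?thesis
    unfolding fract_lift_def
  proof (rule some_equality)
    show "\<exists>a' b'. b' \<noteq> 0 \<and> Fract a b = Fract a' b' \<and> h a / h b = h a' / h b'" using b by blast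
    fix v assume "\<exists>a' b'. b' \<noteq> 0 \<and> Fract a b = Fract a' b' \<and> v = h a' / h b'"
    then obtain a' b' where v: "b' \<noteq> 0" "Fract a b = Fract a' b'" "v = h a' / h b'" by blast
    then have "a * b' = a' * b" using b by (simp add: eq_fract)
    then have "h a * h b' = h a' * h b" by (metis hom_mult)
    moreover have "h b \<noteq> 0" "h b' \<noteq> 0" using b v(1) by simp_all
    ultimately show "v = h a / h b" unfolding v(3) by (simp add: frac_eq_eq)
  qed
qed

lemma fract_lift_hom:
  assumes h: "inj_comm_ring_hom (h :: 'a::idom \<Rightarrow> 'b::field)"
  shows "inj_comm_ring_hom (fract_lift h)"
proof -
  interpret inj_comm_ring_hom h by fact
  note L = fract_lift_Fract[OF h]
  show ?thesis
  proof unfold_locales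
    fix x y :: "'a fract"
    obtain a b where x: "x = Fract a b" "b \<noteq> 0" by (cases x)
    obtain c d where y: "y = Fract c d" "d \<noteq> 0" by (cases y)
    have nz: "h b \<noteq> 0" "h d \<noteq> 0" using x y by simp_all
    show "fract_lift h (x + y) = fract_lift h x + fract_lift h y"
      using x(2) y(2) nz by (simp add: x(1) y(1) L hom_distribs field_simps)
    show "fract_lift h (x * y) = fract_lift h x * fract_lift h y"
      using x(2) y(2) by (simp add: x(1) y(1) L hom_distribs)
  next
    show "fract_lift h 1 = 1" by (simp add: One_fract_def L)
    show "fract_lift h 0 = 0" by (simp add: Zero_fract_def L)
  next
    fix x :: "'a fract"
    assume z: "fract_lift h x = 0"
    obtain a b where x: "x = Fract a b" "b \<noteq> 0" by (cases x)
    then have "a = 0" using z by (simp add: L)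
    then show "x = 0" by (simp add: x(1) Zero_fract_def eq_fract x(2))
  qed
qed

section \<open>The coefficient ring and its embedding\<close>

lemma Tvar_inj: "Tvar i = Tvar j \<longleftrightarrow> i = j"
proof
  assume "Tvar i = Tvar j"
  then have "Poly_Mapping.lookup (Tvar i) (Poly_Mapping.single i 1) = Poly_Mapping.lookup (Tvar j) (Poly_Mapping.single i 1)" by simp
  then have "Poly_Mapping.single j (1 :: nat) = Poly_Mapping.single i 1"
    by (simp add: Tvar_def Poly_Mapping.lookup_single when_def split: if_splits)
  then have "Poly_Mapping.lookup (Poly_Mapping.single j (1 :: nat)) i = Poly_Mapping.lookup (Poly_Mapping.single i 1) i" by simp
  then show "i = j" by (simp add: Poly_Mapping.lookup_single when_def split: if_splits)
qed simp

lemma Tvar_nonzero: "Tvar i \<noteq> 0"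
proof
  assume "Tvar i = 0"
  then have "Poly_Mapping.lookup (Tvar i) (Poly_Mapping.single i 1) = 0" by simp
  then show False by (simp add: Tvar_def)
qed

lemma emb_eq_iff: "emb a = emb b \<longleftrightarrow> a = b"
  by (simp add: emb_def eq_fract)

lemma TF_inj: "TF i = TF j \<longleftrightarrow> i = j"
  by (simp add: emb_eq_iff Tvar_inj)

definition Lam_emb :: "Lam \<Rightarrow> Lam fract alg_closure" where
  "Lam_emb c = to_ac (to_fract c)"

definition Lamq_emb :: "Lam poly \<Rightarrow> Lam fract alg_closure poly fract alg_closure" where
  "Lamq_emb p = to_ac (to_fract (map_poly Lam_emb p))"

lemma Lam_emb_hom: "inj_comm_ring_hom Lam_emb"
  by unfold_locales (simp_all add: Lam_emb_def)

lemma Lamq_emb_hom: "inj_comm_ring_hom Lamq_emb"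
proof -
  interpret inj_comm_ring_hom Lam_emb by (rule Lam_emb_hom)
  interpret P: map_poly_inj_comm_ring_hom Lam_emb ..
  show ?thesis by unfold_locales (simp_all add: Lamq_emb_def P.hom_add P.hom_mult)
qed

lemma Lamq_emb_const: "Lamq_emb [:c:] = const_emb (Lam_emb c)"
proof -
  interpret inj_comm_ring_hom Lam_emb by (rule Lam_emb_hom)
  show ?thesis by (simp add: Lamq_emb_def const_emb_def hom_distribs)
qed

lemma Lamq_emb_q: "Lamq_emb [:0, 1:] = generic_q"
proof -
  interpret inj_comm_ring_hom Lam_emb by (rule Lam_emb_hom)
  show ?thesis by (simp add: Lamq_emb_def generic_q_def hom_distribs)
qed

lemma fract_lift_to_fract: 
  assumes "inj_comm_ring_hom h" shows "fract_lift h (to_fract p) = h p"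
proof -
  interpret inj_comm_ring_hom h by fact
  show ?thesis using fract_lift_Fract[OF assms, of 1 p] by (simp add: to_fract_def)
qed

text \<open>
  The generating function of the coefficients is the polynomial itself. In particular the Gromov-Witten
  invariants, summed with their powers of \<open>q\<close>, give back the matrix element that defines them.
\<close>
lemma coefficient_expansion:
  "(\<Sum>d | poly.coeff p d \<noteq> 0. qF ^ d * emb (poly.coeff p d)) = to_fract p"
proof -
  have qd: "qF ^ d = to_fract ([:0, 1:] ^ d)" for d
    by (induction d) (simp_all only: power_0 power_Suc to_fract_1 to_fract_mult qF_def to_fract_def[symmetric])
  have "(\<Sum>d | poly.coeff p d \<noteq> 0. qF ^ d * emb (poly.coeff p d)) = 
     (\<Sum>d\<le>Polynomial.degree p. qF ^ d * emb (poly.coeff p d))"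
    by (rule sum.mono_neutral_left) (auto simp: le_degree emb_def eq_fract simp flip: to_fract_def)
  also have "\<dots> = (\<Sum>d\<le>Polynomial.degree p. to_fract (Polynomial.monom (poly.coeff p d) d))"
    by (intro sum.cong refl) (simp add: qd emb_def monom_altdef mult.commute flip: to_fract_def to_fract_mult)
  also have "\<dots> = to_fract p"
    by (simp only: to_fract_sum[symmetric] poly_as_sum_of_monoms)
  finally show ?thesis .
qed

section \<open>The expansion in factorial Schur functions\<close>

lemma fact_schur_alternant:
  "fact_schur n lam x a = alternant n lam (\<lambda>j. x (Suc j)) a / alternant n (empty_part n) (\<lambda>j. x (Suc j)) a"
proof -
  have "det (mat n n (\<lambda>(i, j). fact_power (x (j + 1)) a (n - (i + 1)))) = 
      alternant n (empty_part n) (\<lambda>j. x (Suc j)) a"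
    unfolding alternant_def by (rule det_mat_cong) (simp add: expo_def)
  then show ?thesis by (simp add: fact_schur_def alternant_def expo_def)
qed

text \<open>
  The hypothesis on \<open>x\<close> keeps the \<open>x\<^sub>i\<close> distinct, nonzero, and away from the roots of \<open>P\<close>: at \<open>T\<^sub>m\<close> the
  product \<open>(x - t\<^sub>1) \<cdots> (x - t\<^sub>N)\<close> vanishes, so \<open>P(T\<^sub>m) = (-1)\<^sup>n q \<noteq> 0\<close>.
\<close>
lemma partition_function_factorial_schur:
  assumes lam: "lam \<in> Parts n k" and mu: "mu \<in> Parts n k"
    and x: "\<And>i. i < n \<Longrightarrow> x (Suc i) = TF (m i)" and m: "\<And>i. i < n \<Longrightarrow> m i \<in> {1..n + k}" "inj_on m {..<n}"
  shows "Z_tilde n k lam mu x = (\<Sum>nu\<in>Parts n k. fact_schur n nu x TF * 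
    to_fract (matrix_element n lam (S_tilde n k (\<lambda>j. [:tvar n k j:]) [:0, 1:] mu) (dual_part k nu)))"
proof -
  let ?N = "n + k"
  define H where "H = fract_lift Lamq_emb"
  interpret h: inj_comm_ring_hom Lamq_emb by (rule Lamq_emb_hom)
  interpret l: inj_comm_ring_hom Lam_emb by (rule Lam_emb_hom)
  interpret c: inj_comm_ring_hom "const_emb :: Lam fract alg_closure \<Rightarrow> _" by (rule const_emb_hom)
  have H_hom: "inj_comm_ring_hom H" unfolding H_def by (rule fract_lift_hom[OF Lamq_emb_hom])
  interpret H: inj_comm_ring_hom H by (rule H_hom)
  have H_fract: "H (to_fract p) = Lamq_emb p" for p
    unfolding H_def by (rule fract_lift_to_fract[OF Lamq_emb_hom])
  have H_emb: "H (emb v) = const_emb (Lam_emb v)" for v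
    using H_fract[of "[:v:]"] by (simp add: emb_def to_fract_def Lamq_emb_const)
  have H_q: "H qF = generic_q" using H_fract[of "[:0, 1:]"] by (simp add: qF_def to_fract_def Lamq_emb_q)
  let ?s = "\<lambda>i. Lam_emb (tvar n k i)"
  let ?a = "\<lambda>i. const_emb (?s i)"
  let ?b = "\<lambda>i. H (TF i)"
  let ?xi = "\<lambda>i. H (x (Suc i))"
  have s: "inj_on ?s {1..?N}" 
    by (rule inj_onI) (auto simp: tvar_def Tvar_inj)
  have "(- 1 :: Lam fract alg_closure) ^ n \<noteq> 0" by simp
  then obtain y where y: "inj_on y {..<?N}" 
    "\<And>r. r < ?N \<Longrightarrow> fact_power (y r) ?a ?N + const_emb ((- 1) ^ n) * generic_q = 0"
    using distinct_bethe_roots[OF s] by metis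
  have y': "fact_power (y r) ?a ?N + (- 1) ^ n * generic_q = 0" if "r < ?N" for r
    using y(2)[OF that] by (simp add: c.hom_power c.hom_uminus)
  have ab: "?b i = ?a (?N + 1 - i)" if "1 \<le> i" "i \<le> ?N" for i
    using that by (simp add: H_emb tvar_def)
  have xi: "?xi i \<noteq> 0" if "i < n" for i
    using x[OF that] Tvar_nonzero[of "m i"] emb_eq_iff[of "Tvar (m i)" 0] by (simp add: emb_def Zero_fract_def)
  have xi_y: "?xi i \<noteq> y r" if "i < n" "r < ?N" for i r
  proof
    assume eq: "?xi i = y r"
    have mi: "1 \<le> m i" "m i \<le> ?N" using m(1)[OF that(1)] by auto
    have "y r = ?a (?N + 1 - m i)" using ab[OF mi] x[OF that(1)] eq by simp
    moreover have "?N + 1 - m i \<in> {1..?N}" using mi by auto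
    ultimately have "fact_power (y r) ?a ?N = 0" unfolding fact_power_def by (intro prod_zero) auto
    then have "generic_q = (0 :: Lam fract alg_closure poly fract alg_closure)" using y'[OF that(2)] by simp
    then show False using generic_q_transcendental[of 1 "0 :: Lam fract alg_closure"] by simp
  qed
  have alt: "H (alternant n nu (\<lambda>j. x (Suc j)) TF) = alternant n nu ?xi ?b" for nu
    by (simp add: alternant_def H.det_mat_hom H.fact_power_hom)
  let ?w = "\<lambda>nu. matrix_element n lam (S_tilde n k (\<lambda>j. [:tvar n k j:]) [:0, 1:] mu) (dual_part k nu)"
  let ?al = "alternant n (empty_part n) (\<lambda>j. x (Suc j)) TF"
  have "alternant n (empty_part n) ?xi ?b * ((\<Prod>i<n. ?xi i) ^ k *
       H (matrix_element n lam (foldr (\<lambda>i. H_op ?N (tF n k) qF (inverse (x i))) (rev [1..<n + 1])) mu)) =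
     (\<Sum>nu\<in>Parts n k. alternant n nu ?xi ?b * Lamq_emb (?w nu))"
    by (rule partition_function_expansion[where y = y and a = ?a and c = generic_q])
      (use y' y(1) ab xi xi_y lam mu in \<open>auto simp: Lamq_emb_const Lamq_emb_q H_emb H_q intro: h.comm_ring_hom_axioms H.comm_ring_hom_axioms\<close>)
  then have "H (?al * Z_tilde n k lam mu x) = H (\<Sum>nu\<in>Parts n k. alternant n nu (\<lambda>j. x (Suc j)) TF * to_fract (?w nu))"
    by (simp add: Z_tilde_def H.hom_mult H.hom_sum H.hom_power H.hom_prod alt H_fract prod.atLeast1_atMost_eq del: upt_Suc)
  then have eq: "?al * Z_tilde n k lam mu x = (\<Sum>nu\<in>Parts n k. alternant n nu (\<lambda>j. x (Suc j)) TF * to_fract (?w nu))"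
    by (simp only: H.eq_iff)
  have "?al \<noteq> 0"
  proof (rule alternant_empty_nonzero, rule inj_onI)
    fix i j assume "i \<in> {..<n}" "j \<in> {..<n}" "x (Suc i) = x (Suc j)"
    then show "i = j" using x TF_inj[of "m i" "m j"] inj_onD[OF m(2), of i j] by auto
  qed
  then show ?thesis
    using eq by (simp add: fact_schur_alternant sum_divide_distrib[symmetric] eq_divide_eq mult.commute)
qed

section \<open>The vanishing property\<close>

lemma at_part_expo: "i < n \<Longrightarrow> at_part n b rho (Suc i) = b (Suc (expo n rho i))"
  by (simp add: at_part_def expo_def) (metis Suc_diff_Suc Suc_eq_plus1 add.commute less_imp_le trans_less_add2)

text \<open>
  If \<open>\<beta>\<^sub>l > \<rho>\<^sub>l\<close>, the factorial powers in the rows up to \<open>l\<close> are long enough to contain a zero factor at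
  all points of the columns from \<open>l\<close> on.
\<close>
lemma alternant_vanishing:
  fixes b :: "nat \<Rightarrow> 'a::comm_ring_1"
  assumes be: "be \<in> Parts n k" and rho: "rho \<in> Parts n k" and "\<not> subpart be rho"
  shows "alternant n be (\<lambda>j. at_part n b rho (Suc j)) b = 0"
proof -
  obtain l0 where l0: "l0 < n" "rho ! l0 < be ! l0" using not_subpart_obtain[OF rho be assms(3)] .
  show ?thesis unfolding alternant_def
  proof (rule det_upper_right_zero_block[OF l0(1)])
    fix i j assume ij: "i \<le> l0" "l0 \<le> j" "j < n"
    have "be ! l0 \<le> be ! i" "rho ! j \<le> rho ! l0"
      using Parts_nth_mono[OF be ij(1) l0(1)] Parts_nth_mono[OF rho ij(2,3)] by auto
    then have "Suc (expo n rho j) \<in> {1..expo n be i}" using l0 ij by (simp add: expo_def)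
    then show "fact_power (at_part n b rho (Suc j)) b (expo n be i) = 0"
      unfolding fact_power_def at_part_expo[OF ij(3)] by (intro prod_zero) auto
  qed
qed

lemma alternant_diagonal_nonzero:
  fixes b :: "nat \<Rightarrow> 'a::idom"
  assumes rho: "rho \<in> Parts n k" and b: "inj b"
  shows "alternant n rho (\<lambda>j. at_part n b rho (Suc j)) b \<noteq> 0"
proof -
  have "alternant n rho (\<lambda>j. at_part n b rho (Suc j)) b = (\<Prod>i<n. fact_power (at_part n b rho (Suc i)) b (expo n rho i))"
    unfolding alternant_def
  proof (rule det_mat_lower_triangular)
    fix i j assume ij: "i < j" "j < n"
    then have "Suc (expo n rho j) \<in> {1..expo n rho i}" using expo_strict[OF rho ij] by simp
    then show "fact_power (at_part n b rho (Suc j)) b (expo n rho i) = 0"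
      unfolding fact_power_def at_part_expo[OF ij(2)] by (intro prod_zero) auto
  qed
  also have "\<dots> \<noteq> 0"
    using b by (auto simp: fact_power_def at_part_expo dest: injD)
  finally show ?thesis .
qed

lemma fact_schur_vanishing:
  assumes "be \<in> Parts n k" "rho \<in> Parts n k" "\<not> subpart be rho"
  shows "fact_schur n be (at_part n b rho) b = 0"
  using alternant_vanishing[OF assms, of b] by (simp add: fact_schur_alternant)

lemma inj_on_at_part:
  assumes rho: "rho \<in> Parts n k" and b: "inj b"
  shows "inj_on (\<lambda>j. at_part n b rho (Suc j)) {..<n}"
  using inj_onD[OF inj_on_expo[OF rho]] injD[OF b] by (fastforce simp: at_part_expo intro!: inj_onI)

lemma fact_schur_diagonal_nonzero:
  assumes "rho \<in> Parts n k" "inj b"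
  shows "fact_schur n rho (at_part n b rho) b \<noteq> 0"
  using alternant_diagonal_nonzero[OF assms] alternant_empty_nonzero[OF inj_on_at_part[OF assms]] by (simp add: fact_schur_alternant)

section \<open>Solving the triangular system\<close>

lemma subpart_imp_dominated: "subpart al be \<Longrightarrow> dominated al be"
  unfolding subpart_def dominated_def
  by (auto simp: list_all2_lengthD intro!: sum_list_subpart[unfolded subpart_def] list_all2_takeI)

lemma subpart_refl: "subpart al al"
  by (simp add: subpart_def list_all2_refl)

lemma subpart_trans: "subpart al be \<Longrightarrow> subpart be ga \<Longrightarrow> subpart al ga"
  unfolding subpart_def by (rule list_all2_trans[of "(\<le>)" "(\<le>)" "(\<le>)"]) auto

text \<open>
  The values of the partition function at the points \<open>T\<^sub>\<rho>\<close>, \<open>\<rho> \<subseteq> \<nu>\<close>, are the image under \<open>\<gamma>(\<nu>)\<close> of the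
  vector of matrix elements. The order of the listing makes \<open>\<gamma>(\<nu>)\<close> upper triangular and puts \<open>\<nu>\<close> first.
\<close>
lemma det_Gamma_mat:
  assumes lam: "lam \<in> Parts n k" and mu: "mu \<in> Parts n k" and nu: "nu \<in> Parts n k"
    and rs: "index_listing n k nu rs"
  shows "det (Gamma_mat n k lam mu rs) = 
    to_fract (matrix_element n lam (S_tilde n k (\<lambda>j. [:tvar n k j:]) [:0, 1:] mu) (dual_part k nu)) *
    (\<Prod>rho | rho \<in> Parts n k \<and> subpart rho nu. fact_schur n rho (at_part n TF rho) TF)"
proof -
  let ?w = "\<lambda>nu. to_fract (matrix_element n lam (S_tilde n k (\<lambda>j. [:tvar n k j:]) [:0, 1:] mu) (dual_part k nu))"
  let ?s = "\<lambda>be rho. fact_schur n be (at_part n TF rho) TF"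
  let ?l = "length rs"
  have dist: "distinct rs" and set: "set rs = {rho \<in> Parts n k. subpart rho nu}" 
    and sorted: "\<And>i j. i < j \<Longrightarrow> j < ?l \<Longrightarrow> \<not> dominated (rs ! i) (rs ! j)"
    using rs by (auto simp: index_listing_def sorted_wrt_iff_nth_less)
  have rsP: "rs ! r \<in> Parts n k" "subpart (rs ! r) nu" if "r < ?l" for r
    using nth_mem[OF that] set by auto
  have "nu \<in> set rs" using nu subpart_refl set by auto
  then obtain i0 where i0: "i0 < ?l" "rs ! i0 = nu" by (auto simp: in_set_conv_nth)
  then have pos: "0 < ?l" by linarith
  have first: "rs ! 0 = nu"
    using sorted[of 0 i0] i0 subpart_imp_dominated[OF rsP(2)[OF pos]] by (cases "i0 = 0") auto
  have gamma: "gamma_mat n rs \<in> carrier_mat ?l ?l" by (simp add: gamma_mat_def)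
  have inj: "inj TF" by (rule injI) (simp only: TF_inj)
  have Z: "Z_tilde n k lam mu (at_part n TF rho) = (\<Sum>be\<in>set rs. ?s be rho * ?w be)" if rho: "rho \<in> set rs" for rho
  proof -
    have rhoP: "rho \<in> Parts n k" "subpart rho nu" using rho set by auto
    have "Z_tilde n k lam mu (at_part n TF rho) = (\<Sum>be\<in>Parts n k. ?s be rho * ?w be)"
    proof (rule partition_function_factorial_schur[OF lam mu])
      show "at_part n TF rho (Suc i) = TF (Suc (expo n rho i))" if "i < n" for i 
        using at_part_expo[OF that, of TF rho] .
      show "Suc (expo n rho i) \<in> {1..n + k}" if "i < n" for i using expo_less[OF rhoP(1) that] by simp
      show "inj_on (\<lambda>i. Suc (expo n rho i)) {..<n}" 
        using inj_on_expo[OF rhoP(1)] by (auto simp: inj_on_def)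
    qed
    also have "\<dots> = (\<Sum>be\<in>set rs. ?s be rho * ?w be)"
    proof (rule sum.mono_neutral_right[OF finite_Parts])
      show "\<forall>be\<in>Parts n k - set rs. ?s be rho * ?w be = 0"
      proof
        fix be assume "be \<in> Parts n k - set rs"
        then have "be \<in> Parts n k" "\<not> subpart be rho" using subpart_trans[OF _ rhoP(2)] set by auto
        then show "?s be rho * ?w be = 0" using fact_schur_vanishing[OF _ rhoP(1), of be TF] by simp
      qed
    qed (use set in auto)
    finally show ?thesis .
  qed
  let ?x = "vec ?l (\<lambda>r. ?w (rs ! r))"
  have bij: "bij_betw (\<lambda>r. rs ! r) {0..<?l} (set rs)"
    using dist by (simp add: bij_betw_nth atLeast0LessThan)
  have "gamma_mat n rs *\<^sub>v ?x = vec ?l (\<lambda>r. Z_tilde n k lam mu (at_part n TF (rs ! r)))"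
  proof (rule eq_vecI)
    fix r assume "r < dim_vec (vec ?l (\<lambda>r. Z_tilde n k lam mu (at_part n TF (rs ! r))))"
    then have r: "r < ?l" by simp
    have "(gamma_mat n rs *\<^sub>v ?x) $ r = (\<Sum>c = 0..<?l. ?s (rs ! c) (rs ! r) * ?w (rs ! c))"
      using r by (simp add: gamma_mat_def scalar_prod_def)
    also have "\<dots> = (\<Sum>be\<in>set rs. ?s be (rs ! r) * ?w be)"
      by (rule sum.reindex_bij_betw[OF bij])
    finally show "(gamma_mat n rs *\<^sub>v ?x) $ r = vec ?l (\<lambda>r. Z_tilde n k lam mu (at_part n TF (rs ! r))) $ r"
      using r Z[OF nth_mem[OF r]] by simp
  qed (simp add: gamma_mat_def)
  then have "det (Gamma_mat n k lam mu rs) = ?x $ 0 * det (gamma_mat n rs)"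
    unfolding Gamma_mat_def using cramer_lemma_mat[OF gamma, of ?x 0] pos by simp
  also have "?x $ 0 = ?w nu" using pos first by simp
  also have "det (gamma_mat n rs) = (\<Prod>r<?l. ?s (rs ! r) (rs ! r))"
    unfolding gamma_mat_def
  proof (rule det_mat_upper_triangular)
    fix r c assume "c < r" "r < ?l"
    then show "?s (rs ! c) (rs ! r) = 0"
      using sorted[of c r] subpart_imp_dominated[of "rs ! c" "rs ! r"] rsP[of c] rsP[of r] by (intro fact_schur_vanishing) auto
  qed
  also have "\<dots> = (\<Prod>rho\<in>set rs. ?s rho rho)"
    using prod.reindex_bij_betw[OF bij, of "\<lambda>rho. ?s rho rho"] by (simp add: atLeast0LessThan)
  finally show ?thesis using set by simp
qed

text \<open>
  The point is \<open>(T\<^sub>1, \<dots>, T\<^sub>n)\<close>. If \<open>\<nu> \<noteq> \<emptyset>\<close>, the first row of the alternant of \<open>\<nu>\<close> has exponent at least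
  \<open>n\<close>, so that each of its entries contains a zero factor.
\<close>
lemma Z_tilde_at_t:
  assumes lam: "lam \<in> Parts n k" and mu: "mu \<in> Parts n k"
  shows "Z_tilde n k lam mu (at_part n (tF n k) (replicate n k)) = 
    to_fract (matrix_element n lam (S_tilde n k (\<lambda>j. [:tvar n k j:]) [:0, 1:] mu) (replicate n k))"
proof -
  let ?x = "at_part n (tF n k) (replicate n k)"
  let ?w = "\<lambda>nu. to_fract (matrix_element n lam (S_tilde n k (\<lambda>j. [:tvar n k j:]) [:0, 1:] mu) (dual_part k nu))"
  have x: "?x (Suc i) = TF (Suc i)" if "i < n" for i
    using that by (simp add: at_part_def tvar_def)
  have one: "fact_schur n (empty_part n) ?x TF = 1"
  proof -
    have "alternant n (empty_part n) (\<lambda>j. ?x (Suc j)) TF \<noteq> 0"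
      by (rule alternant_empty_nonzero) (auto simp: inj_on_def x TF_inj)
    then show ?thesis by (simp add: fact_schur_alternant)
  qed
  have zero: "fact_schur n nu ?x TF = 0" if nu: "nu \<in> Parts n k" "nu \<noteq> empty_part n" for nu
  proof -
    have "\<exists>i<n. 0 < nu ! i"
    proof (rule ccontr)
      assume "\<not> (\<exists>i<n. 0 < nu ! i)"
      then have "nu = empty_part n" using Parts_length[OF nu(1)] by (intro nth_equalityI) auto
      then show False using nu(2) by simp
    qed
    then obtain i where "i < n" "0 < nu ! i" by blast
    then have n: "0 < n" "0 < nu ! 0" using Parts_nth_mono[OF nu(1), of 0 i] by auto
    have "alternant n nu (\<lambda>j. ?x (Suc j)) TF = 0"
      unfolding alternant_def
    proof (rule det_upper_right_zero_block[OF n(1)])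
      fix i j :: nat assume "i \<le> 0" "0 \<le> j" "j < n"
      moreover have "Suc j \<in> {1..expo n nu 0}" using n \<open>j < n\<close> by (simp add: expo_def)
      ultimately show "fact_power (?x (Suc j)) TF (expo n nu i) = 0"
        unfolding fact_power_def by (intro prod_zero) (auto simp: x)
    qed
    then show ?thesis by (simp add: fact_schur_alternant)
  qed
  have "Z_tilde n k lam mu ?x = (\<Sum>nu\<in>Parts n k. fact_schur n nu ?x TF * ?w nu)"
    by (rule partition_function_factorial_schur[where m = Suc, OF lam mu x]) auto
  also have "\<dots> = (\<Sum>nu\<in>Parts n k. if nu = empty_part n then ?w nu else 0)"
    by (intro sum.cong refl) (use zero one in auto)
  also have "\<dots> = ?w (empty_part n)"
    using replicate_Parts[of 0 k n] by (simp add: finite_Parts)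
  finally show ?thesis by (simp add: dual_part_def)
qed

theorem corollary6p29:
  fixes n k :: nat and lam mu nu :: "nat list"
  assumes "lam \<in> Parts n k" and "mu \<in> Parts n k" and "nu \<in> Parts n k"
  shows "(\<forall>rs. index_listing n k nu rs \<longrightarrow>
            (\<Sum>d | GW n k mu (dual_part k nu) lam d \<noteq> 0.
                qF ^ d * emb (GW n k mu (dual_part k nu) lam d)) =
            det (Gamma_mat n k lam mu rs) /
            (\<Prod>rho | rho \<in> Parts n k \<and> subpart rho nu.
                fact_schur n rho (at_part n TF rho) TF)) \<and>
         (\<Sum>d | GW n k mu (replicate n k) lam d \<noteq> 0.
             qF ^ d * emb (GW n k mu (replicate n k) lam d)) =
         Z_tilde n k lam mu (at_part n (tF n k) (replicate n k))"
proof (intro conjI allI impI)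
  fix rs assume rs: "index_listing n k nu rs"
  have "inj TF" by (rule injI) (simp only: TF_inj)
  then have "(\<Prod>rho | rho \<in> Parts n k \<and> subpart rho nu. fact_schur n rho (at_part n TF rho) TF) \<noteq> 0"
    using fact_schur_diagonal_nonzero by (auto simp: finite_Parts)
  then show "(\<Sum>d | GW n k mu (dual_part k nu) lam d \<noteq> 0. qF ^ d * emb (GW n k mu (dual_part k nu) lam d)) =
            det (Gamma_mat n k lam mu rs) / (\<Prod>rho | rho \<in> Parts n k \<and> subpart rho nu. fact_schur n rho (at_part n TF rho) TF)"
    unfolding GW_def coefficient_expansion det_Gamma_mat[OF assms rs] by simp
next
  show "(\<Sum>d | GW n k mu (replicate n k) lam d \<noteq> 0. qF ^ d * emb (GW n k mu (replicate n k) lam d)) =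
         Z_tilde n k lam mu (at_part n (tF n k) (replicate n k))"
    by (simp add: GW_def coefficient_expansion Z_tilde_at_t[OF assms(1,2)])
qed

end
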